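(* Let $(p_n)_{n\in\mathbb Z}$ be a strictly increasing doubly infinite sequence of real numbers such that (a) $\cdots<p_{-2}<p_{-1}<0\le p_0<p_1<\cdots$; (b) the limit $\lim_{S\to\infty}\sum_{0<|p_n|<S}\frac1{p_n}$ exists (as a finite number); (c) $\lim_{n\to\pm\infty}\frac{p_n}{n}=1$. For $R>0$ let $N(R):=\#\{p_n \mid |p_n|\le R\}$ and let $\rho_R$ be the weight on $[-R,R]$ given by $$\rho_R(t)=\lim_{S\to\infty}\prod_{R<|p_n|<S}\Bigl(1-\frac{t}{p_n}\Bigr)^2,\qquad t\in[-R,R].$$ Then $$\lim_{R\to\infty}K_{N(R)}(x,y;\rho_R)=\frac{\sin\pi(x-y)}{\pi(x-y)}$$ uniformly for $x$ and $y$ in compact subsets of the real line.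
   Context: For a non-negative weight function $w$ on $\mathbb R$ (a weight given on an interval being regarded as zero outside it) with $\int|t|^n w(t)\,dt<\infty$ for all $n\ge0$, $(\varphi_j(\cdot;w))_{j\ge0}$ denotes the sequence of orthonormal polynomials: $\varphi_j(\cdot;w)$ is a polynomial of degree $j$ with positive leading coefficient and $\int\varphi_j(t;w)\varphi_k(t;w)w(t)\,dt=\delta_{jk}$. For $N\ge1$ the kernel is $$K_N(x,y;w)=\sqrt{w(x)w(y)}\sum_{j=0}^{N-1}\varphi_j(x;w)\varphi_j(y;w).$$ The limit defining $\rho_R$ exists because of assumption (b). The sine kernel $\frac{\sin\pi(x-y)}{\pi(x-y)}$ is understood to equal $1$ when $x=y$. *)

theory Defs
  imports "HOL-Analysis.Analysis" "HOL-Computational_Algebra.Polynomial"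
begin

(* has_bochner_integral rather than an equation between integrals, so that every integral
   occurring here is required to exist. *)
definition orthonormal_polys :: "(real \<Rightarrow> real) \<Rightarrow> (nat \<Rightarrow> real poly) \<Rightarrow> bool" where
  "orthonormal_polys w \<phi> \<longleftrightarrow>
     (\<forall>j. degree (\<phi> j) = j \<and> lead_coeff (\<phi> j) > 0) \<and>
     (\<forall>j k. has_bochner_integral lborel (\<lambda>t. poly (\<phi> j) t * poly (\<phi> k) t * w t)
              (if j = k then 1 else 0))"

(* By Gram-Schmidt the sequence exists and is unique when w is a measurable non-negative function
   with finite moments that is not almost everywhere zero;
   for other w the value is unspecified. *)
definition orthonormal_poly :: "(real \<Rightarrow> real) \<Rightarrow> nat \<Rightarrow> real poly" where
  "orthonormal_poly w = (THE \<phi>. orthonormal_polys w \<phi>)"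

definition orthonormal_kernel :: "(real \<Rightarrow> real) \<Rightarrow> nat \<Rightarrow> real \<Rightarrow> real \<Rightarrow> real" where
  "orthonormal_kernel w N x y =
     sqrt (w x * w y) * (\<Sum>j<N. poly (orthonormal_poly w j) x * poly (orthonormal_poly w j) y)"

definition point_count :: "(int \<Rightarrow> real) \<Rightarrow> real \<Rightarrow> nat" where
  "point_count p R = card {p n | n. \<bar>p n\<bar> \<le> R}"

(* The weight rho_R, extended by zero outside [-R,R]. *)
definition point_weight :: "(int \<Rightarrow> real) \<Rightarrow> real \<Rightarrow> real \<Rightarrow> real" where
  "point_weight p R t =
     (if t \<in> {-R..R}
      then Lim at_top (\<lambda>S. \<Prod>n | R < \<bar>p n\<bar> \<and> \<bar>p n\<bar> < S. (1 - t / p n)\<^sup>2)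
      else 0)"

definition sine_kernel :: "real \<Rightarrow> real \<Rightarrow> real" where
  "sine_kernel x y = (if x = y then 1 else sin (pi * (x - y)) / (pi * (x - y)))"

end

theory Submission
  imports Defs "HOL-Complex_Analysis.Complex_Analysis" "HOL-Probability.Sinc_Integral" "HOL-Real_Asymp.Real_Asymp"
begin

text \<open>The kernel reproduces the functions \<open>q \<surd>\<rho>\<^sub>R\<close>, \<open>q\<close> a polynomial of degree below \<open>N(R)\<close>. By Cauchy--Schwarz in this
  finite-dimensional space it is close to \<open>sinc (\<pi>(x - y))\<close> as soon as evaluation at \<open>y\<close> has squared norm at
  most \<open>1 + o(1)\<close>, and some \<open>q \<surd>\<rho>\<^sub>R\<close> of norm at most \<open>1 + o(1)\<close> is close to \<open>sinc (\<pi>(\<cdot> - y))\<close> on compact sets.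

  Write \<open>\<surd>\<rho>\<^sub>R = G\<close> with \<open>G(z) = \<Prod> (1 - z / p\<^sub>n)\<close> over \<open>\<bar>p\<^sub>n\<bar> > R\<close>. For the evaluation bound, interpolate \<open>q\<close> at the
  lattice \<open>(1 - \<eta>)\<int> + s\<close>, compare the products with the product of the sine, and average over \<open>s\<close>: up to a
  loss \<open>exp (O(\<eta>) R)\<close>, \<open>q G\<close> grows on a disc of radius proportional to \<open>R\<close> like a function of exponential
  type \<open>\<pi> / (1 - \<eta>)\<close>. A Gaussian factor absorbs the loss, and Cauchy's theorem expresses the value at \<open>y\<close> as an
  integral against a cardinal sine. For the approximation, interpolate a Gaussian-damped cardinal sine divided
  by \<open>G\<close> at the lattice \<open>(1 + \<eta>)\<int>\<close>; the Hermite remainder is exponentially small in \<open>R\<close>.\<close>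

section \<open>Comparison with the product of the sine\<close>

text \<open>Condition (c) places p_n only up to o(n), so products can be compared only up to
  exp(o(R)), and every such loss must be beaten by a gain exponential in R. Contours of size
  proportional to R provide it: there the Gaussian gains a fixed multiple of \<kappa> R, and \<eta>
  is taken small compared with \<kappa>. In the disc of radius R/4 all factors 1 - z / p_n stay away
  from 0 and the comparison is two-sided. At real points near \<plusminus>R, which occur as nodes
  and as arguments, the logarithms are unbounded and only monotonicity survives. It needs the
  rescaled points to lie outside the integers paired with them in one estimate and inside them in
  the other; dividing by 1 - \<eta> or by 1 + \<eta> forces this. That is the origin of the two
  lattice spacings. Condition (b) takes care of the linear terms of the logarithms; once they are
  split off, the remainders are summable like 1 / n^2. All estimates concern finitely many factors,
  with a cut-off M chosen after R, and the infinite product is compared with its truncation only at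
  the end.\<close>

lemma sum_inverse_squares_nat:
  fixes n :: nat
  assumes "2 \<le> n"
  shows "(\<Sum>j\<in>{n..<n+k}. 1 / (real j)\<^sup>2) \<le> 1 / (real n - 1) - 1 / (real (n + k) - 1)"
proof (induction k)
  case (Suc k)
  have pos: "real (n + k) > 1" using assms by simp
  have "1 / (real (n + k))\<^sup>2 \<le> 1 / (real (n + k) - 1) - 1 / (real (n + k))"
  proof -
    have "1 / (real (n + k) - 1) - 1 / (real (n + k)) = 1 / (real (n + k) * (real (n + k) - 1))"
      using pos by (simp add: divide_simps)
    moreover have "1 / (real (n + k))\<^sup>2 \<le> 1 / (real (n + k) * (real (n + k) - 1))"
      unfolding power2_eq_square using pos by (intro divide_left_mono mult_left_mono mult_pos_pos) auto
    ultimately show ?thesis by simp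
  qed
  with Suc show ?case by simp
qed (use assms in simp)

lemma sum_inverse_squares_int:
  fixes A :: "int set" and c :: real
  assumes "finite A" "2 \<le> c" "\<And>j. j \<in> A \<Longrightarrow> c \<le> \<bar>real_of_int j\<bar>"
  shows "(\<Sum>j\<in>A. 1 / (real_of_int j)\<^sup>2) \<le> 4 / c"
proof -
  define n where "n = nat \<lceil>c\<rceil>"
  have n2: "2 \<le> n" and nc: "c \<le> real n" using assms(2) unfolding n_def by linarith+
  \<comment> \<open>If |j| determines j, the sum runs over distinct naturals from n on, and n - 1
    \<ge> n / 2 gives 2 / c; the bound 4 / c pays for the two signs.\<close>
  have part: "(\<Sum>j\<in>B. 1 / (real_of_int j)\<^sup>2) \<le> 2 / c"
    if B: "B \<subseteq> A" and inj: "inj_on (\<lambda>j. nat \<bar>j\<bar>) B" for B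
  proof -
    have fB: "finite B" using B assms(1) finite_subset by blast
    define C where "C = (\<lambda>j. nat \<bar>j\<bar>) ` B"
    have "finite C" using fB by (simp add: C_def)
    then obtain K where K: "\<And>x. x \<in> C \<Longrightarrow> x < K" by (meson finite_nat_set_iff_bounded)
    have "n \<le> x" if "x \<in> C" for x
    proof -
      obtain j where j: "j \<in> B" "x = nat \<bar>j\<bar>" using \<open>x \<in> C\<close> unfolding C_def by blast
      have "c \<le> \<bar>real_of_int j\<bar>" using assms(3) B j by auto
      then have "\<lceil>c\<rceil> \<le> \<bar>j\<bar>" by (simp add: ceiling_le_iff)
      then show ?thesis unfolding n_def j by linarith
    qed
    then have Csub: "C \<subseteq> {n..<n+K}" using K by fastforce
    have "(\<Sum>j\<in>B. 1 / (real_of_int j)\<^sup>2) = (\<Sum>x\<in>C. 1 / (real x)\<^sup>2)"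
      unfolding C_def using inj by (subst sum.reindex) (auto simp: o_def)
    also have "\<dots> \<le> (\<Sum>x\<in>{n..<n+K}. 1 / (real x)\<^sup>2)"
      by (rule sum_mono2) (use Csub in auto)
    also have "\<dots> \<le> 1 / (real n - 1) - 1 / (real (n + K) - 1)"
      by (rule sum_inverse_squares_nat[OF n2])
    also have "\<dots> \<le> 1 / (real n - 1)" using n2 by simp
    also have "\<dots> \<le> 2 / real n" using n2 by (simp add: field_simps)
    also have "\<dots> \<le> 2 / c" using nc assms(2) by (simp add: field_simps)
    finally show ?thesis .
  qed
  define Ap where "Ap = {j\<in>A. 0 < j}"
  define An where "An = {j\<in>A. j \<le> 0}"
  have "(\<Sum>j\<in>A. 1 / (real_of_int j)\<^sup>2) = (\<Sum>j\<in>Ap. 1 / (real_of_int j)\<^sup>2) + (\<Sum>j\<in>An. 1 / (real_of_int j)\<^sup>2)"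
    by (subst sum.union_disjoint[symmetric])
       (use assms(1) in \<open>auto simp: Ap_def An_def intro!: sum.cong\<close>)
  also have "\<dots> \<le> 2 / c + 2 / c"
    by (intro add_mono part) (auto simp: Ap_def An_def inj_on_def)
  finally show ?thesis by simp
qed

text \<open>Adding the linear term makes the derivative of \<open>Ln (1 - z) + z\<close> equal to
  \<open>- z / (1 - z)\<close>, which vanishes at 0. Displacing a point near j by a small proportion
  of j therefore costs a term of order 1 / j^2 instead of 1 / j, and such terms can be
  summed.\<close>

lemma ln_norm_one_minus_lipschitz:
  fixes u v :: complex
  assumes "norm u \<le> t" "norm v \<le> t" "t < 1"
  shows "\<bar>(ln (norm (1 - u)) + Re u) - (ln (norm (1 - v)) + Re v)\<bar> \<le> t / (1 - t) * norm (u - v)"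
proof -
  define f where "f = (\<lambda>z::complex. Ln (1 - z) + z)"
  have t0: "0 \<le> t" using assms(1) norm_ge_zero order_trans by blast
  have ne: "1 - z \<noteq> 0" if "norm z \<le> t" for z :: complex
    using that assms(3) by force
  have der: "(f has_field_derivative (- z / (1 - z))) (at z within cball 0 t)" if "z \<in> cball 0 t" for z
  proof -
    have z: "norm z \<le> t" using that by simp
    have "Re z < 1" using z assms(3) complex_Re_le_cmod[of z] by linarith
    then have "1 - z \<notin> \<real>\<^sub>\<le>\<^sub>0" by (auto simp: complex_nonpos_Reals_iff)
    then have "(f has_field_derivative (- (1 / (1 - z)) + 1)) (at z within cball 0 t)"
      unfolding f_def by (auto intro!: derivative_eq_intros simp: divide_inverse)
    moreover have "- (1 / (1 - z)) + 1 = - z / (1 - z)" using ne[OF z] by (simp add: field_simps)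
    ultimately show ?thesis by simp
  qed
  have bd: "norm (- z / (1 - z)) \<le> t / (1 - t)" if "z \<in> cball 0 t" for z :: complex
  proof -
    have z: "norm z \<le> t" using that by simp
    have "1 - t \<le> norm (1 - z)" using z norm_triangle_ineq2[of "1::complex" z] by simp
    then show ?thesis using z assms(3) t0 by (simp add: norm_divide frac_le)
  qed
  have "norm (f u - f v) \<le> t / (1 - t) * norm (u - v)"
    by (rule field_differentiable_bound[OF _ der bd]) (use assms in auto)
  moreover have "Re (f z) = ln (norm (1 - z)) + Re z" if "norm z \<le> t" for z
    using ne[OF that] by (simp add: f_def)
  ultimately show ?thesis
    using abs_Re_le_cmod[of "f u - f v"] assms(1,2) by simp
qed

text \<open>The map \<open>x \<mapsto> ln (1 - x) + x\<close> increases up to 0 and decreases on [0,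
  1). Monotonicity involves no constant that degenerates as v approaches 1, so it serves for factors
  arbitrarily close to zero, where a Lipschitz bound fails.\<close>

lemma ln_one_minus_plus_antimono:
  fixes u v :: real
  assumes "0 \<le> u * v" "\<bar>u\<bar> \<le> \<bar>v\<bar>" "v < 1"
  shows "ln (1 - v) + v \<le> ln (1 - u) + u"
proof -
  have der: "((\<lambda>x::real. ln (1 - x) + x) has_real_derivative (- x / (1 - x))) (at x)" if "x < 1" for x
    using that by (auto intro!: derivative_eq_intros simp: field_simps)
  show ?thesis
  proof (cases "0 \<le> v")
    case True
    then have uv: "u \<le> v" "0 \<le> u \<or> v = 0" using assms
      by (auto simp: zero_le_mult_iff)
    then have u: "0 \<le> u" using assms True by force
    show ?thesis
    proof (rule DERIV_nonpos_imp_nonincreasing[OF uv(1)])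
      fix x assume "u \<le> x" "x \<le> v"
      then show "\<exists>y. ((\<lambda>x. ln (1 - x) + x) has_real_derivative y) (at x) \<and> y \<le> 0"
        using der[of x] assms u by (intro exI[of _ "- x / (1 - x)"]) (auto simp: divide_nonpos_pos)
    qed
  next
    case False
    then have uv: "v \<le> u" "u \<le> 0" using assms by (auto simp: zero_le_mult_iff)
    show ?thesis
    proof (rule DERIV_nonneg_imp_nondecreasing[OF uv(1)])
      fix x assume "v \<le> x" "x \<le> u"
      then show "\<exists>y. ((\<lambda>x. ln (1 - x) + x) has_real_derivative y) (at x) \<and> 0 \<le> y"
        using der[of x] assms uv by (intro exI[of _ "- x / (1 - x)"]) (auto simp: divide_nonpos_pos)
    qed
  qed
qed

text \<open>The price of an index without a partner: its factor lowers the corrected logarithm by at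
  most \<open>1 - ln c\<close>.\<close>

lemma ln_one_minus_plus_ge:
  fixes x c :: real
  assumes "0 < c" "\<bar>x\<bar> \<le> 1 - c"
  shows "ln c - 1 \<le> ln (1 - x) + x"
proof -
  have "ln c \<le> ln (1 - x)" using assms by auto
  moreover have "-1 \<le> x" using assms by auto
  ultimately show ?thesis by simp
qed

section \<open>Products over index sets compared with products over symmetric shells\<close>

lemma prod_eq_exp_sum_ln:
  assumes "finite A" "\<And>j. j \<in> A \<Longrightarrow> 0 < f j"
  shows "(\<Prod>j\<in>A. f j) = exp (\<Sum>j\<in>A. ln (f j :: real))"
  using assms by (simp add: exp_sum)

text \<open>Symmetric, so that the sum of 1 / j over it vanishes, and half open, so that
  \<open>shell 0 m\<close> and \<open>shell m M\<close> partition \<open>shell 0 M\<close> for 0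
  \<le> m \<le> M.\<close>

definition shell :: "int \<Rightarrow> int \<Rightarrow> int set" where
  "shell m M = {j. m < \<bar>j\<bar> \<and> \<bar>j\<bar> \<le> M}"

lemma finite_shell [simp]: "finite (shell m M)"
  by (rule finite_subset[of _ "{-M..M}"]) (auto simp: shell_def)

lemma sum_inverse_shell [simp]: "(\<Sum>j\<in>shell m M. 1 / real_of_int j) = 0"
proof -
  have "(\<Sum>j\<in>shell m M. 1 / real_of_int j) = (\<Sum>j\<in>shell m M. - (1 / real_of_int j))"
    by (rule sum.reindex_bij_witness[of _ uminus uminus]) (auto simp: shell_def)
  then show ?thesis by (simp add: sum_negf)
qed

text \<open>All quotients w / j and w / r j have modulus at most 5/8, so the logarithms corrected by
  their linear terms are Lipschitz. Common indices cost \<eta> R^2 times the sum of 1 / j^2 over |j|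
  \<ge> R / 2, hence a multiple of \<eta> R. Each index lying in only one of the two sets costs at
  most 5/4, and there are at most \<eta> R of them on either side. The linear terms cancel over the
  shell and are controlled over I by hypothesis. The total 9/2 + 5/4 + 5/4 + 1/4 is rounded up to
  8.\<close>

lemma prod_compare_complex:
  fixes r :: "int \<Rightarrow> real" and w :: complex and R \<eta> :: real and I :: "int set" and m M :: int
  assumes "finite I" and R: "8 \<le> R" and eta: "0 < \<eta>" "\<eta> \<le> 1/10"
    and I: "\<And>j. j \<in> I \<Longrightarrow> R / 2 \<le> \<bar>real_of_int j\<bar>"
    and m: "R / 2 \<le> real_of_int m"
    and r: "\<And>j. j \<in> I \<Longrightarrow> \<bar>r j - real_of_int j\<bar> \<le> 2 * \<eta> * \<bar>real_of_int j\<bar>"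
    and sum_r: "\<bar>\<Sum>j\<in>I. 1 / r j\<bar> \<le> \<eta>"
    and card: "real (card (I - shell m M)) \<le> \<eta> * R" "real (card (shell m M - I)) \<le> \<eta> * R"
    and w: "norm w \<le> R / 4"
  shows "\<bar>(\<Sum>j\<in>I. ln (norm (1 - w / of_real (r j)))) - (\<Sum>j\<in>shell m M. ln (norm (1 - w / of_int j)))\<bar>
         \<le> 8 * \<eta> * R"
proof -
  define Z where "Z = shell m M"
  have fZ: "finite Z" by (simp add: Z_def)
  have Zj: "R / 2 \<le> \<bar>real_of_int j\<bar>" if "j \<in> Z" for j
    using that m by (auto simp: Z_def shell_def)
  define \<psi> where "\<psi> = (\<lambda>u::complex. ln (norm (1 - u)) + Re u)"
  have lip: "\<bar>\<psi> u - \<psi> v\<bar> \<le> 8/3 * t * norm (u - v)" if "norm u \<le> t" "norm v \<le> t" "t \<le> 5/8" for u v t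
  proof -
    have t0: "0 \<le> t" using that norm_ge_zero order_trans by blast
    have "\<bar>\<psi> u - \<psi> v\<bar> \<le> t / (1 - t) * norm (u - v)"
      unfolding \<psi>_def by (rule ln_norm_one_minus_lipschitz) (use that in auto)
    also have "t / (1 - t) \<le> 8/3 * t"
    proof -
      have "t / (1 - t) \<le> t / (3/8)" using that t0 by (intro divide_left_mono) auto
      then show ?thesis by simp
    qed
    finally show ?thesis by (simp add: mult_right_mono)
  qed
  have \<psi>0: "\<bar>\<psi> u\<bar> \<le> 5/4" if "norm u \<le> 5/8" for u
  proof -
    have "\<bar>\<psi> u - \<psi> 0\<bar> \<le> 8/3 * (5/8) * norm (u - 0)"
      by (rule lip) (use that in auto)
    then show ?thesis using that by (simp add: \<psi>_def)
  qed
  have rj: "4/5 * \<bar>real_of_int j\<bar> \<le> \<bar>r j\<bar>" if "j \<in> I" for j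
  proof -
    have "2 * \<eta> * \<bar>real_of_int j\<bar> \<le> 1/5 * \<bar>real_of_int j\<bar>"
      using eta by (intro mult_right_mono) auto
    then show ?thesis using r[OF that] by linarith
  qed
  have wr: "norm (w / of_real (r j)) \<le> 5/4 * (norm w / \<bar>real_of_int j\<bar>)" if "j \<in> I" for j
  proof -
    have "0 < \<bar>real_of_int j\<bar>" using I[OF that] R by linarith
    moreover have "norm w / \<bar>r j\<bar> \<le> norm w / (4/5 * \<bar>real_of_int j\<bar>)"
      using calculation rj[OF that] by (intro divide_left_mono) auto
    ultimately show ?thesis by (simp add: norm_divide)
  qed
  have wj: "norm w / \<bar>real_of_int j\<bar> \<le> 1/2" if "R / 2 \<le> \<bar>real_of_int j\<bar>" for j
    using that w R by (simp add: divide_simps)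
  have term_bd: "\<bar>\<psi> (w / of_real (r j)) - \<psi> (w / of_int j)\<bar> \<le> 9/16 * \<eta> * R\<^sup>2 * (1 / (real_of_int j)\<^sup>2)"
    if j: "j \<in> I" for j
  proof -
    define a where "a = norm w / \<bar>real_of_int j\<bar>"
    have jpos: "0 < \<bar>real_of_int j\<bar>" using I[OF j] R by linarith
    have rpos: "0 < \<bar>r j\<bar>" using rj[OF j] jpos by linarith
    have a0: "0 \<le> a" by (simp add: a_def)
    have nd: "norm (w / of_real (r j) - w / of_int j) \<le> a * (5/2 * \<eta>)"
    proof -
      have "w / of_real (r j) - w / of_int j = w * of_real (real_of_int j - r j) / (of_real (r j) * of_int j)"
        using jpos rpos by (simp add: field_simps)
      then have "norm (w / of_real (r j) - w / of_int j) = a * (\<bar>r j - real_of_int j\<bar> / \<bar>r j\<bar>)"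
        by (simp only: norm_divide norm_mult norm_of_real norm_of_int a_def) (simp add: abs_minus_commute)
      also have "\<bar>r j - real_of_int j\<bar> / \<bar>r j\<bar> \<le> 2 * \<eta> * \<bar>real_of_int j\<bar> / (4/5 * \<bar>real_of_int j\<bar>)"
        by (rule frac_le) (use r[OF j] rj[OF j] jpos eta in auto)
      also have "\<dots> = 5/2 * \<eta>" using jpos by (simp add: field_simps)
      finally show ?thesis using a0 by (simp add: mult_left_mono)
    qed
    have "\<bar>\<psi> (w / of_real (r j)) - \<psi> (w / of_int j)\<bar> \<le>
          8/3 * (5/4 * a) * norm (w / of_real (r j) - w / of_int j)"
    proof (rule lip)
      show "norm (w / of_real (r j)) \<le> 5/4 * a" using wr[OF j] by (simp add: a_def)
      have "norm (w / of_int j) = a" by (simp add: norm_divide a_def)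
      then show "norm (w / of_int j) \<le> 5/4 * a" using a0 by simp
      show "5/4 * a \<le> 5/8" using wj[OF I[OF j]] unfolding a_def by linarith
    qed
    also have "\<dots> \<le> 8/3 * (5/4 * a) * (a * (5/2 * \<eta>))"
      using nd a0 by (intro mult_left_mono) auto
    also have "8/3 * (5/4 * a) * (a * (5/2 * \<eta>)) \<le> 9 * \<eta> * a\<^sup>2"
      using a0 eta by (simp add: power2_eq_square)
    also have "a\<^sup>2 = (norm w)\<^sup>2 * (1 / (real_of_int j)\<^sup>2)" by (simp add: a_def power_divide)
    also have "9 * \<eta> * ((norm w)\<^sup>2 * (1 / (real_of_int j)\<^sup>2)) \<le> 9 * \<eta> * ((R/4)\<^sup>2 * (1 / (real_of_int j)\<^sup>2))"
      using eta w by (intro mult_left_mono mult_right_mono power_mono) auto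
    finally have "\<bar>\<psi> (w / of_real (r j)) - \<psi> (w / of_int j)\<bar> \<le> 9 * \<eta> * ((R/4)\<^sup>2 * (1 / (real_of_int j)\<^sup>2))"
      .
    then show ?thesis by (simp add: power_divide)
  qed
  have c1: "\<bar>\<Sum>j\<in>I\<inter>Z. \<psi> (w / of_real (r j)) - \<psi> (w / of_int j)\<bar> \<le> 9/2 * \<eta> * R"
  proof -
    have "\<bar>\<Sum>j\<in>I\<inter>Z. \<psi> (w / of_real (r j)) - \<psi> (w / of_int j)\<bar>
        \<le> (\<Sum>j\<in>I\<inter>Z. 9/16 * \<eta> * R\<^sup>2 * (1 / (real_of_int j)\<^sup>2))"
      using term_bd by (intro order_trans[OF sum_abs] sum_mono) auto
    also have "\<dots> = 9/16 * \<eta> * R\<^sup>2 * (\<Sum>j\<in>I\<inter>Z. 1 / (real_of_int j)\<^sup>2)" by (simp add: sum_distrib_left)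
    also have "\<dots> \<le> 9/16 * \<eta> * R\<^sup>2 * (4 / (R/2))"
      using eta assms(1) I R by (intro mult_left_mono sum_inverse_squares_int) auto
    also have "\<dots> = 9/2 * \<eta> * R" using R by (simp add: power2_eq_square)
    finally show ?thesis .
  qed
  have c2: "\<bar>\<Sum>j\<in>I-Z. \<psi> (w / of_real (r j))\<bar> \<le> 5/4 * (\<eta> * R)"
  proof -
    have "\<bar>\<psi> (w / of_real (r j))\<bar> \<le> 5/4" if "j \<in> I" for j
      using wr[OF that] wj[OF I[OF that]] by (intro \<psi>0) linarith
    then have "\<bar>\<Sum>j\<in>I-Z. \<psi> (w / of_real (r j))\<bar> \<le> (\<Sum>j\<in>I-Z. 5/4)"
      by (intro order_trans[OF sum_abs] sum_mono) auto
    then show ?thesis using card(1) by (simp add: Z_def)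
  qed
  have c3: "\<bar>\<Sum>j\<in>Z-I. \<psi> (w / of_int j)\<bar> \<le> 5/4 * (\<eta> * R)"
  proof -
    have "\<bar>\<psi> (w / of_int j)\<bar> \<le> 5/4" if "j \<in> Z" for j
    proof (rule \<psi>0)
      have "norm (w / of_int j) = norm w / \<bar>real_of_int j\<bar>" by (simp add: norm_divide)
      then show "norm (w / of_int j) \<le> 5/8" using wj[OF Zj[OF that]] by linarith
    qed
    then have "\<bar>\<Sum>j\<in>Z-I. \<psi> (w / of_int j)\<bar> \<le> (\<Sum>j\<in>Z-I. 5/4)"
      by (intro order_trans[OF sum_abs] sum_mono) auto
    then show ?thesis using card(2) by (simp add: Z_def)
  qed
  have e1: "(\<Sum>j\<in>I. ln (norm (1 - w / of_real (r j)))) =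
      (\<Sum>j\<in>I\<inter>Z. \<psi> (w / of_real (r j))) + (\<Sum>j\<in>I-Z. \<psi> (w / of_real (r j))) - Re w * (\<Sum>j\<in>I. 1 / r j)"
  proof -
    have "(\<Sum>j\<in>I. ln (norm (1 - w / of_real (r j)))) = (\<Sum>j\<in>I. \<psi> (w / of_real (r j)) - Re w * (1 / r j))"
      by (intro sum.cong) (auto simp: \<psi>_def)
    also have "\<dots> = (\<Sum>j\<in>I. \<psi> (w / of_real (r j))) - Re w * (\<Sum>j\<in>I. 1 / r j)"
      by (simp add: sum_subtractf sum_distrib_left)
    also have "(\<Sum>j\<in>I. \<psi> (w / of_real (r j))) = (\<Sum>j\<in>I\<inter>Z. \<psi> (w / of_real (r j))) + (\<Sum>j\<in>I-Z. \<psi> (w / of_real (r j)))"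
      by (rule sum.Int_Diff[OF assms(1)])
    finally show ?thesis .
  qed
  have e2: "(\<Sum>j\<in>Z. ln (norm (1 - w / of_int j))) =
      (\<Sum>j\<in>I\<inter>Z. \<psi> (w / of_int j)) + (\<Sum>j\<in>Z-I. \<psi> (w / of_int j))"
  proof -
    have "(\<Sum>j\<in>Z. ln (norm (1 - w / of_int j))) = (\<Sum>j\<in>Z. \<psi> (w / of_int j) - Re w * (1 / real_of_int j))"
    proof (intro sum.cong refl)
      fix j show "ln (norm (1 - w / of_int j)) = \<psi> (w / of_int j) - Re w * (1 / real_of_int j)"
        using Re_divide_of_real[of w "real_of_int j"] by (simp add: \<psi>_def)
    qed
    also have "\<dots> = (\<Sum>j\<in>Z. \<psi> (w / of_int j)) - Re w * (\<Sum>j\<in>Z. 1 / real_of_int j)"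
      by (simp add: sum_subtractf sum_distrib_left)
    also have "(\<Sum>j\<in>Z. 1 / real_of_int j) = 0" by (simp add: Z_def)
    also have "(\<Sum>j\<in>Z. \<psi> (w / of_int j)) = (\<Sum>j\<in>Z\<inter>I. \<psi> (w / of_int j)) + (\<Sum>j\<in>Z-I. \<psi> (w / of_int j))"
      by (rule sum.Int_Diff[OF fZ])
    finally show ?thesis by (simp add: Int_commute)
  qed
  have c4: "\<bar>Re w * (\<Sum>j\<in>I. 1 / r j)\<bar> \<le> R / 4 * \<eta>"
    using abs_Re_le_cmod[of w] w sum_r unfolding abs_mult by (intro mult_mono) auto
  have "\<bar>(\<Sum>j\<in>I. ln (norm (1 - w / of_real (r j)))) - (\<Sum>j\<in>Z. ln (norm (1 - w / of_int j)))\<bar> \<le>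
     \<bar>\<Sum>j\<in>I\<inter>Z. \<psi> (w / of_real (r j)) - \<psi> (w / of_int j)\<bar> + \<bar>\<Sum>j\<in>I-Z. \<psi> (w / of_real (r j))\<bar> +
     \<bar>\<Sum>j\<in>Z-I. \<psi> (w / of_int j)\<bar> + \<bar>Re w * (\<Sum>j\<in>I. 1 / r j)\<bar>"
    unfolding e1 e2 sum_subtractf by linarith
  also have "\<dots> \<le> 9/2 * \<eta> * R + 5/4 * (\<eta> * R) + 5/4 * (\<eta> * R) + R / 4 * \<eta>"
    using c1 c2 c3 c4 by linarith
  also have "\<dots> \<le> 8 * \<eta> * R"
  proof -
    have "0 \<le> \<eta> * R" using eta R by simp
    then show ?thesis by (simp add: algebra_simps)
  qed
  finally show ?thesis by (simp add: Z_def)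
qed

text \<open>Meant for real arguments as large as the nodes, where factors may be nearly zero and no
  two-sided bound holds. When \<open>r j\<close> lies farther from 0 than j on the same side,
  \<open>ln_one_minus_plus_antimono\<close> compares term by term; only the indices of I outside the
  shell are paid for, at \<open>1 - ln c\<close> each.\<close>

lemma prod_compare_real_lower:
  fixes r :: "int \<Rightarrow> real" and k c d :: real
  assumes "finite I" and sub: "shell m M \<subseteq> I" and k: "\<bar>k\<bar> \<le> real_of_int m" and c: "0 < c"
    and r: "\<And>j. j \<in> shell m M \<Longrightarrow> \<bar>real_of_int j\<bar> \<le> \<bar>r j\<bar> \<and> 0 \<le> r j * real_of_int j"
    and r': "\<And>j. j \<in> I - shell m M \<Longrightarrow> \<bar>k / r j\<bar> \<le> 1 - c"
    and sum_r: "\<bar>\<Sum>j\<in>I. 1 / r j\<bar> \<le> d"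
  shows "(\<Sum>j\<in>shell m M. ln (1 - k / real_of_int j))
         \<le> (\<Sum>j\<in>I. ln (1 - k / r j)) + \<bar>k\<bar> * d + real (card (I - shell m M)) * (1 - ln c)"
proof -
  define \<phi> where "\<phi> = (\<lambda>x::real. ln (1 - x) + x)"
  define Z where "Z = shell m M"
  have a: "(\<Sum>j\<in>I. ln (1 - k / r j)) = (\<Sum>j\<in>Z. \<phi> (k / r j)) + (\<Sum>j\<in>I-Z. \<phi> (k / r j)) - k * (\<Sum>j\<in>I. 1 / r j)"
  proof -
    have "(\<Sum>j\<in>I. ln (1 - k / r j)) = (\<Sum>j\<in>I. \<phi> (k / r j)) - k * (\<Sum>j\<in>I. 1 / r j)"
      by (simp add: \<phi>_def sum.distrib sum_distrib_left)
    also have "(\<Sum>j\<in>I. \<phi> (k / r j)) = (\<Sum>j\<in>Z. \<phi> (k / r j)) + (\<Sum>j\<in>I-Z. \<phi> (k / r j))"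
      using sum.subset_diff[OF sub assms(1), of "\<lambda>j. \<phi> (k / r j)"] by (simp add: Z_def)
    finally show ?thesis .
  qed
  have b: "(\<Sum>j\<in>Z. ln (1 - k / real_of_int j)) = (\<Sum>j\<in>Z. \<phi> (k / real_of_int j))"
  proof -
    have "(\<Sum>j\<in>Z. \<phi> (k / real_of_int j)) = (\<Sum>j\<in>Z. ln (1 - k / real_of_int j)) + k * (\<Sum>j\<in>Z. 1 / real_of_int j)"
      by (simp add: \<phi>_def sum.distrib sum_distrib_left)
    then show ?thesis by (simp add: Z_def)
  qed
  have "(\<Sum>j\<in>Z. \<phi> (k / real_of_int j)) \<le> (\<Sum>j\<in>Z. \<phi> (k / r j))"
  proof (rule sum_mono)
    fix j assume j: "j \<in> Z"
    have mj: "\<bar>k\<bar> < \<bar>real_of_int j\<bar>" using j k by (auto simp: Z_def shell_def)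
    have rj: "\<bar>real_of_int j\<bar> \<le> \<bar>r j\<bar>" "0 \<le> r j * real_of_int j" using r j by (auto simp: Z_def)
    show "\<phi> (k / real_of_int j) \<le> \<phi> (k / r j)"
      unfolding \<phi>_def
    proof (rule ln_one_minus_plus_antimono)
      have "k / r j * (k / real_of_int j) = k\<^sup>2 / (r j * real_of_int j)" by (simp add: power2_eq_square)
      then show "0 \<le> k / r j * (k / real_of_int j)" using rj by simp
      show "\<bar>k / r j\<bar> \<le> \<bar>k / real_of_int j\<bar>"
        using mj rj by (simp add: abs_divide) (intro divide_left_mono, auto)
      have "\<bar>k / real_of_int j\<bar> < 1" using mj by (simp add: abs_divide divide_less_eq)
      then show "k / real_of_int j < 1" by linarith
    qed
  qed
  moreover have "(\<Sum>j\<in>I-Z. \<phi> (k / r j)) \<ge> - real (card (I - Z)) * (1 - ln c)"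
  proof -
    have "(\<Sum>j\<in>I-Z. ln c - 1) \<le> (\<Sum>j\<in>I-Z. \<phi> (k / r j))"
      unfolding \<phi>_def using r' by (intro sum_mono ln_one_minus_plus_ge c) (auto simp: Z_def)
    then show ?thesis by (simp add: algebra_simps)
  qed
  moreover have "\<bar>k * (\<Sum>j\<in>I. 1 / r j)\<bar> \<le> \<bar>k\<bar> * d"
    using sum_r unfolding abs_mult by (intro mult_left_mono) auto
  ultimately show ?thesis using a b unfolding Z_def by linarith
qed

text \<open>The mirror image of \<open>prod_compare_real_lower\<close>: the \<open>r j\<close> lie
  closer to 0 than the integers, I is the smaller set, and the shell indices missing from it are
  paid for.\<close>

lemma prod_compare_real_upper:
  fixes r :: "int \<Rightarrow> real" and z c d :: real
  assumes sub: "I \<subseteq> shell m M" and c: "0 < c"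
    and r: "\<And>j. j \<in> I \<Longrightarrow> \<bar>r j\<bar> \<le> \<bar>real_of_int j\<bar> \<and> 0 \<le> r j * real_of_int j \<and> \<bar>z\<bar> < \<bar>r j\<bar>"
    and r': "\<And>j. j \<in> shell m M - I \<Longrightarrow> \<bar>z / real_of_int j\<bar> \<le> 1 - c"
    and sum_r: "\<bar>\<Sum>j\<in>I. 1 / r j\<bar> \<le> d"
  shows "(\<Sum>j\<in>I. ln (1 - z / r j))
         \<le> (\<Sum>j\<in>shell m M. ln (1 - z / real_of_int j)) + \<bar>z\<bar> * d + real (card (shell m M - I)) * (1 - ln c)"
proof -
  define \<phi> where "\<phi> = (\<lambda>x::real. ln (1 - x) + x)"
  define Z where "Z = shell m M"
  have b: "(\<Sum>j\<in>I. ln (1 - z / r j)) = (\<Sum>j\<in>I. \<phi> (z / r j)) - z * (\<Sum>j\<in>I. 1 / r j)"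
    by (simp add: \<phi>_def sum.distrib sum_distrib_left)
  have a: "(\<Sum>j\<in>Z. ln (1 - z / real_of_int j)) = (\<Sum>j\<in>I. \<phi> (z / real_of_int j)) + (\<Sum>j\<in>Z-I. \<phi> (z / real_of_int j))"
  proof -
    have "(\<Sum>j\<in>Z. \<phi> (z / real_of_int j)) = (\<Sum>j\<in>Z. ln (1 - z / real_of_int j)) + z * (\<Sum>j\<in>Z. 1 / real_of_int j)"
      by (simp add: \<phi>_def sum.distrib sum_distrib_left)
    also have "(\<Sum>j\<in>Z. 1 / real_of_int j) = 0" by (simp add: Z_def)
    finally show ?thesis
      using sum.subset_diff[OF sub, of "\<lambda>j. \<phi> (z / real_of_int j)"] by (simp add: Z_def)
  qed
  have "(\<Sum>j\<in>I. \<phi> (z / r j)) \<le> (\<Sum>j\<in>I. \<phi> (z / real_of_int j))"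
  proof (rule sum_mono)
    fix j assume j: "j \<in> I"
    have rj: "\<bar>r j\<bar> \<le> \<bar>real_of_int j\<bar>" "0 \<le> r j * real_of_int j" "\<bar>z\<bar> < \<bar>r j\<bar>" using r j by auto
    show "\<phi> (z / r j) \<le> \<phi> (z / real_of_int j)"
      unfolding \<phi>_def
    proof (rule ln_one_minus_plus_antimono)
      have "z / real_of_int j * (z / r j) = z\<^sup>2 / (r j * real_of_int j)" by (simp add: power2_eq_square)
      then show "0 \<le> z / real_of_int j * (z / r j)" using rj by simp
      show "\<bar>z / real_of_int j\<bar> \<le> \<bar>z / r j\<bar>"
        using rj by (simp add: abs_divide) (intro divide_left_mono, auto)
      have "\<bar>z / r j\<bar> < 1" using rj by (simp add: abs_divide divide_less_eq)
      then show "z / r j < 1" by linarith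
    qed
  qed
  moreover have "(\<Sum>j\<in>Z-I. \<phi> (z / real_of_int j)) \<ge> - real (card (Z - I)) * (1 - ln c)"
  proof -
    have "(\<Sum>j\<in>Z-I. ln c - 1) \<le> (\<Sum>j\<in>Z-I. \<phi> (z / real_of_int j))"
      unfolding \<phi>_def using r' by (intro sum_mono ln_one_minus_plus_ge c) (auto simp: Z_def)
    then show ?thesis by (simp add: algebra_simps)
  qed
  moreover have "\<bar>z * (\<Sum>j\<in>I. 1 / r j)\<bar> \<le> \<bar>z\<bar> * d"
    using sum_r unfolding abs_mult by (intro mult_left_mono) auto
  ultimately show ?thesis using a b unfolding Z_def by linarith
qed

section \<open>Truncations of Euler's product for sin(pi z) / pi\<close>

definition sin_prod :: "int \<Rightarrow> complex \<Rightarrow> complex" where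
  "sin_prod M z = z * (\<Prod>j\<in>shell 0 M. 1 - z / of_int j)"

lemma sin_prod_eq:
  "sin_prod (int n) z = z * (\<Prod>k=1..n. 1 - z\<^sup>2 / (of_nat k)\<^sup>2)"
proof -
  have "shell 0 (int n) = {1..int n} \<union> uminus ` {1..int n}"
  proof (intro set_eqI iffI)
    fix x assume "x \<in> shell 0 (int n)"
    then show "x \<in> {1..int n} \<union> uminus ` {1..int n}"
      by (cases "0 < x") (auto simp: shell_def intro!: image_eqI[of _ _ "-x"])
  qed (auto simp: shell_def)
  then have "(\<Prod>j\<in>shell 0 (int n). 1 - z / of_int j) =
      (\<Prod>j\<in>{1..int n}. 1 - z / of_int j) * (\<Prod>j\<in>uminus ` {1..int n}. 1 - z / of_int j)"
    by (simp only:) (rule prod.union_disjoint, auto)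
  also have "(\<Prod>j\<in>uminus ` {1..int n}. 1 - z / of_int j) = (\<Prod>j\<in>{1..int n}. 1 + z / of_int j)"
    by (subst prod.reindex) (auto simp: o_def)
  also have "(\<Prod>j\<in>{1..int n}. 1 - z / of_int j) * (\<Prod>j\<in>{1..int n}. 1 + z / of_int j)
      = (\<Prod>j\<in>{1..int n}. 1 - z\<^sup>2 / (of_int j)\<^sup>2)"
    by (simp add: prod.distrib[symmetric] algebra_simps power2_eq_square)
  also have "\<dots> = (\<Prod>k=1..n. 1 - z\<^sup>2 / (of_nat k)\<^sup>2)"
    by (rule prod.reindex_bij_witness[of _ int nat]) auto
  finally show ?thesis by (simp add: sin_prod_def)
qed

text \<open>Weierstrass' product inequality; it keeps the tail of the sine product away from
  0.\<close>

lemma one_minus_sum_le_prod: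
  fixes a :: "'a \<Rightarrow> real"
  assumes "finite A" "\<And>k. k \<in> A \<Longrightarrow> 0 \<le> a k \<and> a k \<le> 1"
  shows "1 - (\<Sum>k\<in>A. a k) \<le> (\<Prod>k\<in>A. 1 - a k)"
  using assms
proof (induction A rule: finite_induct)
  case (insert x A)
  have IH: "1 - sum a A \<le> (\<Prod>k\<in>A. 1 - a k)" using insert by auto
  have p: "(\<Prod>k\<in>A. 1 - a k) \<le> 1" using insert by (intro prod_le_1) auto
  have "a x * (\<Prod>k\<in>A. 1 - a k) \<le> a x" using p insert.prems[of x] by (simp add: mult_left_le)
  then show ?case using insert.hyps IH by (simp add: algebra_simps)
qed simp

text \<open>The factors beyond n are 1 - z^2 / k^2, and the moduli |z|^2 / k^2 add up to at most
  1/4, so their product has modulus between 3/4 and 4/3; both are relaxed to a factor 2. The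
  hypothesis on z is the reason why later cut-offs M are at least of order R^2.\<close>

lemma sin_prod_bounds:
  assumes n: "1 \<le> n" and z: "(norm z)\<^sup>2 \<le> real n / 4"
  shows "norm (sin (of_real pi * z)) \<le> 2 * (pi * norm (sin_prod (int n) z))"
    and "pi * norm (sin_prod (int n) z) \<le> 2 * norm (sin (of_real pi * z))"
proof -
  define P where "P = (\<lambda>n. of_real pi * z * (\<Prod>k=1..n. 1 - z\<^sup>2 / (of_nat k)\<^sup>2))"
  have lim: "(\<lambda>n. norm (P n)) \<longlonglongrightarrow> norm (sin (of_real pi * z))"
    unfolding P_def by (intro tendsto_norm sin_product_formula_complex)
  have P: "norm (P n) = pi * norm (sin_prod (int n) z)"
    by (simp add: P_def sin_prod_eq norm_mult)
  define a where "a = (\<lambda>k::nat. (norm z)\<^sup>2 / (real k)\<^sup>2)"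
  have sa: "(\<Sum>k\<in>{Suc n..n'}. a k) \<le> 1/4" if "n \<le> n'" for n'
  proof -
    have "{Suc n..n'} = {Suc n..<Suc n + (n' - n)}" using that by auto
    then have "(\<Sum>k\<in>{Suc n..n'}. a k) = (norm z)\<^sup>2 * (\<Sum>k\<in>{Suc n..<Suc n + (n'-n)}. 1 / (real k)\<^sup>2)"
      unfolding a_def sum_distrib_left by (intro sum.cong) auto
    also have "(\<Sum>k\<in>{Suc n..<Suc n + (n'-n)}. 1 / (real k)\<^sup>2)
        \<le> 1 / (real (Suc n) - 1) - 1 / (real (Suc n + (n'-n)) - 1)"
      by (rule sum_inverse_squares_nat) (use n in simp)
    also have "\<dots> \<le> 1 / real n" using n that by simp
    also have "(norm z)\<^sup>2 * (1 / real n) \<le> real n / 4 * (1 / real n)"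
      using z by (intro mult_right_mono) auto
    finally show ?thesis using n by (simp add: mult_left_mono)
  qed
  have sp: "norm (P n') = norm (P n) * (\<Prod>k\<in>{Suc n..n'}. norm (1 - z\<^sup>2 / (of_nat k)\<^sup>2))" if "n \<le> n'" for n'
  proof -
    have "{1..n'} = {1..n} \<union> {Suc n..n'}" using that n by auto
    then have "(\<Prod>k=1..n'. 1 - z\<^sup>2 / (of_nat k)\<^sup>2) =
       (\<Prod>k=1..n. 1 - z\<^sup>2 / (of_nat k)\<^sup>2) * (\<Prod>k\<in>{Suc n..n'}. 1 - z\<^sup>2 / (of_nat k)\<^sup>2)"
      by (simp only:) (rule prod.union_disjoint, auto)
    then show ?thesis by (simp add: P_def norm_mult prod_norm)
  qed
  have na: "norm (z\<^sup>2 / (of_nat k)\<^sup>2) = a k" for k by (simp add: a_def norm_divide norm_power)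
  have up: "norm (P n') \<le> norm (P n) * (4/3)" if "n \<le> n'" for n'
  proof -
    have "(\<Prod>k\<in>{Suc n..n'}. norm (1 - z\<^sup>2 / (of_nat k)\<^sup>2)) \<le> (\<Prod>k\<in>{Suc n..n'}. exp (a k))"
    proof (intro prod_mono conjI norm_ge_zero)
      fix k
      have "norm (1 - z\<^sup>2 / (of_nat k)\<^sup>2) \<le> 1 + a k"
        using norm_triangle_ineq4[of 1 "z\<^sup>2 / (of_nat k)\<^sup>2"] na[of k] by simp
      also have "\<dots> \<le> exp (a k)" by (rule exp_ge_add_one_self)
      finally show "norm (1 - z\<^sup>2 / (of_nat k)\<^sup>2) \<le> exp (a k)" .
    qed
    also have "\<dots> = exp (\<Sum>k\<in>{Suc n..n'}. a k)" by (simp add: exp_sum)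
    also have "\<dots> \<le> exp (1/4)" using sa[OF that] by simp
    also have "\<dots> \<le> 4/3"
    proof -
      have "3/4 \<le> exp (-(1/4::real))" using exp_ge_add_one_self[of "-(1/4)::real"] by simp
      then have "3/4 * exp (1/4) \<le> exp (-(1/4::real)) * exp (1/4)" by (intro mult_right_mono) auto
      also have "\<dots> = 1" by (simp add: exp_minus)
      finally show ?thesis by simp
    qed
    finally show ?thesis unfolding sp[OF that] by (intro mult_left_mono) auto
  qed
  have low: "norm (P n) * (3/4) \<le> norm (P n')" if "n \<le> n'" for n'
  proof -
    have ale: "0 \<le> a k \<and> a k \<le> 1" if "k \<in> {Suc n..n'}" for k
    proof -
      have "a k \<le> (\<Sum>k\<in>{Suc n..n'}. a k)" by (rule member_le_sum) (use that in \<open>auto simp: a_def\<close>)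
      then show ?thesis using sa[OF \<open>n \<le> n'\<close>] by (simp add: a_def)
    qed
    have "3/4 \<le> 1 - (\<Sum>k\<in>{Suc n..n'}. a k)" using sa[OF that] by simp
    also have "\<dots> \<le> (\<Prod>k\<in>{Suc n..n'}. 1 - a k)" by (rule one_minus_sum_le_prod) (use ale in auto)
    also have "\<dots> \<le> (\<Prod>k\<in>{Suc n..n'}. norm (1 - z\<^sup>2 / (of_nat k)\<^sup>2))"
    proof (intro prod_mono conjI)
      fix k assume "k \<in> {Suc n..n'}"
      then show "0 \<le> 1 - a k" using ale by auto
      show "1 - a k \<le> norm (1 - z\<^sup>2 / (of_nat k)\<^sup>2)"
        using norm_triangle_ineq2[of 1 "z\<^sup>2 / (of_nat k)\<^sup>2"] na[of k] by simp
    qed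
    finally show ?thesis unfolding sp[OF that] by (intro mult_left_mono) auto
  qed
  have "norm (sin (of_real pi * z)) \<le> norm (P n) * (4/3)"
    by (rule tendsto_upperbound[OF lim]) (use up in \<open>auto simp: eventually_sequentially\<close>)
  then show "norm (sin (of_real pi * z)) \<le> 2 * (pi * norm (sin_prod (int n) z))"
    unfolding P[symmetric] using norm_ge_zero[of "P n"] by linarith
  have "norm (P n) * (3/4) \<le> norm (sin (of_real pi * z))"
    by (rule tendsto_lowerbound[OF lim]) (use low in \<open>auto simp: eventually_sequentially\<close>)
  then show "pi * norm (sin_prod (int n) z) \<le> 2 * norm (sin (of_real pi * z))"
    unfolding P[symmetric] using norm_ge_zero[of "P n"] by linarith
qed

lemma norm_sin_le_exp: "norm (sin z) \<le> exp \<bar>Im z\<bar>" for z :: complex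
proof -
  have "(norm (sin z))\<^sup>2 = (exp (2 * Im z) + exp (- (2 * Im z)) - 2 * cos (2 * Re z)) / 4"
    by (simp add: norm_sin_squared exp_minus)
  also have "\<dots> \<le> (exp (2 * Im z) + exp (- (2 * Im z)) - 2 * (- 1)) / 4"
    using cos_ge_minus_one[of "2 * Re z"] by (intro divide_right_mono diff_left_mono mult_left_mono) simp_all
  also have "\<dots> \<le> exp (2 * \<bar>Im z\<bar>)"
  proof -
    define X where "X = exp (2 * \<bar>Im z\<bar>)"
    have "exp (2 * Im z) \<le> X" "exp (- (2 * Im z)) \<le> X" "1 \<le> X"
      by (auto simp: X_def)
    then show ?thesis unfolding X_def[symmetric] by simp
  qed
  also have "\<dots> = (exp \<bar>Im z\<bar>)\<^sup>2" by (simp add: power2_eq_square mult_exp_exp)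
  finally show ?thesis by (rule power2_le_imp_le) auto
qed

lemma norm_cos_le_exp: "norm (cos z) \<le> exp \<bar>Im z\<bar>" for z :: complex
  using norm_sin_le_exp[of "z + of_real (pi/2)"] by (simp add: sin_add sin_of_real cos_of_real del: of_real_divide)

text \<open>Mean value along the segment from 0. The factor \<open>norm z\<close> retains the zero
  of the sine, which has to cancel a linear factor in \<open>lagrange_lattice_bound\<close>.\<close>

lemma norm_sin_le_mult_exp: "norm (sin z) \<le> norm z * exp \<bar>Im z\<bar>" for z :: complex
proof -
  have "norm (sin z - sin 0) \<le> exp \<bar>Im z\<bar> * norm (z - 0)"
  proof (rule field_differentiable_bound[where S = "closed_segment 0 z" and f' = cos])
    fix w assume "w \<in> closed_segment 0 z"
    then obtain t where t: "0 \<le> t" "t \<le> 1" "w = t *\<^sub>R z" by (auto simp: in_segment)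
    have "norm (cos w) \<le> exp \<bar>Im w\<bar>" by (rule norm_cos_le_exp)
    also have "\<dots> \<le> exp \<bar>Im z\<bar>" using t by (simp add: abs_mult mult_left_le_one_le)
    finally show "norm (cos w) \<le> exp \<bar>Im z\<bar>" .
  qed (auto intro: has_field_derivative_at_within DERIV_sin)
  then show ?thesis by (simp add: mult.commute)
qed

text \<open>The squared modulus is (cosh(2 pi Im z) - cos(2 pi Re z)) / 2: the cosine helps where it
  equals -1, and at height at least 1 the hyperbolic part dominates it anyway. A square whose
  vertical sides lie halfway between integers and whose horizontal sides have height at least 1
  meets these conditions.\<close>

lemma norm_sin_pi_ge:
  fixes z :: complex
  assumes "Re z = real_of_int K + 1/2 \<or> 1 \<le> \<bar>Im z\<bar>"
  shows "exp (pi * \<bar>Im z\<bar>) / 4 \<le> norm (sin (of_real pi * z))"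
proof -
  have e: "exp (2 * pi * \<bar>Im z\<bar>) \<le> exp (2 * (pi * Im z)) + exp (- (2 * (pi * Im z)))"
    by (cases "0 \<le> Im z") (auto simp: mult.assoc)
  have sq: "(norm (sin (of_real pi * z)))\<^sup>2 =
     (exp (2 * (pi * Im z)) + exp (- (2 * (pi * Im z))) - 2 * cos (2 * (pi * Re z))) / 4"
    using norm_sin_squared[of "of_real pi * z"] by (simp add: exp_minus)
  have "exp (2 * pi * \<bar>Im z\<bar>) / 16 \<le> (norm (sin (of_real pi * z)))\<^sup>2"
    using assms
  proof
    assume "Re z = real_of_int K + 1/2"
    then have "cos (2 * (pi * Re z)) = cos (2 * pi * real_of_int K + pi)" by (simp add: algebra_simps)
    also have "\<dots> = - cos (2 * pi * real_of_int K)" by simp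
    also have "cos (2 * pi * real_of_int K) = 1" using cos_int_2pin[of K] by simp
    finally have "cos (2 * (pi * Re z)) = -1" .
    note c = this
    define X where "X = exp (2 * pi * \<bar>Im z\<bar>)"
    have "0 \<le> X" by (simp add: X_def)
    then show ?thesis unfolding sq c using e unfolding X_def[symmetric] by simp
  next
    assume i: "1 \<le> \<bar>Im z\<bar>"
    have "3 \<le> 1 + 2 * pi * \<bar>Im z\<bar>"
    proof -
      have "3 * 1 \<le> pi * \<bar>Im z\<bar>" using i pi_gt3 by (intro mult_mono) auto
      then show ?thesis by linarith
    qed
    also have "\<dots> \<le> exp (2 * pi * \<bar>Im z\<bar>)" by (rule exp_ge_add_one_self)
    finally have "3 \<le> exp (2 * pi * \<bar>Im z\<bar>)" .
    moreover define c where "c = cos (2 * (pi * Re z))"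
    moreover have "c \<le> 1" by (simp add: c_def)
    moreover define X where "X = exp (2 * pi * \<bar>Im z\<bar>)"
    moreover define A where "A = exp (2 * (pi * Im z)) + exp (- (2 * (pi * Im z)))"
    ultimately have "3 \<le> X" "c \<le> 1" "X \<le> A"
      using e by auto
    then show ?thesis unfolding sq c_def[symmetric] X_def[symmetric] A_def[symmetric] by simp
  qed
  also have "exp (2 * pi * \<bar>Im z\<bar>) / 16 = (exp (pi * \<bar>Im z\<bar>) / 4)\<^sup>2"
    by (simp add: power2_eq_square mult_exp_exp)
  finally show ?thesis by (rule power2_le_imp_le) auto
qed

section \<open>Lagrange products on the integer lattice\<close>

lemma prod_dist_eq_fact:
  fixes k :: int
  assumes "\<bar>k\<bar> \<le> int n"
  shows "(\<Prod>j\<in>{-int n..int n}-{k}. \<bar>real_of_int k - real_of_int j\<bar>) = fact (nat (int n + k)) * fact (nat (int n - k))"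
proof -
  have "{-int n..int n}-{k} = {-int n..k-1} \<union> {k+1..int n}" using assms by auto
  then have "(\<Prod>j\<in>{-int n..int n}-{k}. \<bar>real_of_int k - real_of_int j\<bar>) =
    (\<Prod>j\<in>{-int n..k-1}. \<bar>real_of_int k - real_of_int j\<bar>) * (\<Prod>j\<in>{k+1..int n}. \<bar>real_of_int k - real_of_int j\<bar>)"
    by (simp only:) (rule prod.union_disjoint, auto)
  also have "(\<Prod>j\<in>{-int n..k-1}. \<bar>real_of_int k - real_of_int j\<bar>) = (\<Prod>i\<in>{1..nat (int n + k)}. real i)"
    by (rule prod.reindex_bij_witness[of _ "\<lambda>i. k - int i" "\<lambda>j. nat (k - j)"]) auto
  also have "(\<Prod>j\<in>{k+1..int n}. \<bar>real_of_int k - real_of_int j\<bar>) = (\<Prod>i\<in>{1..nat (int n - k)}. real i)"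
    by (rule prod.reindex_bij_witness[of _ "\<lambda>i. k + int i" "\<lambda>j. nat (j - k)"]) auto
  finally show ?thesis by (simp add: fact_prod)
qed

text \<open>The central binomial coefficient is the largest. Through
  \<open>prod_dist_eq_fact\<close>, the product of the distances to the other nodes is smallest at
  the central node.\<close>

lemma fact_square_le: "fact n * fact n \<le> (fact (n + k) * fact (n - k) :: real)" if "k \<le> n" for n k :: nat
proof -
  have "fact (2*n) / (fact (n + k) * fact (n - k)) = real ((2*n) choose (n + k))"
    using that by (subst binomial_fact) (auto simp: mult_2)
  also have "\<dots> \<le> real ((2*n) choose n)" using binomial_maximum'[of n "n+k"] by simp
  also have "\<dots> = fact (2*n) / (fact n * fact n)"
    by (subst binomial_fact) (auto simp: mult_2)
  finally show ?thesis by (simp add: divide_simps)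
qed

text \<open>Multiplying by \<open>norm (z - of_int k)\<close> completes the numerator to the modulus
  of \<open>sin_prod\<close> times the denominator \<open>D 0\<close> of the central node, and
  \<open>D 0 \<le> D k\<close>. By periodicity |sin(pi z)| = |sin(pi (z - k))|, whose zero at k
  gives back the factor |z - k|. The resulting bound is uniform in k.\<close>

lemma lagrange_lattice_bound:
  fixes z :: complex and k :: int
  assumes n: "1 \<le> n" and z: "(norm z)\<^sup>2 \<le> real n / 4" and k: "\<bar>k\<bar> \<le> int n"
  shows "(\<Prod>j\<in>{-int n..int n}-{k}. norm (z - of_int j) / \<bar>real_of_int k - real_of_int j\<bar>) \<le> 2 * exp (pi * \<bar>Im z\<bar>)"
proof (cases "z = of_int k")
  case True
  \<comment> \<open>At the node itself the product is exactly 1; elsewhere one may divide by |z -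
    k|.\<close>
  have "norm (z - of_int j) / \<bar>real_of_int k - real_of_int j\<bar> = 1" if "j \<noteq> k" for j
  proof -
    have "z - of_int j = of_real (real_of_int k - real_of_int j)" using True by simp
    then show ?thesis using that by (simp only: norm_of_real) simp
  qed
  then have "(\<Prod>j\<in>{-int n..int n}-{k}. norm (z - of_int j) / \<bar>real_of_int k - real_of_int j\<bar>) = 1"
    by (intro prod.neutral ballI) blast
  moreover have "1 \<le> exp (pi * \<bar>Im z\<bar>)" by simp
  ultimately show ?thesis by linarith
next
  case False
  then have zk: "0 < norm (z - of_int k)" by simp
  define D where "D = (\<lambda>k::int. \<Prod>j\<in>{-int n..int n}-{k}. \<bar>real_of_int k - real_of_int j\<bar>)"
  have Dpos: "0 < D k" for k unfolding D_def by (rule prod_pos) auto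
  have D: "D 0 \<le> D k"
  proof -
    have "D 0 = fact n * fact n" unfolding D_def by (subst prod_dist_eq_fact) auto
    also have "\<dots> \<le> fact (n + nat \<bar>k\<bar>) * fact (n - nat \<bar>k\<bar>)" using k by (intro fact_square_le) auto
    also have "\<dots> = D k"
    proof (cases "0 \<le> k")
      case True
      then have "nat (int n + k) = n + nat \<bar>k\<bar>" "nat (int n - k) = n - nat \<bar>k\<bar>" by auto
      then show ?thesis unfolding D_def using k by (subst prod_dist_eq_fact) auto
    next
      case False
      then have "nat (int n + k) = n - nat \<bar>k\<bar>" "nat (int n - k) = n + nat \<bar>k\<bar>" by auto
      then show ?thesis unfolding D_def using k by (subst prod_dist_eq_fact) auto
    qed
    finally show ?thesis .
  qed
  have S: "{-int n..int n}-{0} = shell 0 (int n)" by (auto simp: shell_def)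
  have "(\<Prod>j\<in>{-int n..int n}-{k}. norm (z - of_int j)) * norm (z - of_int k) = (\<Prod>j\<in>{-int n..int n}. norm (z - of_int j))"
    using k by (subst prod.remove[of _ k]) (auto simp: mult.commute)
  also have "\<dots> = norm z * (\<Prod>j\<in>{-int n..int n}-{0}. norm (z - of_int j))"
    by (subst prod.remove[of _ 0]) auto
  also have "(\<Prod>j\<in>{-int n..int n}-{0}. norm (z - of_int j))
      = (\<Prod>j\<in>{-int n..int n}-{0}. norm (1 - z / of_int j) * \<bar>real_of_int 0 - real_of_int j\<bar>)"
  proof (intro prod.cong refl)
    fix j assume "j \<in> {-int n..int n}-{0}"
    then have "z - of_int j = - (1 - z / of_int j) * of_int j" by (simp add: field_simps)
    then show "norm (z - of_int j) = norm (1 - z / of_int j) * \<bar>real_of_int 0 - real_of_int j\<bar>"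
      by (simp only: norm_mult norm_minus_cancel norm_of_int) simp
  qed
  also have "\<dots> = (\<Prod>j\<in>shell 0 (int n). norm (1 - z / of_int j)) * D 0"
    by (simp only: prod.distrib D_def S)
  also have "norm z * ((\<Prod>j\<in>shell 0 (int n). norm (1 - z / of_int j)) * D 0) = norm (sin_prod (int n) z) * D 0"
    by (simp add: sin_prod_def norm_mult prod_norm)
  finally have eq: "(\<Prod>j\<in>{-int n..int n}-{k}. norm (z - of_int j)) * norm (z - of_int k) = norm (sin_prod (int n) z) * D 0" .
  have "pi * norm (sin_prod (int n) z) \<le> 2 * norm (sin (of_real pi * z))"
    by (rule sin_prod_bounds(2)[OF n z])
  also have "norm (sin (of_real pi * z)) = norm (sin (of_real pi * (z - of_int k)))"
  proof -
    have "sin (of_real pi * z) = sin (of_real pi * (z - of_int k) + of_real (pi * of_int k))"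
      by (simp add: algebra_simps)
    also have "\<dots> = sin (of_real pi * (z - of_int k)) * of_real (cos (pi * of_int k))"
      by (subst sin_add) (simp only: sin_of_real cos_of_real, simp add: sin_npi_int)
    finally show ?thesis by (simp add: norm_mult cos_npi_int)
  qed
  also have "\<dots> \<le> norm (of_real pi * (z - of_int k)) * exp \<bar>Im (of_real pi * (z - of_int k))\<bar>"
    by (rule norm_sin_le_mult_exp)
  also have "\<dots> = pi * norm (z - of_int k) * exp (pi * \<bar>Im z\<bar>)"
    by (simp add: norm_mult abs_mult)
  finally have "norm (sin_prod (int n) z) \<le> 2 * norm (z - of_int k) * exp (pi * \<bar>Im z\<bar>)"
    using pi_gt_zero by (simp add: mult_le_cancel_left)
  then have "(\<Prod>j\<in>{-int n..int n}-{k}. norm (z - of_int j)) * norm (z - of_int k)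
     \<le> (2 * norm (z - of_int k) * exp (pi * \<bar>Im z\<bar>)) * D k"
    unfolding eq using D Dpos[of 0] by (intro mult_mono) auto
  then have "(\<Prod>j\<in>{-int n..int n}-{k}. norm (z - of_int j)) * norm (z - of_int k)
     \<le> (2 * exp (pi * \<bar>Im z\<bar>) * D k) * norm (z - of_int k)" by (simp add: mult_ac)
  then have "(\<Prod>j\<in>{-int n..int n}-{k}. norm (z - of_int j)) \<le> 2 * exp (pi * \<bar>Im z\<bar>) * D k"
    using zk by simp
  moreover have "(\<Prod>j\<in>{-int n..int n}-{k}. norm (z - of_int j) / \<bar>real_of_int k - real_of_int j\<bar>) =
    (\<Prod>j\<in>{-int n..int n}-{k}. norm (z - of_int j)) / D k" by (simp add: prod_dividef D_def)
  ultimately show ?thesis using Dpos[of k] by (simp only: pos_divide_le_eq)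
qed

section \<open>Orthonormal polynomials\<close>

definition weight_inner :: "(real \<Rightarrow> real) \<Rightarrow> real poly \<Rightarrow> real poly \<Rightarrow> real" where
  "weight_inner w p q = (\<integral>t. poly p t * poly q t * w t \<partial>lborel)"

text \<open>Definiteness is stated for the form on polynomials, since this is what Gram-Schmidt
  divides by.\<close>

locale poly_weight =
  fixes w :: "real \<Rightarrow> real"
  assumes moments: "\<And>p. integrable lborel (\<lambda>t. poly p t * w t)"
    and positive: "\<And>p. p \<noteq> 0 \<Longrightarrow> 0 < weight_inner w p p"
begin

abbreviation ip where "ip \<equiv> weight_inner w"

lemma integrable_mult: "integrable lborel (\<lambda>t. poly p t * poly q t * w t)"
  using moments[of "p * q"] by simp

lemma ip_commute: "ip p q = ip q p"
  by (simp add: weight_inner_def mult.commute)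

lemma ip_add: "ip (p + q) r = ip p r + ip q r"
  unfolding weight_inner_def
  by (subst Bochner_Integration.integral_add[symmetric])
     (auto intro!: integrable_mult Bochner_Integration.integral_cong simp: distrib_right distrib_left)

lemma ip_smult: "ip (smult c p) r = c * ip p r"
  unfolding weight_inner_def
  by (subst integral_mult_right_zero[symmetric])
     (auto intro!: Bochner_Integration.integral_cong simp: algebra_simps)

lemma ip_0 [simp]: "ip 0 r = 0" by (simp add: weight_inner_def)

lemma ip_diff: "ip (p - q) r = ip p r - ip q r"
  using ip_add[of p "smult (-1) q" r] ip_smult[of "-1" q r] by simp

lemma ip_sum: "ip (\<Sum>k\<in>A. f k) r = (\<Sum>k\<in>A. ip (f k) r)"
  by (induction A rule: infinite_finite_induct) (auto simp: ip_add)

lemma orthonormal_polys_iff: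
  "orthonormal_polys w \<phi> \<longleftrightarrow>
    (\<forall>j. degree (\<phi> j) = j \<and> lead_coeff (\<phi> j) > 0) \<and> (\<forall>j k. ip (\<phi> j) (\<phi> k) = (if j = k then 1 else 0))"
  unfolding orthonormal_polys_def has_bochner_integral_iff weight_inner_def
  using integrable_mult by auto

text \<open>Gram-Schmidt on the monomials, left monic so that degree and leading coefficient stay
  transparent; \<open>orth\<close> normalises afterwards.\<close>

function monic_orth :: "nat \<Rightarrow> real poly" where
  "monic_orth n = monom 1 n - (\<Sum>k<n. smult (ip (monom 1 n) (monic_orth k) / ip (monic_orth k) (monic_orth k)) (monic_orth k))"
  by pat_completeness auto
termination by (relation "Wellfounded.measure id") auto

declare monic_orth.simps [simp del]

lemma monic_orth_degree: "degree (monic_orth n) = n \<and> lead_coeff (monic_orth n) = 1"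
proof (induction n rule: less_induct)
  case (less n)
  define s where "s = (\<Sum>k<n. smult (ip (monom 1 n) (monic_orth k) / ip (monic_orth k) (monic_orth k)) (monic_orth k))"
  have e: "monic_orth n = monom 1 n - s" by (subst monic_orth.simps) (simp add: s_def)
  have s: "coeff s i = 0" if "n \<le> i" for i
    unfolding s_def coeff_sum coeff_smult
  proof (rule sum.neutral, intro ballI)
    fix k assume "k \<in> {..<n}"
    then have "coeff (monic_orth k) i = 0" using less[of k] that by (intro coeff_eq_0) auto
    then show "ip (monom 1 n) (monic_orth k) / ip (monic_orth k) (monic_orth k) * coeff (monic_orth k) i = 0" by simp
  qed
  have c: "coeff (monic_orth n) n = 1" using s[of n] by (simp add: e)
  have "degree (monic_orth n) \<le> n"
    by (rule degree_le) (use s in \<open>auto simp: e\<close>)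
  moreover have "n \<le> degree (monic_orth n)" by (rule le_degree) (simp add: c)
  ultimately show ?case using c by simp
qed

lemma monic_orth_nonzero: "monic_orth n \<noteq> 0"
  using monic_orth_degree[of n] by auto

lemma monic_orth_orthogonal: "m < n \<Longrightarrow> ip (monic_orth n) (monic_orth m) = 0"
proof (induction n arbitrary: m rule: less_induct)
  case (less n)
  let ?c = "\<lambda>k. ip (monom 1 n) (monic_orth k) / ip (monic_orth k) (monic_orth k)"
  \<comment> \<open>The induction hypothesis at the larger of k and m, which is below n in either
    case.\<close>
  have off: "ip (monic_orth k) (monic_orth m) = 0" if "k < n" "k \<noteq> m" for k
    using that less.IH[of k m] less.IH[of m k] less.prems ip_commute by (metis linorder_neqE_nat)
  have "(\<Sum>k<n. ?c k * ip (monic_orth k) (monic_orth m)) = (\<Sum>k<n. if k = m then ip (monom 1 n) (monic_orth m) else 0)"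
    using off positive[OF monic_orth_nonzero[of m]] by (intro sum.cong) auto
  also have "\<dots> = ip (monom 1 n) (monic_orth m)" using less.prems by simp
  finally show ?case by (subst monic_orth.simps) (simp add: ip_diff ip_sum ip_smult)
qed

definition orth :: "nat \<Rightarrow> real poly" where
  "orth n = smult (1 / sqrt (ip (monic_orth n) (monic_orth n))) (monic_orth n)"

lemma orth_orthonormal: "orthonormal_polys w orth"
proof -
  have "ip (orth j) (orth k) = (if j = k then 1 else 0)" for j k
  proof -
    have "ip (monic_orth j) (monic_orth k) = 0" if "j \<noteq> k"
      using monic_orth_orthogonal[of j k] monic_orth_orthogonal[of k j] that
      by (metis ip_commute linorder_neqE_nat)
    moreover have "ip (smult a p) (smult b q) = a * b * ip p q" for a b p q
      by (simp add: ip_smult ip_commute[of p "smult b q"] ip_commute[of p q])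
    moreover have "0 < ip (monic_orth k) (monic_orth k)" by (rule positive[OF monic_orth_nonzero])
    ultimately show ?thesis unfolding orth_def by (auto simp: real_sqrt_mult_self)
  qed
  moreover have "degree (orth j) = j \<and> lead_coeff (orth j) > 0" for j
  proof -
    have "degree (monic_orth j) = j" "coeff (monic_orth j) j = 1" using monic_orth_degree[of j] by auto
    then show ?thesis using positive[OF monic_orth_nonzero[of j]] by (simp add: orth_def)
  qed
  ultimately show ?thesis unfolding orthonormal_polys_iff by blast
qed

lemma orthonormal_expansion:
  assumes "orthonormal_polys w \<phi>" "degree q < N"
  shows "q = (\<Sum>j<N. smult (ip q (\<phi> j)) (\<phi> j))"
proof -
  have deg: "degree (\<phi> j) = j" and lc: "coeff (\<phi> j) j > 0" for j
    using assms(1) unfolding orthonormal_polys_iff by metis+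
  have on: "ip (\<phi> j) (\<phi> k) = (if j = k then 1 else 0)" for j k
    using assms(1) by (auto simp: orthonormal_polys_iff)
  \<comment> \<open>By triangularity: subtracting a multiple of \<open>\<phi> N\<close> removes the
    coefficient of degree N.\<close>
  have ex: "\<exists>c. q = (\<Sum>j<N. smult (c j) (\<phi> j))" if "\<And>i. N \<le> i \<Longrightarrow> coeff q i = 0" for q N
    using that
  proof (induction N arbitrary: q)
    case 0
    then have "q = 0" by (auto intro: poly_eqI)
    then show ?case by simp
  next
    case (Suc N)
    define a where "a = coeff q N / coeff (\<phi> N) N"
    have "coeff (q - smult a (\<phi> N)) i = 0" if "N \<le> i" for i
    proof (cases "i = N")
      case True
      then show ?thesis using lc[of N] by (simp add: a_def)
    next
      case False
      then have "coeff (\<phi> N) i = 0" using deg[of N] that by (intro coeff_eq_0) auto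
      then show ?thesis using Suc.prems[of i] that False by simp
    qed
    then obtain c where c: "q - smult a (\<phi> N) = (\<Sum>j<N. smult (c j) (\<phi> j))" using Suc.IH by blast
    have "q = (\<Sum>j<Suc N. smult ((c(N := a)) j) (\<phi> j))" using c by (simp add: algebra_simps)
    then show ?case by blast
  qed
  obtain c where c: "q = (\<Sum>j<N. smult (c j) (\<phi> j))"
    using ex[of N q] assms(2) by (meson coeff_eq_0 less_le_trans)
  have "ip q (\<phi> k) = c k" if "k < N" for k
  proof -
    have "ip q (\<phi> k) = (\<Sum>j<N. c j * (if j = k then 1 else 0))"
      by (subst c) (simp add: ip_sum ip_smult on)
    also have "\<dots> = (\<Sum>j<N. if j = k then c j else 0)" by (intro sum.cong) auto
    finally show ?thesis using that by simp
  qed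
  then show ?thesis using c by simp
qed

text \<open>\<open>\<psi> n\<close> is orthogonal to everything of lower degree, so its expansion in
  \<phi> keeps only the last term; the norm leaves a sign, which the positive leading coefficients
  fix. This makes the definite description in \<open>orthonormal_poly\<close> meaningful.\<close>

lemma orthonormal_unique:
  assumes "orthonormal_polys w \<phi>" "orthonormal_polys w \<psi>"
  shows "\<phi> = \<psi>"
proof
  fix n
  have d\<phi>: "degree (\<phi> j) = j" "coeff (\<phi> j) j > 0" for j using assms(1) unfolding orthonormal_polys_iff by metis+
  have d\<psi>: "degree (\<psi> j) = j" "coeff (\<psi> j) j > 0" for j using assms(2) unfolding orthonormal_polys_iff by metis+
  have on\<phi>: "ip (\<phi> j) (\<phi> k) = (if j = k then 1 else 0)" for j k using assms(1) by (auto simp: orthonormal_polys_iff)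
  have on\<psi>: "ip (\<psi> j) (\<psi> k) = (if j = k then 1 else 0)" for j k using assms(2) by (auto simp: orthonormal_polys_iff)
  have orth: "ip q (\<psi> n) = 0" if "degree q < n" for q
  proof -
    have "ip q (\<psi> n) = (\<Sum>j<n. ip q (\<psi> j) * ip (\<psi> j) (\<psi> n))"
      by (subst orthonormal_expansion[OF assms(2) that]) (simp add: ip_sum ip_smult)
    also have "\<dots> = 0" by (rule sum.neutral) (auto simp: on\<psi>)
    finally show ?thesis .
  qed
  have "ip (\<psi> n) (\<phi> j) = 0" if "j < n" for j
    using orth[of "\<phi> j"] d\<phi> that ip_commute by simp
  then have "\<psi> n = smult (ip (\<psi> n) (\<phi> n)) (\<phi> n)"
    using orthonormal_expansion[OF assms(1), of "\<psi> n" "Suc n"] d\<psi> by simp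
  then obtain a where a: "\<psi> n = smult a (\<phi> n)" by blast
  have "1 = a * a * ip (\<phi> n) (\<phi> n)"
    using on\<psi>[of n n] unfolding a by (simp add: ip_smult ip_commute[of "\<phi> n" "smult a (\<phi> n)"])
  then have "a = 1 \<or> a = -1" using on\<phi>[of n n] by (simp add: square_eq_1_iff)
  moreover have "0 < a"
    using d\<psi>(2)[of n] d\<phi>(2)[of n] unfolding a by (simp add: zero_less_mult_iff)
  ultimately show "\<phi> n = \<psi> n" using a by auto
qed

lemma orthonormal_poly: "orthonormal_polys w (orthonormal_poly w)"
  unfolding orthonormal_poly_def
  by (rule theI[of _ orth]) (auto intro: orth_orthonormal orthonormal_unique)

text \<open>If evaluation at \<open>x\<close> has squared norm at most \<open>C\<close> on polynomials of degree below \<open>N\<close>, the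
  reproducing property turns any almost optimal \<open>q\<close> into an approximation of the kernel.\<close>

lemma orthonormal_kernel_approx:
  fixes q :: "real poly"
  assumes w: "0 \<le> w x" "0 \<le> w y"
    and upper: "\<And>r z. z \<in> {x, y} \<Longrightarrow> degree r < N \<Longrightarrow> (poly r z)\<^sup>2 * w z \<le> C * ip r r"
    and q: "degree q < N" and N: "ip q q \<le> C"
    and C: "0 \<le> C"
  shows "\<bar>orthonormal_kernel w N x y - sqrt (w x) * poly q x\<bar> \<le> sqrt (C * (2 * C - 2 * (sqrt (w y) * poly q y)))"
proof -
  define \<phi> where "\<phi> = orthonormal_poly w"
  have \<phi>: "orthonormal_polys w \<phi>" unfolding \<phi>_def by (rule orthonormal_poly)
  have deg: "degree (\<phi> j) = j" for j using \<phi> by (auto simp: orthonormal_polys_iff)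
  have on: "ip (\<phi> j) (\<phi> k) = (if j = k then 1 else 0)" for j k using \<phi> by (auto simp: orthonormal_polys_iff)
  define a where "a = (\<lambda>z j. sqrt (w z) * poly (\<phi> j) z)"
  have ipc: "ip (\<Sum>j<N. smult (c j) (\<phi> j)) (\<Sum>j<N. smult (c j) (\<phi> j)) = (\<Sum>j<N. (c j)\<^sup>2)" for c
  proof -
    have "ip (\<phi> k) (\<Sum>j<N. smult (c j) (\<phi> j)) = c k" if "k < N" for k
      using that by (subst ip_commute) (simp add: ip_sum ip_smult on if_distrib cong: if_cong)
    then show ?thesis by (simp add: ip_sum[of "\<lambda>j. smult (c j) (\<phi> j)"] ip_smult power2_eq_square)
  qed
  \<comment> \<open>Tests \<open>upper\<close> on the element r that represents weighted evaluation
    at z: its squared norm and its weighted value at z both equal K, so K^2 \<le> C K.\<close>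
  have diag: "(\<Sum>j<N. (a z j)\<^sup>2) \<le> C" if z: "z \<in> {x, y}" for z
  proof -
    define K where "K = (\<Sum>j<N. (a z j)\<^sup>2)"
    define r where "r = (\<Sum>j<N. smult (a z j) (\<phi> j))"
    have "N \<noteq> 0" using q by auto
    then have "degree r < N" unfolding r_def using deg
      by (intro le_less_trans[OF degree_sum_le[of _ _ "N - 1"]]) (auto intro: order_trans[OF degree_smult_le])
    then have "(poly r z)\<^sup>2 * w z \<le> C * ip r r" by (rule upper[OF z])
    moreover have "ip r r = K" unfolding r_def K_def by (rule ipc)
    moreover have "sqrt (w z) * poly r z = K"
      unfolding r_def K_def poly_sum sum_distrib_left a_def
      by (intro sum.cong) (auto simp: power2_eq_square)
    moreover have "(poly r z)\<^sup>2 * w z = (sqrt (w z) * poly r z)\<^sup>2" using w z by (auto simp: power_mult_distrib)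
    ultimately have "K * K \<le> C * K" by (simp add: power2_eq_square)
    moreover have "0 \<le> K" unfolding K_def by (intro sum_nonneg) auto
    ultimately show ?thesis unfolding K_def[symmetric] using C
      by (cases "K = 0") (auto simp: mult_le_cancel_right)
  qed
  define c where "c = (\<lambda>j. ip q (\<phi> j))"
  have qe: "q = (\<Sum>j<N. smult (c j) (\<phi> j))"
    unfolding c_def by (rule orthonormal_expansion[OF \<phi> q])
  have fq: "sqrt (w z) * poly q z = (\<Sum>j<N. a z j * c j)" for z
    by (subst qe) (simp add: poly_sum sum_distrib_left a_def mult_ac)
  have kern: "orthonormal_kernel w N x y = (\<Sum>j<N. a x j * a y j)"
    unfolding orthonormal_kernel_def \<phi>_def[symmetric] a_def real_sqrt_mult sum_distrib_left
    by (intro sum.cong) (auto simp: mult_ac)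
  have cs: "(\<Sum>j<N. (c j)\<^sup>2) \<le> C" using N qe ipc by metis
  \<comment> \<open>Pairs the evaluation vector at x with the difference between the evaluation
    vector at y and the coefficients of q. Expanding the squared norm of that difference leaves at
    most 2 C minus twice the weighted value of q at y.\<close>
  have "\<bar>orthonormal_kernel w N x y - sqrt (w x) * poly q x\<bar>\<^sup>2 = (\<Sum>j<N. a x j * (a y j - c j))\<^sup>2"
    unfolding kern fq by (simp add: right_diff_distrib sum_subtractf)
  also have "\<dots> \<le> (\<Sum>j<N. (a x j)\<^sup>2) * (\<Sum>j<N. (a y j - c j)\<^sup>2)"
    by (rule Cauchy_Schwarz_ineq_sum)
  also have "(\<Sum>j<N. (a y j - c j)\<^sup>2) = (\<Sum>j<N. (a y j)\<^sup>2) + (\<Sum>j<N. (c j)\<^sup>2) - 2 * (\<Sum>j<N. a y j * c j)"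
    by (simp add: power2_diff sum.distrib sum_subtractf sum_distrib_left mult_ac)
  also have "(\<Sum>j<N. (a x j)\<^sup>2) * \<dots> \<le> C * (2 * C - 2 * (sqrt (w y) * poly q y))"
  proof (rule mult_mono)
    show "(\<Sum>j<N. (a y j)\<^sup>2) + (\<Sum>j<N. (c j)\<^sup>2) - 2 * (\<Sum>j<N. a y j * c j) \<le> 2 * C - 2 * (sqrt (w y) * poly q y)"
      using diag[of y] cs unfolding fq by simp
    have "0 \<le> (\<Sum>j<N. (a y j - c j)\<^sup>2)" by (intro sum_nonneg) auto
    then show "0 \<le> (\<Sum>j<N. (a y j)\<^sup>2) + (\<Sum>j<N. (c j)\<^sup>2) - 2 * (\<Sum>j<N. a y j * c j)"
      by (simp add: power2_diff sum.distrib sum_subtractf sum_distrib_left mult_ac)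
  qed (use diag C in auto)
  finally show ?thesis by (rule real_le_rsqrt)
qed

end

section \<open>Integrals of the cardinal sine\<close>

lemma has_integral_sinc_scaled:
  fixes \<tau> y a b :: real
  assumes "a \<le> b"
  shows "((\<lambda>t. \<tau> / pi * sinc (\<tau> * (t - y))) has_integral (Si (\<tau> * (b - y)) - Si (\<tau> * (a - y))) / pi) {a..b}"
proof -
  have "((\<lambda>t. \<tau> / pi * sinc (\<tau> * (t - y))) has_integral (Si (\<tau> * (b - y)) / pi - Si (\<tau> * (a - y)) / pi)) {a..b}"
  proof (rule fundamental_theorem_of_calculus[OF assms])
    fix t assume "t \<in> {a..b}"
    have "((\<lambda>t. Si (\<tau> * (t - y)) / pi) has_real_derivative sinc (\<tau> * (t - y)) * \<tau> / pi) (at t)"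
      by (intro DERIV_cdivide DERIV_chain2[OF DERIV_Si]) (auto intro!: derivative_eq_intros)
    moreover have "sinc (\<tau> * (t - y)) * \<tau> / pi = \<tau> / pi * sinc (\<tau> * (t - y))" by (simp only: times_divide_eq_left mult.commute)
    ultimately have "((\<lambda>t. Si (\<tau> * (t - y)) / pi) has_real_derivative \<tau> / pi * sinc (\<tau> * (t - y))) (at t within {a..b})"
      using has_field_derivative_at_within by metis
    then show "((\<lambda>t. Si (\<tau> * (t - y)) / pi) has_vector_derivative \<tau> / pi * sinc (\<tau> * (t - y))) (at t within {a..b})"
      by (simp only: has_real_derivative_iff_has_vector_derivative)
  qed
  then show ?thesis by (simp add: diff_divide_distrib)
qed

text \<open>Integration by parts gives \<open>Si (2 * u) - (sin u)\<^sup>2 / u\<close> as a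
  primitive of the squared cardinal sine; writing the quotient with \<open>sinc\<close> makes it
  continuous at 0.\<close>

definition sinc2_primitive :: "real \<Rightarrow> real" where
  "sinc2_primitive u = Si (2 * u) - sin u * sinc u"

lemma has_integral_sinc2:
  fixes \<tau> y a b :: real
  assumes "a \<le> b" "0 < \<tau>"
  shows "((\<lambda>t. (\<tau> / pi * sinc (\<tau> * (t - y)))\<^sup>2) has_integral
     \<tau> / pi\<^sup>2 * (sinc2_primitive (\<tau> * (b - y)) - sinc2_primitive (\<tau> * (a - y)))) {a..b}"
proof -
  let ?G = "\<lambda>t. \<tau> / pi\<^sup>2 * sinc2_primitive (\<tau> * (t - y))"
  have cont: "continuous_on UNIV sinc2_primitive"
  proof -
    have Si: "continuous_on UNIV Si" by (intro continuous_at_imp_continuous_on ballI isCont_Si)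
    have "continuous_on UNIV (\<lambda>u. Si (2 * u))"
      by (rule continuous_on_compose2[OF Si]) (auto intro: continuous_intros)
    then show ?thesis
      unfolding sinc2_primitive_def
      by (intro continuous_on_diff continuous_on_mult continuous_on_sin continuous_on_id continuous_on_sinc)
  qed
  have der: "(sinc2_primitive has_real_derivative (sinc u)\<^sup>2) (at u)" if "u \<noteq> 0" for u
  proof -
    have "((\<lambda>u. Si (2 * u) - sin u * (sin u / u)) has_real_derivative
       sinc (2 * u) * 2 - (sin u * ((cos u * u - sin u) / (u * u)) + cos u * (sin u / u))) (at u)"
    proof (intro DERIV_diff DERIV_mult' DERIV_sin)
      show "((\<lambda>u. Si (2 * u)) has_real_derivative sinc (2 * u) * 2) (at u)"
        by (rule DERIV_chain2[OF DERIV_Si]) (auto intro!: derivative_eq_intros)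
      show "((\<lambda>u. sin u / u) has_real_derivative (cos u * u - sin u) / (u * u)) (at u)"
        using DERIV_divide[OF DERIV_sin DERIV_ident, of u] that by simp
    qed
    moreover have "sinc (2 * u) * 2 - (sin u * ((cos u * u - sin u) / (u * u)) + cos u * (sin u / u)) = (sinc u)\<^sup>2"
      using that sin_double[of u] by (simp add: field_simps power2_eq_square)
    ultimately have "((\<lambda>u. Si (2 * u) - sin u * (sin u / u)) has_real_derivative (sinc u)\<^sup>2) (at u)" by simp
    then show ?thesis
    proof (rule has_field_derivative_transform_within_open[of _ _ _ "- {0}"])
      fix x :: real assume "x \<in> - {0}"
      then show "Si (2 * x) - sin x * (sin x / x) = sinc2_primitive x" by (simp add: sinc2_primitive_def)
    qed (use that in auto)
  qed
  \<comment> \<open>The derivative of the primitive was computed away from u = 0 only, hence the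
    exceptional point y, where continuity suffices.\<close>
  have "((\<lambda>t. (\<tau> / pi * sinc (\<tau> * (t - y)))\<^sup>2) has_integral ?G b - ?G a) {a..b}"
  proof (rule fundamental_theorem_of_calculus_interior_strong[of "{y}"])
    fix t assume "t \<in> {a<..<b} - {y}"
    then have "\<tau> * (t - y) \<noteq> 0" using assms by auto
    then have "(?G has_real_derivative \<tau> / pi\<^sup>2 * ((sinc (\<tau> * (t - y)))\<^sup>2 * \<tau>)) (at t)"
      by (intro DERIV_cmult DERIV_chain2[OF der]) (auto intro!: derivative_eq_intros)
    moreover have "\<tau> / pi\<^sup>2 * ((sinc (\<tau> * (t - y)))\<^sup>2 * \<tau>) = (\<tau> / pi * sinc (\<tau> * (t - y)))\<^sup>2"
      unfolding power_mult_distrib power_divide by (simp add: power2_eq_square)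
    ultimately show "(?G has_vector_derivative (\<tau> / pi * sinc (\<tau> * (t - y)))\<^sup>2) (at t)"
      by (simp only: has_real_derivative_iff_has_vector_derivative)
  next
    show "continuous_on {a..b} ?G"
      by (intro continuous_on_mult continuous_on_const continuous_on_compose2[OF cont]) (auto intro!: continuous_intros)
  qed (use assms in auto)
  then show ?thesis by (simp only: right_diff_distrib)
qed

text \<open>The primitive increases, since its increments are integrals of a square, it is odd, and
  it has the limit pi / 2 of \<open>Si\<close>. So the squared cardinal sine has integral at most pi
  over any interval, which gives the sharp norm in \<open>integral_sinc2_le\<close>.\<close>

lemma abs_sinc2_primitive_le: "\<bar>sinc2_primitive u\<bar> \<le> pi / 2"
proof -
  have mono: "sinc2_primitive a \<le> sinc2_primitive b" if "a \<le> b" for a b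
  proof -
    have "0 \<le> 1 / pi\<^sup>2 * (sinc2_primitive (1 * (b - 0)) - sinc2_primitive (1 * (a - 0)))"
      by (rule has_integral_nonneg[OF has_integral_sinc2[OF that, of 1 0]]) auto
    then show ?thesis by (simp add: zero_le_divide_iff)
  qed
  have "(sinc2_primitive \<longlongrightarrow> pi / 2 - 0) at_top"
    unfolding sinc2_primitive_def
  proof (rule tendsto_diff)
    show "((\<lambda>u. Si (2 * u)) \<longlongrightarrow> pi / 2) at_top"
      by (rule filterlim_compose[OF Si_at_top]) (auto intro!: filterlim_tendsto_pos_mult_at_top[OF tendsto_const] filterlim_ident)
    have "((\<lambda>u::real. 1 / u) \<longlongrightarrow> 0) at_top" by (rule tendsto_divide_0[OF tendsto_const]) (auto intro!: filterlim_mono[OF filterlim_ident] at_top_le_at_infinity)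
    then show "((\<lambda>u. sin u * sinc u) \<longlongrightarrow> 0) at_top"
    proof (rule Lim_null_comparison[rotated])
      show "\<forall>\<^sub>F u in at_top. norm (sin u * sinc u) \<le> 1 / u"
        using eventually_gt_at_top[of "0::real"]
      proof eventually_elim
        case (elim u)
        have "\<bar>sin u\<bar> * \<bar>sin u\<bar> \<le> 1 * 1" by (intro mult_mono) auto
        then show ?case using elim by (simp add: abs_mult divide_right_mono)
      qed
    qed
  qed
  then have lim: "(sinc2_primitive \<longlongrightarrow> pi / 2) at_top" by simp
  have up: "sinc2_primitive v \<le> pi / 2" for v
    by (rule tendsto_lowerbound[OF lim]) (auto intro!: eventually_mono[OF eventually_ge_at_top[of v]] mono)
  have odd: "sinc2_primitive (- v) = - sinc2_primitive v" if "0 \<le> v" for v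
    using that Si_neg[of "2 * v"] by (simp add: sinc2_primitive_def)
  show ?thesis
  proof (cases "0 \<le> u")
    case True
    have "0 \<le> sinc2_primitive u" using mono[OF True] odd[of 0] by simp
    then show ?thesis using up[of u] by simp
  next
    case False
    then have "sinc2_primitive u = - sinc2_primitive (- u)" using odd[of "-u"] by simp
    moreover have "0 \<le> sinc2_primitive (- u)" using mono[of 0 "-u"] odd[of 0] False by simp
    ultimately show ?thesis using up[of "-u"] by simp
  qed
qed

lemma integral_sinc2_le:
  fixes \<tau> y a b :: real
  assumes "0 < \<tau>"
  shows "integral {a..b} (\<lambda>t. (\<tau> / pi * sinc (\<tau> * (t - y)))\<^sup>2) \<le> \<tau> / pi"
proof (cases "a \<le> b")
  case True
  have "integral {a..b} (\<lambda>t. (\<tau> / pi * sinc (\<tau> * (t - y)))\<^sup>2)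
     = \<tau> / pi\<^sup>2 * (sinc2_primitive (\<tau> * (b - y)) - sinc2_primitive (\<tau> * (a - y)))"
    by (rule integral_unique[OF has_integral_sinc2[OF True assms]])
  also have "\<dots> \<le> \<tau> / pi\<^sup>2 * pi"
    using abs_sinc2_primitive_le[of "\<tau> * (b - y)"] abs_sinc2_primitive_le[of "\<tau> * (a - y)"] assms
    by (intro mult_left_mono) auto
  finally show ?thesis by (simp add: power2_eq_square)
qed (use assms in auto)

lemma integral_Cauchy_Schwarz:
  fixes f g :: "real \<Rightarrow> real"
  assumes f: "continuous_on {a..b} f" and g: "continuous_on {a..b} g"
  shows "(integral {a..b} (\<lambda>t. f t * g t))\<^sup>2 \<le> integral {a..b} (\<lambda>t. (f t)\<^sup>2) * integral {a..b} (\<lambda>t. (g t)\<^sup>2)"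
proof -
  define A where "A = integral {a..b} (\<lambda>t. (f t)\<^sup>2)"
  define B where "B = integral {a..b} (\<lambda>t. f t * g t)"
  define C where "C = integral {a..b} (\<lambda>t. (g t)\<^sup>2)"
  have q: "0 \<le> A * x\<^sup>2 - 2 * B * x + C" for x
  proof -
    have "((\<lambda>t. (f t)\<^sup>2 * x\<^sup>2 - 2 * x * (f t * g t) + (g t)\<^sup>2) has_integral (A * x\<^sup>2 - 2 * x * B + C)) {a..b}"
      unfolding A_def B_def C_def
      by (intro has_integral_add has_integral_diff has_integral_mult_left has_integral_mult_right
          integrable_integral integrable_continuous_real continuous_intros f g)
    moreover have "(f t)\<^sup>2 * x\<^sup>2 - 2 * x * (f t * g t) + (g t)\<^sup>2 = (f t * x - g t)\<^sup>2" for t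
      by (simp add: power2_diff power_mult_distrib mult_ac)
    ultimately have "((\<lambda>t. (f t * x - g t)\<^sup>2) has_integral (A * x\<^sup>2 - 2 * x * B + C)) {a..b}" by simp
    then have "0 \<le> A * x\<^sup>2 - 2 * x * B + C" by (rule has_integral_nonneg) auto
    then show ?thesis by (simp add: mult_ac)
  qed
  have A0: "0 \<le> A" unfolding A_def by (intro integral_nonneg integrable_continuous_real continuous_intros f) auto
  show ?thesis
  proof (cases "A = 0")
    case True
    have "B = 0"
    proof (rule ccontr)
      assume "B \<noteq> 0"
      \<comment> \<open>For A = 0 the expression in \<open>q\<close> is linear in x, and at this
        point it equals -1.\<close>
      then show False using q[of "(C + 1) / (2 * B)"] True by simp
    qed
    then show ?thesis using True by (simp add: A_def B_def)
  next
    case False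
    then have "A > 0" using A0 by simp
    have "0 \<le> A * (B / A)\<^sup>2 - 2 * B * (B / A) + C" by (rule q)
    also have "\<dots> = C - B\<^sup>2 / A" using False by (simp add: power2_eq_square field_simps)
    finally show ?thesis using \<open>A > 0\<close> by (simp add: A_def[symmetric] B_def[symmetric] C_def[symmetric] divide_le_eq mult.commute)
  qed
qed

section \<open>Asymptotics of the points\<close>

lemma card_int_annulus_le:
  fixes A B :: real
  assumes "A \<le> B"
  shows "finite {n::int. A \<le> \<bar>real_of_int n\<bar> \<and> \<bar>real_of_int n\<bar> \<le> B}"
    and "real (card {n::int. A \<le> \<bar>real_of_int n\<bar> \<and> \<bar>real_of_int n\<bar> \<le> B}) \<le> 2 * (B - A + 1)"
proof -
  let ?X = "{n::int. A \<le> \<bar>real_of_int n\<bar> \<and> \<bar>real_of_int n\<bar> \<le> B}"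
  have sub: "?X \<subseteq> {\<lceil>A\<rceil>..\<lfloor>B\<rfloor>} \<union> {-\<lfloor>B\<rfloor>..-\<lceil>A\<rceil>}"
  proof
    fix n assume n: "n \<in> ?X"
    show "n \<in> {\<lceil>A\<rceil>..\<lfloor>B\<rfloor>} \<union> {-\<lfloor>B\<rfloor>..-\<lceil>A\<rceil>}"
    proof (cases "0 \<le> n")
      case True
      then have "A \<le> real_of_int n" "real_of_int n \<le> B" using n by auto
      then show ?thesis by (simp add: ceiling_le_iff le_floor_iff)
    next
      case False
      then have "A \<le> real_of_int (-n)" "real_of_int (-n) \<le> B" using n by auto
      then have "\<lceil>A\<rceil> \<le> -n" "-n \<le> \<lfloor>B\<rfloor>" by (simp_all only: ceiling_le_iff le_floor_iff)
      then show ?thesis by auto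
    qed
  qed
  then show "finite ?X" by (rule finite_subset) simp
  have "card ?X \<le> card ({\<lceil>A\<rceil>..\<lfloor>B\<rfloor>} \<union> {-\<lfloor>B\<rfloor>..-\<lceil>A\<rceil>})" by (rule card_mono) (use sub in auto)
  also have "\<dots> \<le> nat (\<lfloor>B\<rfloor> - \<lceil>A\<rceil> + 1) + nat (\<lfloor>B\<rfloor> - \<lceil>A\<rceil> + 1)"
    by (rule order_trans[OF card_Un_le]) simp
  finally have "real (card ?X) \<le> real (nat (\<lfloor>B\<rfloor> - \<lceil>A\<rceil> + 1)) + real (nat (\<lfloor>B\<rfloor> - \<lceil>A\<rceil> + 1))"
    by linarith
  also have "real (nat (\<lfloor>B\<rfloor> - \<lceil>A\<rceil> + 1)) \<le> B - A + 1"
    using assms by linarith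
  finally show "real (card ?X) \<le> 2 * (B - A + 1)" by simp
qed

locale points =
  fixes p :: "int \<Rightarrow> real" and L :: real
  assumes strict_mono: "strict_mono p"
    and sum_limit: "((\<lambda>S. \<Sum>n | 0 < \<bar>p n\<bar> \<and> \<bar>p n\<bar> < S. 1 / p n) \<longlongrightarrow> L) at_top"
    and limit_top: "((\<lambda>n. p n / of_int n) \<longlongrightarrow> 1) at_top"
    and limit_bot: "((\<lambda>n. p n / of_int n) \<longlongrightarrow> 1) at_bot"
begin

lemma mono_iff: "p m \<le> p n \<longleftrightarrow> m \<le> n"
  using strict_mono by (simp add: strict_mono_less_eq)

lemma near_lattice:
  assumes "0 < \<delta>"
  obtains n0 :: real where "1 \<le> n0" "\<And>n. n0 \<le> \<bar>real_of_int n\<bar> \<Longrightarrow> \<bar>p n - real_of_int n\<bar> \<le> \<delta> * \<bar>real_of_int n\<bar>"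
proof -
  have "\<forall>\<^sub>F n in at_top. \<bar>p n / of_int n - 1\<bar> < \<delta>"
    using tendstoD[OF limit_top assms] by (simp add: dist_real_def)
  then obtain N1 where N1: "\<And>n. N1 \<le> n \<Longrightarrow> \<bar>p n / of_int n - 1\<bar> < \<delta>"
    by (auto simp: eventually_at_top_linorder)
  have "\<forall>\<^sub>F n in at_bot. \<bar>p n / of_int n - 1\<bar> < \<delta>"
    using tendstoD[OF limit_bot assms] by (simp add: dist_real_def)
  then obtain N2 where N2: "\<And>n. n \<le> N2 \<Longrightarrow> \<bar>p n / of_int n - 1\<bar> < \<delta>"
    by (auto simp: eventually_at_bot_linorder)
  define n0 where "n0 = max 1 (max \<bar>real_of_int N1\<bar> \<bar>real_of_int N2\<bar>)"
  have "\<bar>p n - real_of_int n\<bar> \<le> \<delta> * \<bar>real_of_int n\<bar>" if n: "n0 \<le> \<bar>real_of_int n\<bar>" for n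
  proof -
    have "\<bar>p n / of_int n - 1\<bar> < \<delta>"
    proof (cases "0 \<le> n")
      case True
      then show ?thesis using n by (intro N1) (auto simp: n0_def)
    next
      case False
      then show ?thesis using n by (intro N2) (auto simp: n0_def)
    qed
    moreover have "n \<noteq> 0" using n by (auto simp: n0_def)
    then have "p n - real_of_int n = (p n / of_int n - 1) * real_of_int n" by (simp add: field_simps)
    ultimately show ?thesis by (simp add: abs_mult mult_right_mono)
  qed
  then show ?thesis using that[of n0] by (auto simp: n0_def)
qed

definition inner :: "real \<Rightarrow> int set" where "inner R = {n. \<bar>p n\<bar> \<le> R}"

lemma finite_inner [simp]: "finite (inner R)"
proof -
  obtain n0 where n0: "1 \<le> n0" "\<And>n. n0 \<le> \<bar>real_of_int n\<bar> \<Longrightarrow> \<bar>p n - real_of_int n\<bar> \<le> 1/2 * \<bar>real_of_int n\<bar>"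
    using near_lattice[of "1/2"] by auto
  have "inner R \<subseteq> {n. 0 \<le> \<bar>real_of_int n\<bar> \<and> \<bar>real_of_int n\<bar> \<le> max n0 (2 * \<bar>R\<bar>)}"
  proof
    fix n assume "n \<in> inner R"
    then have "\<bar>p n\<bar> \<le> R" by (simp add: inner_def)
    then show "n \<in> {n. 0 \<le> \<bar>real_of_int n\<bar> \<and> \<bar>real_of_int n\<bar> \<le> max n0 (2 * \<bar>R\<bar>)}"
    proof (cases "n0 \<le> \<bar>real_of_int n\<bar>")
      case True
      then have "\<bar>real_of_int n\<bar> \<le> 2 * \<bar>R\<bar>" using n0(2)[of n] \<open>\<bar>p n\<bar> \<le> R\<close> by linarith
      then show ?thesis by simp
    qed simp
  qed
  then show ?thesis by (rule finite_subset) (intro card_int_annulus_le(1), use n0 in auto)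
qed

lemma finite_less [simp]: "finite {n. \<bar>p n\<bar> < S}" "finite {n. 0 < \<bar>p n\<bar> \<and> \<bar>p n\<bar> < S}"
  by (rule finite_subset[OF _ finite_inner[of S]], force simp: inner_def)+

text \<open>Monotonicity makes \<open>inner R\<close> an interval of indices. Its end indices
  satisfy |p n| \<le> R and their outer neighbours |p n| > R; all of them lie beyond the index k
  from which p n is close to n, so a and b agree with R up to a small proportion. For the same
  reason every index outside \<open>inner R\<close> is close to its point.\<close>

lemma inner_interval:
  fixes \<delta> :: real
  assumes \<delta>: "0 < \<delta>" "\<delta> \<le> 1/2"
  shows "\<forall>\<^sub>F R in at_top. \<exists>a b::int. inner R = {-a..b} \<and>
     (1 - \<delta>) * R \<le> real_of_int a \<and> real_of_int a \<le> (1 + \<delta>) * R \<and>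
     (1 - \<delta>) * R \<le> real_of_int b \<and> real_of_int b \<le> (1 + \<delta>) * R \<and>
     (\<forall>n. n \<notin> inner R \<longrightarrow> \<bar>p n - real_of_int n\<bar> \<le> \<delta> * \<bar>real_of_int n\<bar>)"
proof -
  \<comment> \<open>The accuracy \<delta>/4 leaves room for (1 + \<delta>)(1 - \<delta>/4) \<ge> 1
    and (1 - \<delta>/2)(1 + \<delta>/4) \<le> 1.\<close>
  obtain n0 where n0: "1 \<le> n0"
    "\<And>n. n0 \<le> \<bar>real_of_int n\<bar> \<Longrightarrow> \<bar>p n - real_of_int n\<bar> \<le> \<delta>/4 * \<bar>real_of_int n\<bar>"
    using near_lattice[of "\<delta>/4"] \<delta> by auto
  define k where "k = \<lceil>n0\<rceil>"
  have k: "n0 \<le> real_of_int k" "1 \<le> k" using n0(1) unfolding k_def by linarith+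
  have "\<forall>\<^sub>F R in at_top. max (p k) (- p (-k)) \<le> R \<and> 4 / \<delta> \<le> R"
    by (intro eventually_conj eventually_ge_at_top)
  then show ?thesis
  proof eventually_elim
    case (elim R)
    then have R: "p k \<le> R" "- p (-k) \<le> R" "4 / \<delta> \<le> R" by auto
    have R4: "4 \<le> \<delta> * R" using R(3) \<delta> by (simp add: divide_le_eq mult.commute)
    have kJ: "n \<in> inner R" if "\<bar>n\<bar> \<le> k" for n
      using that mono_iff[of n k] mono_iff[of "-k" n] R by (auto simp: inner_def)
    define b where "b = Max (inner R)"
    define a where "a = - Min (inner R)"
    have ne: "inner R \<noteq> {}" using kJ[of 0] k by auto
    have bJ: "b \<in> inner R" and aJ: "-a \<in> inner R" using Max_in[OF _ ne] Min_in[OF _ ne] by (auto simp: a_def b_def)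
    have J: "inner R = {-a..b}"
    proof (intro set_eqI iffI)
      fix n assume "n \<in> inner R"
      then show "n \<in> {-a..b}" by (simp add: a_def b_def)
    next
      fix n assume "n \<in> {-a..b}"
      then show "n \<in> inner R" using mono_iff[of n b] mono_iff[of "-a" n] aJ bJ by (auto simp: inner_def)
    qed
    have kb: "k \<le> b" using kJ[of k] k unfolding J by auto
    have ka: "k \<le> a" using kJ[of "-k"] k unfolding J by auto
    have out: "\<bar>p n - real_of_int n\<bar> \<le> \<delta>/4 * \<bar>real_of_int n\<bar>" if "k \<le> \<bar>n\<bar>" for n
      using that k by (intro n0(2)) linarith
    have upper: "real_of_int c \<le> (1 + \<delta>) * R" if "k \<le> c" "\<bar>p n\<bar> \<le> R" "\<bar>n\<bar> = c" for c n
    proof -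
      have "\<bar>real_of_int n\<bar> = real_of_int c" using that by linarith
      then have nd: "\<bar>p n - real_of_int n\<bar> \<le> \<delta>/4 * real_of_int c" using out[of n] that by auto
      then have "(1 - \<delta>/4) * real_of_int c \<le> R"
        using \<open>\<bar>real_of_int n\<bar> = real_of_int c\<close> that left_diff_distrib[of 1 "\<delta>/4" "real_of_int c"] by linarith
      then have "(1 + \<delta>) * ((1 - \<delta>/4) * real_of_int c) \<le> (1 + \<delta>) * R" using \<delta> by (intro mult_left_mono) auto
      moreover have "real_of_int c \<le> (1 + \<delta>) * ((1 - \<delta>/4) * real_of_int c)"
      proof -
        have "1 \<le> (1 + \<delta>) * (1 - \<delta>/4)" using \<delta> mult_right_mono[of \<delta> "1/2" \<delta>] by (simp add: algebra_simps)
        then show ?thesis using that k by (simp add: mult.assoc[symmetric])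
      qed
      ultimately show ?thesis by linarith
    qed
    \<comment> \<open>Here n is the first index outside, so |n| = c + 1; the extra 1 is absorbed by
      \<delta> R / 2, as \<delta> R \<ge> 4.\<close>
    have lower: "(1 - \<delta>) * R \<le> real_of_int c" if "k \<le> c" "R < \<bar>p n\<bar>" "\<bar>n\<bar> = c + 1" for c n
    proof -
      define x where "x = real_of_int c + 1"
      have c: "\<bar>real_of_int n\<bar> = x" using that unfolding x_def by linarith
      then have nd: "\<bar>p n - real_of_int n\<bar> \<le> \<delta>/4 * x" using out[of n] that by auto
      have "R \<le> x + \<delta>/4 * x"
        using nd c that(2) by linarith
      then have "R \<le> (1 + \<delta>/4) * (real_of_int c + 1)" unfolding x_def by (simp add: algebra_simps)
      then have "(1 - \<delta>/2) * R \<le> (1 - \<delta>/2) * ((1 + \<delta>/4) * (real_of_int c + 1))"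
        using \<delta> by (intro mult_left_mono) auto
      moreover have "(1 - \<delta>/2) * ((1 + \<delta>/4) * (real_of_int c + 1)) \<le> real_of_int c + 1"
      proof -
        have "(1 - \<delta>/2) * (1 + \<delta>/4) \<le> 1" using \<delta> by (simp add: algebra_simps)
        then show ?thesis using that k by (simp add: mult.assoc[symmetric])
      qed
      ultimately have "(1 - \<delta>/2) * R \<le> real_of_int c + 1" by linarith
      then show ?thesis using R4 by (simp add: algebra_simps)
    qed
    have pb: "R < \<bar>p (b+1)\<bar>" and pa: "R < \<bar>p (-a-1)\<bar>"
    proof -
      have "b + 1 \<notin> inner R" "-a-1 \<notin> inner R" unfolding J by auto
      then show "R < \<bar>p (b+1)\<bar>" "R < \<bar>p (-a-1)\<bar>" by (auto simp: inner_def)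
    qed
    show ?case
    proof (rule exI[of _ a], rule exI[of _ b], intro conjI J)
      show "(1 - \<delta>) * R \<le> real_of_int a" by (rule lower[OF ka pa]) (use ka k in auto)
      show "(1 - \<delta>) * R \<le> real_of_int b" by (rule lower[OF kb pb]) (use kb k in auto)
      show "real_of_int a \<le> (1 + \<delta>) * R" by (rule upper[OF ka, of "-a"]) (use aJ ka k in \<open>auto simp: inner_def\<close>)
      show "real_of_int b \<le> (1 + \<delta>) * R" by (rule upper[OF kb, of "b"]) (use bJ kb k in \<open>auto simp: inner_def\<close>)
      show "\<forall>n. n \<notin> inner R \<longrightarrow> \<bar>p n - real_of_int n\<bar> \<le> \<delta> * \<bar>real_of_int n\<bar>"
      proof (intro allI impI)
        fix n assume "n \<notin> inner R"
        then have "k \<le> \<bar>n\<bar>" using ka kb unfolding J by auto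
        then have "\<bar>p n - real_of_int n\<bar> \<le> \<delta>/4 * \<bar>real_of_int n\<bar>" by (rule out)
        also have "\<dots> \<le> \<delta> * \<bar>real_of_int n\<bar>" using \<delta> by (intro mult_right_mono) auto
        finally show "\<bar>p n - real_of_int n\<bar> \<le> \<delta> * \<bar>real_of_int n\<bar>" .
      qed
    qed
  qed
qed

text \<open>The hypothesis truncates by \<open>\<bar>p n\<bar> < S\<close>, the comparison with the integer lattice by
  \<open>\<bar>n\<bar> \<le> S\<close>; the discrepancy is a set of \<open>o(S)\<close> indices on which \<open>p n\<close> has size about \<open>S\<close>.\<close>

definition trunc_diff :: "real \<Rightarrow> int set" where
  "trunc_diff S = {n. (\<bar>p n\<bar> < S) \<noteq> (\<bar>real_of_int n\<bar> \<le> S)}"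

lemma trunc_diff_bounds:
  assumes \<delta>: "0 < \<delta>" "\<delta> \<le> (1/2::real)"
  shows "\<forall>\<^sub>F S in at_top. finite (trunc_diff S) \<and> (\<forall>n\<in>trunc_diff S. S / 4 \<le> \<bar>p n\<bar>) \<and>
     (\<Sum>n\<in>trunc_diff S. 1 / \<bar>p n\<bar>) \<le> \<delta>"
proof -
  \<comment> \<open>The annulus holding the discrepancy contains at most 2 (3 d S + 1) integers and
    each term is at most 4 / S; together 24 d + 8 / S \<le> 32 d.\<close>
  define d where "d = \<delta>/32"
  have d: "0 < d" "d \<le> 1/32" using \<delta> by (auto simp: d_def)
  obtain n0 where n0: "1 \<le> n0"
    "\<And>n. n0 \<le> \<bar>real_of_int n\<bar> \<Longrightarrow> \<bar>p n - real_of_int n\<bar> \<le> d * \<bar>real_of_int n\<bar>"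
    using near_lattice[of d] d by auto
  define k where "k = \<lceil>n0\<rceil>"
  have k: "n0 \<le> real_of_int k" "1 \<le> k" using n0(1) unfolding k_def by linarith+
  have "\<forall>\<^sub>F S in at_top. max (p k) (- p (-k)) < S \<and> real_of_int k < S \<and> 1 / d \<le> S \<and> 1 \<le> S"
    by (intro eventually_conj eventually_ge_at_top eventually_gt_at_top)
  then show ?thesis
  proof eventually_elim
    case (elim S)
    then have S: "p k < S" "- p (-k) < S" "real_of_int k < S" "1 / d \<le> S" "1 \<le> S" by auto
    have dS: "1 \<le> d * S" using S(4) d by (simp add: divide_le_eq mult.commute)
    have bd: "(1 - d) * S \<le> \<bar>real_of_int n\<bar> \<and> \<bar>real_of_int n\<bar> \<le> (1 + 2 * d) * S \<and> S/4 \<le> \<bar>p n\<bar>"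
      if n: "n \<in> trunc_diff S" for n
    proof -
      \<comment> \<open>Up to k both truncations keep the index, so a discrepancy occurs only where
        p n is close to n.\<close>
      have kn: "k < \<bar>n\<bar>"
      proof (rule ccontr)
        assume "\<not> k < \<bar>n\<bar>"
        then have kn: "\<bar>n\<bar> \<le> k" by simp
        have "\<bar>p n\<bar> < S" using kn S mono_iff[of n k] mono_iff[of "-k" n] by auto
        moreover have "\<bar>real_of_int n\<bar> \<le> S" using kn S by linarith
        ultimately show False using n by (auto simp: trunc_diff_def)
      qed
      then have "n0 \<le> \<bar>real_of_int n\<bar>" using k by linarith
      then have near: "\<bar>p n - real_of_int n\<bar> \<le> d * \<bar>real_of_int n\<bar>" by (rule n0(2))
      consider "\<bar>p n\<bar> < S" "S < \<bar>real_of_int n\<bar>" | "S \<le> \<bar>p n\<bar>" "\<bar>real_of_int n\<bar> \<le> S"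
        using n by (auto simp: trunc_diff_def)
      then show ?thesis
      proof cases
        case 1
        have "(1 - d) * \<bar>real_of_int n\<bar> \<le> S" using near 1 left_diff_distrib[of 1 d "\<bar>real_of_int n\<bar>"] by linarith
        then have "(1 + 2 * d) * ((1 - d) * \<bar>real_of_int n\<bar>) \<le> (1 + 2 * d) * S" using d by (intro mult_left_mono) auto
        moreover have "1 * \<bar>real_of_int n\<bar> \<le> ((1 + 2 * d) * (1 - d)) * \<bar>real_of_int n\<bar>"
        proof (rule mult_right_mono)
          show "1 \<le> (1 + 2 * d) * (1 - d)" using d mult_right_mono[of d "1/32" d] by (simp add: algebra_simps)
        qed simp
        ultimately have "\<bar>real_of_int n\<bar> \<le> (1 + 2 * d) * S" by (simp add: mult.assoc)
        moreover have "(1 - d) * S \<le> 1 * S" using d S by (intro mult_right_mono) auto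
        moreover have "S/4 \<le> \<bar>p n\<bar>"
        proof -
          have "d * \<bar>real_of_int n\<bar> \<le> 1/32 * \<bar>real_of_int n\<bar>" using d by (intro mult_right_mono) auto
          then show ?thesis using near 1 S by linarith
        qed
        ultimately show ?thesis using 1 by linarith
      next
        case 2
        have "S \<le> (1 + d) * \<bar>real_of_int n\<bar>" using near 2 distrib_right[of 1 d "\<bar>real_of_int n\<bar>"] by linarith
        then have "(1 - d) * S \<le> (1 - d) * ((1 + d) * \<bar>real_of_int n\<bar>)" using d by (intro mult_left_mono) auto
        also have "\<dots> = ((1 - d) * (1 + d)) * \<bar>real_of_int n\<bar>" by (simp add: mult.assoc)
        also have "\<dots> \<le> 1 * \<bar>real_of_int n\<bar>" by (rule mult_right_mono) (auto simp: algebra_simps)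
        finally have "(1 - d) * S \<le> \<bar>real_of_int n\<bar>" by simp
        moreover have "1 * S \<le> (1 + 2 * d) * S" using d S by (intro mult_right_mono) auto
        ultimately show ?thesis using 2 S by linarith
      qed
    qed
    let ?X = "{n::int. (1 - d) * S \<le> \<bar>real_of_int n\<bar> \<and> \<bar>real_of_int n\<bar> \<le> (1 + 2 * d) * S}"
    have AB: "(1 - d) * S \<le> (1 + 2 * d) * S" using d S by (intro mult_right_mono) auto
    have sub: "trunc_diff S \<subseteq> ?X" using bd by blast
    have fin: "finite (trunc_diff S)" by (rule finite_subset[OF sub card_int_annulus_le(1)[OF AB]])
    have "(\<Sum>n\<in>trunc_diff S. 1 / \<bar>p n\<bar>) \<le> (\<Sum>n\<in>trunc_diff S. 4 / S)"
    proof (rule sum_mono)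
      fix n assume "n \<in> trunc_diff S"
      then have "S/4 \<le> \<bar>p n\<bar>" using bd by blast
      then have "1 / \<bar>p n\<bar> \<le> 1 / (S/4)" using S by (intro divide_left_mono) auto
      then show "1 / \<bar>p n\<bar> \<le> 4 / S" by simp
    qed
    also have "\<dots> = real (card (trunc_diff S)) * (4 / S)" by simp
    also have "\<dots> \<le> (2 * ((1 + 2 * d) * S - (1 - d) * S + 1)) * (4 / S)"
    proof (rule mult_right_mono)
      have "real (card (trunc_diff S)) \<le> real (card ?X)"
        using card_mono[OF card_int_annulus_le(1)[OF AB] sub] by simp
      also have "\<dots> \<le> 2 * ((1 + 2 * d) * S - (1 - d) * S + 1)" by (rule card_int_annulus_le(2)[OF AB])
      finally show "real (card (trunc_diff S)) \<le> 2 * ((1 + 2 * d) * S - (1 - d) * S + 1)" .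
    qed (use S in auto)
    also have "\<dots> = 24 * d + 8 / S" using S by (simp add: field_simps)
    also have "8 / S \<le> 8 * d" using dS S by (simp add: divide_le_eq)
    also have "24 * d + 8 * d = \<delta>" by (simp add: d_def)
    finally show ?case using fin bd by auto
  qed
qed

definition outer :: "real \<Rightarrow> nat \<Rightarrow> int set" where
  "outer R M = {-int M..int M} - inner R"

lemma finite_outer [simp]: "finite (outer R M)" by (simp add: outer_def)

text \<open>Convergence is assumed for truncation by size; \<open>trunc_diff_bounds\<close>
  transfers it to truncation by index with the same limit.\<close>

lemma outer_sum_limit: "(\<lambda>M. \<Sum>n\<in>outer R M. 1 / p n) \<longlonglongrightarrow> L - (\<Sum>n\<in>inner R. 1 / p n)"
proof -
  have "(\<lambda>M::nat. \<Sum>n | 0 < \<bar>p n\<bar> \<and> \<bar>p n\<bar> < real M. 1 / p n) \<longlonglongrightarrow> L"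
    by (rule filterlim_compose[OF sum_limit filterlim_real_sequentially])
  moreover have "(\<lambda>M::nat. (\<Sum>n\<in>{-int M..int M}. 1 / p n) - (\<Sum>n | 0 < \<bar>p n\<bar> \<and> \<bar>p n\<bar> < real M. 1 / p n)) \<longlonglongrightarrow> 0"
  proof (rule tendstoI)
    fix e :: real assume e: "0 < e"
    define \<delta> where "\<delta> = min (1/2) (e/2)"
    have \<delta>: "0 < \<delta>" "\<delta> \<le> 1/2" "\<delta> < e" using e by (auto simp: \<delta>_def)
    have "\<forall>\<^sub>F M::nat in sequentially. finite (trunc_diff (real M)) \<and> (\<forall>n\<in>trunc_diff (real M). real M / 4 \<le> \<bar>p n\<bar>) \<and>
     (\<Sum>n\<in>trunc_diff (real M). 1 / \<bar>p n\<bar>) \<le> \<delta>"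
      using filterlim_real_sequentially trunc_diff_bounds[OF \<delta>(1,2)] unfolding filterlim_iff by blast
    then show "\<forall>\<^sub>F M::nat in sequentially. dist ((\<Sum>n\<in>{-int M..int M}. 1 / p n) -
        (\<Sum>n | 0 < \<bar>p n\<bar> \<and> \<bar>p n\<bar> < real M. 1 / p n)) 0 < e"
    proof eventually_elim
      case (elim M)
      define A where "A = {-int M..int M}"
      define B where "B = {n. \<bar>p n\<bar> < real M}"
      have fAB: "finite A" "finite B" by (auto simp: A_def B_def)
      \<comment> \<open>An index with \<open>p n = 0\<close> may be included because
        \<open>1 / 0 = 0\<close>.\<close>
      have eqB: "(\<Sum>n | 0 < \<bar>p n\<bar> \<and> \<bar>p n\<bar> < real M. 1 / p n) = (\<Sum>n\<in>B. 1 / p n)"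
        by (rule sum.mono_neutral_left) (auto simp: B_def)
      have D: "trunc_diff (real M) = (A - B) \<union> (B - A)"
        by (auto simp: trunc_diff_def A_def B_def)
      have "\<bar>(\<Sum>n\<in>A. 1 / p n) - (\<Sum>n\<in>B. 1 / p n)\<bar> = \<bar>(\<Sum>n\<in>A-B. 1 / p n) - (\<Sum>n\<in>B-A. 1 / p n)\<bar>"
        using sum.Int_Diff[OF fAB(1), of "\<lambda>n. 1 / p n" B] sum.Int_Diff[OF fAB(2), of "\<lambda>n. 1 / p n" A]
        by (simp add: Int_commute)
      also have "\<dots> \<le> (\<Sum>n\<in>A-B. \<bar>1 / p n\<bar>) + (\<Sum>n\<in>B-A. \<bar>1 / p n\<bar>)"
        using sum_abs[of "\<lambda>n. 1 / p n" "A-B"] sum_abs[of "\<lambda>n. 1 / p n" "B-A"] by linarith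
      also have "\<dots> = (\<Sum>n\<in>trunc_diff (real M). 1 / \<bar>p n\<bar>)"
        unfolding D by (subst sum.union_disjoint) (use fAB in auto)
      also have "\<dots> < e" using elim \<delta> by linarith
      finally show ?case unfolding eqB A_def[symmetric] dist_real_def by simp
    qed
  qed
  ultimately have "(\<lambda>M::nat. \<Sum>n\<in>{-int M..int M}. 1 / p n) \<longlonglongrightarrow> L"
    by (rule Lim_transform)
  then have lim: "(\<lambda>M::nat. (\<Sum>n\<in>{-int M..int M}. 1 / p n) - (\<Sum>n\<in>inner R. 1 / p n)) \<longlonglongrightarrow> L - (\<Sum>n\<in>inner R. 1 / p n)"
    by (intro tendsto_diff tendsto_const)
  have "\<exists>M0. \<forall>n\<in>inner R. \<bar>n\<bar> \<le> int M0"
  proof -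
    have "finite ((\<lambda>n. nat \<bar>n\<bar>) ` inner R)" by simp
    then obtain M0 where "\<forall>x\<in>(\<lambda>n. nat \<bar>n\<bar>) ` inner R. x \<le> M0" using finite_nat_set_iff_bounded_le by blast
    then show ?thesis by (intro exI[of _ M0]) auto
  qed
  then obtain M0 where M0: "\<And>n. n \<in> inner R \<Longrightarrow> \<bar>n\<bar> \<le> int M0" by blast
  show ?thesis
  proof (rule Lim_transform_eventually[OF lim])
    show "\<forall>\<^sub>F M in sequentially. (\<Sum>n\<in>{-int M..int M}. 1 / p n) - (\<Sum>n\<in>inner R. 1 / p n) = (\<Sum>n\<in>outer R M. 1 / p n)"
      using eventually_ge_at_top[of M0]
    proof eventually_elim
      case (elim M)
      have "inner R \<subseteq> {-int M..int M}" using M0 elim by fastforce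
      then show ?case unfolding outer_def by (subst sum_diff) auto
    qed
  qed
qed

lemma inner_sum_limit: "((\<lambda>R. \<Sum>n\<in>inner R. 1 / p n) \<longlongrightarrow> L) at_top"
proof (rule tendstoI)
  fix e :: real assume "0 < e"
  from tendstoD[OF sum_limit this] obtain R0
    where R0: "\<And>S. R0 \<le> S \<Longrightarrow> dist (\<Sum>n | 0 < \<bar>p n\<bar> \<and> \<bar>p n\<bar> < S. 1 / p n) L < e"
    by (auto simp: eventually_at_top_linorder)
  show "\<forall>\<^sub>F R in at_top. dist (\<Sum>n\<in>inner R. 1 / p n) L < e"
    using eventually_ge_at_top[of R0]
  proof eventually_elim
    case (elim R)
    \<comment> \<open>The minimum S of V is R + 1 or the smallest |p n| above R, so that the strict
      truncation at S selects exactly the closed set \<open>inner R\<close>.\<close>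
    define V where "V = insert (R + 1) ((\<lambda>n. \<bar>p n\<bar>) ` {n \<in> inner (R+1). R < \<bar>p n\<bar>})"
    define S where "S = Min V"
    have fV: "finite V" "V \<noteq> {}" by (auto simp: V_def)
    have "S \<in> V" unfolding S_def by (rule Min_in[OF fV])
    then have SR: "R < S" by (auto simp: V_def)
    have "R < S \<and> S \<le> R + 1" using SR Min_le[OF fV(1), of "R+1"] by (auto simp: S_def V_def)
    have iff: "\<bar>p n\<bar> < S \<longleftrightarrow> \<bar>p n\<bar> \<le> R" for n
    proof
      assume n: "\<bar>p n\<bar> < S"
      show "\<bar>p n\<bar> \<le> R"
      proof (rule ccontr)
        assume "\<not> \<bar>p n\<bar> \<le> R"
        then have "\<bar>p n\<bar> \<in> V" using n \<open>R < S \<and> S \<le> R + 1\<close> by (auto simp: V_def inner_def)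
        then have "S \<le> \<bar>p n\<bar>" unfolding S_def by (rule Min_le[OF fV(1)])
        then show False using n by simp
      qed
    qed (use SR in auto)
    have "(\<Sum>n | 0 < \<bar>p n\<bar> \<and> \<bar>p n\<bar> < S. 1 / p n) = (\<Sum>n\<in>inner R. 1 / p n)"
      by (rule sum.mono_neutral_left[OF finite_inner]) (auto simp: inner_def iff)
    then show ?case using R0[of S] elim SR by auto
  qed
qed

text \<open>For fixed R the tail sums tend to L minus the sum over \<open>inner R\<close>, and that
  difference is small for large R. The quantifiers leave M to be chosen after R.\<close>

lemma outer_sum_small:
  assumes "0 < \<delta>"
  shows "\<forall>\<^sub>F R in at_top. \<forall>\<^sub>F M in sequentially. \<bar>\<Sum>n\<in>outer R M. 1 / p n\<bar> < \<delta>"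
  using tendstoD[OF inner_sum_limit assms]
proof eventually_elim
  case (elim R)
  then have "\<bar>L - (\<Sum>n\<in>inner R. 1 / p n)\<bar> < \<delta>" by (simp add: dist_real_def abs_minus_commute)
  then show ?case using order_tendstoD(2)[OF tendsto_rabs[OF outer_sum_limit]] by blast
qed

end

section \<open>Interpolation at lattice nodes\<close>

lemma shell_split: "0 \<le> m \<Longrightarrow> m \<le> M \<Longrightarrow> shell 0 M = shell 0 m \<union> shell m M" "shell 0 m \<inter> shell m M = {}"
  by (auto simp: shell_def)

lemma sin_prod_split:
  assumes "0 \<le> m" "m \<le> M"
  shows "sin_prod M z = sin_prod m z * (\<Prod>j\<in>shell m M. 1 - z / of_int j)"
  unfolding sin_prod_def shell_split(1)[OF assms]
  by (subst prod.union_disjoint) (auto simp: shell_split(2))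

lemma norm_one_minus_pos:
  fixes w :: complex
  assumes "norm w < \<bar>x\<bar>"
  shows "0 < norm (1 - w / of_real x)"
proof -
  have "norm (w / of_real x) < 1" using assms by (simp add: norm_divide divide_less_eq)
  then show ?thesis by force
qed

lemma one_minus_pos:
  fixes w :: real
  assumes "\<bar>w\<bar> < \<bar>x\<bar>"
  shows "0 < 1 - w / x"
proof -
  have "\<bar>w / x\<bar> < 1" using assms by (simp add: abs_divide divide_less_eq)
  then show ?thesis by linarith
qed

lemma prod_compare_complex_exp:
  fixes r :: "int \<Rightarrow> real" and w :: complex and R \<eta> :: real and I :: "int set" and m M :: int
  assumes "finite I" and R: "8 \<le> R" and eta: "0 < \<eta>" "\<eta> \<le> 1/10"
    and I: "\<And>j. j \<in> I \<Longrightarrow> R / 2 \<le> \<bar>real_of_int j\<bar>"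
    and m: "R / 2 \<le> real_of_int m"
    and r: "\<And>j. j \<in> I \<Longrightarrow> \<bar>r j - real_of_int j\<bar> \<le> 2 * \<eta> * \<bar>real_of_int j\<bar>"
    and sum_r: "\<bar>\<Sum>j\<in>I. 1 / r j\<bar> \<le> \<eta>"
    and card: "real (card (I - shell m M)) \<le> \<eta> * R" "real (card (shell m M - I)) \<le> \<eta> * R"
    and w: "norm w \<le> R / 4"
  shows "0 < (\<Prod>j\<in>shell m M. norm (1 - w / of_int j))" "0 < (\<Prod>j\<in>I. norm (1 - w / of_real (r j)))"
    and "(\<Prod>j\<in>I. norm (1 - w / of_real (r j))) \<le> exp (8 * \<eta> * R) * (\<Prod>j\<in>shell m M. norm (1 - w / of_int j))"
    and "(\<Prod>j\<in>shell m M. norm (1 - w / of_int j)) \<le> exp (8 * \<eta> * R) * (\<Prod>j\<in>I. norm (1 - w / of_real (r j)))"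
proof -
  have p1: "0 < norm (1 - w / of_real (r j))" if "j \<in> I" for j
  proof (rule norm_one_minus_pos)
    have "2 * \<eta> * \<bar>real_of_int j\<bar> \<le> 1/5 * \<bar>real_of_int j\<bar>" using eta by (intro mult_right_mono) auto
    then show "norm w < \<bar>r j\<bar>" using r[OF that] I[OF that] w R by linarith
  qed
  have p2: "0 < norm (1 - w / of_int j)" if "j \<in> shell m M" for j
    using norm_one_minus_pos[of w "real_of_int j"] that m w R by (auto simp: shell_def)
  show "0 < (\<Prod>j\<in>shell m M. norm (1 - w / of_int j))" by (rule prod_pos) (rule p2)
  show "0 < (\<Prod>j\<in>I. norm (1 - w / of_real (r j)))" by (rule prod_pos) (rule p1)
  have e1: "(\<Prod>j\<in>I. norm (1 - w / of_real (r j))) = exp (\<Sum>j\<in>I. ln (norm (1 - w / of_real (r j))))"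
    by (rule prod_eq_exp_sum_ln[OF assms(1) p1])
  have e2: "(\<Prod>j\<in>shell m M. norm (1 - w / of_int j)) = exp (\<Sum>j\<in>shell m M. ln (norm (1 - w / of_int j)))"
    by (rule prod_eq_exp_sum_ln[OF finite_shell p2])
  have "\<bar>(\<Sum>j\<in>I. ln (norm (1 - w / of_real (r j)))) - (\<Sum>j\<in>shell m M. ln (norm (1 - w / of_int j)))\<bar> \<le> 8 * \<eta> * R"
    by (rule prod_compare_complex) (use assms in auto)
  then show "(\<Prod>j\<in>I. norm (1 - w / of_real (r j))) \<le> exp (8 * \<eta> * R) * (\<Prod>j\<in>shell m M. norm (1 - w / of_int j))"
    and "(\<Prod>j\<in>shell m M. norm (1 - w / of_int j)) \<le> exp (8 * \<eta> * R) * (\<Prod>j\<in>I. norm (1 - w / of_real (r j)))"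
    unfolding e1 e2 mult_exp_exp exp_le_cancel_iff by linarith+
qed

text \<open>The product over I stands in for the lattice nodes between m and M. For the full lattice
  up to M the Lagrange product is \<open>A * (Zw / Zk)\<close> and obeys
  \<open>lagrange_lattice_bound\<close>. Then Zw is exchanged for Iw at the complex point, costing
  exp(8 \<eta> R), and Zk for Ik at the real node, costing exp(3 \<eta> R). At the node only the
  one-sided comparison is available; for it I contains the shell and \<open>r j\<close> lies outside
  j.\<close>

lemma lagrange_term_bound:
  fixes r :: "int \<Rightarrow> real" and w :: complex and R \<eta> c :: real and I :: "int set" and m M :: nat and k :: int
  assumes fI: "finite I" and R: "8 \<le> R" and eta: "0 < \<eta>" "\<eta> \<le> 1/10"
    and I: "\<And>j. j \<in> I \<Longrightarrow> R / 2 \<le> \<bar>real_of_int j\<bar>"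
    and m: "R / 2 \<le> real m" "real m \<le> 2 * R"
    and M: "m \<le> M" "R\<^sup>2 \<le> 4 * real M"
    and r: "\<And>j. j \<in> I \<Longrightarrow> \<bar>r j - real_of_int j\<bar> \<le> 2 * \<eta> * \<bar>real_of_int j\<bar>"
    and sum_r: "\<bar>\<Sum>j\<in>I. 1 / r j\<bar> \<le> \<eta>"
    and sub: "shell m M \<subseteq> I"
    and c: "0 < c" "c \<le> 1"
    and card: "real (card (I - shell m M)) * (1 - ln c) \<le> \<eta> * R"
    and r1: "\<And>j. j \<in> shell m M \<Longrightarrow> \<bar>real_of_int j\<bar> \<le> \<bar>r j\<bar> \<and> 0 \<le> r j * real_of_int j"
    and r2: "\<And>j. j \<in> I - shell m M \<Longrightarrow> real m \<le> (1 - c) * \<bar>r j\<bar>"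
    and w: "norm w \<le> R / 4" and k: "\<bar>k\<bar> \<le> int m"
  shows "(\<Prod>j\<in>{-int m..int m}-{k}. norm (w - of_int j) / \<bar>real_of_int k - real_of_int j\<bar>) *
      (\<Prod>j\<in>I. norm (1 - w / of_real (r j))) \<le> 2 * exp (pi * \<bar>Im w\<bar> + 11 * \<eta> * R) * (\<Prod>j\<in>I. 1 - real_of_int k / r j)"
    and "0 < (\<Prod>j\<in>I. 1 - real_of_int k / r j)"
proof -
  define Z where "Z = shell (int m) (int M)"
  define A where "A = (\<Prod>j\<in>{-int m..int m}-{k}. norm (w - of_int j) / \<bar>real_of_int k - real_of_int j\<bar>)"
  define Zw where "Zw = (\<Prod>j\<in>Z. norm (1 - w / of_int j))"
  define Zk where "Zk = (\<Prod>j\<in>Z. 1 - real_of_int k / real_of_int j)"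
  define Iw where "Iw = (\<Prod>j\<in>I. norm (1 - w / of_real (r j)))"
  define Ik where "Ik = (\<Prod>j\<in>I. 1 - real_of_int k / r j)"
  have kr: "\<bar>real_of_int k\<bar> \<le> real m" using k by linarith
  have ln: "1 \<le> 1 - ln c" using c by simp
  have card0: "real (card (I - shell m M)) \<le> \<eta> * R"
    using card mult_left_mono[OF ln, of "real (card (I - shell m M))"] by simp
  have cardE: "real (card (shell m M - I)) \<le> \<eta> * R"
    using sub eta R by (simp add: Diff_eq_empty_iff[THEN iffD2])
  have comp: "Iw \<le> exp (8 * \<eta> * R) * Zw" "0 < Zw"
    unfolding Iw_def Zw_def Z_def
    by (rule prod_compare_complex_exp[where R = R and \<eta> = \<eta> and I = I]; use assms card0 cardE in simp)+
  have pZk: "0 < 1 - real_of_int k / real_of_int j" if "j \<in> Z" for j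
    using that kr by (intro one_minus_pos) (auto simp: Z_def shell_def)
  have rpos: "\<bar>real_of_int k\<bar> < \<bar>r j\<bar>" if "j \<in> I" for j
  proof (cases "j \<in> Z")
    case True
    then have "real m < \<bar>real_of_int j\<bar>" by (auto simp: Z_def shell_def)
    then show ?thesis using r1[of j] True kr by (auto simp: Z_def)
  next
    case False
    have "real m \<le> (1 - c) * \<bar>r j\<bar>" using r2 that False by (auto simp: Z_def)
    moreover have "0 < real m" using m R by linarith
    ultimately have "0 < (1 - c) * \<bar>r j\<bar>" by linarith
    then have "0 < \<bar>r j\<bar>" by (metis abs_ge_zero mult_zero_right order_le_less)
    then have "(1 - c) * \<bar>r j\<bar> < 1 * \<bar>r j\<bar>" using c by (intro mult_strict_right_mono) auto
    then show ?thesis using \<open>real m \<le> (1 - c) * \<bar>r j\<bar>\<close> kr by linarith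
  qed
  have pIk: "0 < 1 - real_of_int k / r j" if "j \<in> I" for j
    using rpos[OF that] by (rule one_minus_pos)
  show "0 < (\<Prod>j\<in>I. 1 - real_of_int k / r j)" by (rule prod_pos) (rule pIk)
  have ZkIk: "Zk \<le> exp (3 * \<eta> * R) * Ik"
  proof -
    have "(\<Sum>j\<in>shell m M. ln (1 - real_of_int k / real_of_int j))
         \<le> (\<Sum>j\<in>I. ln (1 - real_of_int k / r j)) + \<bar>real_of_int k\<bar> * \<eta> + real (card (I - shell m M)) * (1 - ln c)"
    proof (rule prod_compare_real_lower[OF fI sub _ c(1) r1 _ sum_r])
      show "\<bar>real_of_int k\<bar> \<le> real_of_int (int m)" using kr by simp
      fix j assume j: "j \<in> I - shell (int m) (int M)"
      have "\<bar>real_of_int k\<bar> \<le> (1 - c) * \<bar>r j\<bar>" using r2[OF j] kr by linarith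
      moreover have "0 < \<bar>r j\<bar>" using rpos[of j] j by force
      ultimately show "\<bar>real_of_int k / r j\<bar> \<le> 1 - c" by (simp add: abs_divide divide_le_eq)
    qed
    \<comment> \<open>The linear terms cost up to 2 \<eta> R since k may be of size 2 R, the
      unpaired indices another \<eta> R.\<close>
    also have "\<bar>real_of_int k\<bar> * \<eta> \<le> 2 * R * \<eta>" using kr m eta by (intro mult_right_mono) auto
    finally have "(\<Sum>j\<in>Z. ln (1 - real_of_int k / real_of_int j)) \<le> (\<Sum>j\<in>I. ln (1 - real_of_int k / r j)) + 3 * \<eta> * R"
      using card unfolding Z_def by (simp add: mult_ac)
    moreover have "Zk = exp (\<Sum>j\<in>Z. ln (1 - real_of_int k / real_of_int j))"
      unfolding Zk_def using pZk by (intro prod_eq_exp_sum_ln) (auto simp: Z_def)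
    moreover have "Ik = exp (\<Sum>j\<in>I. ln (1 - real_of_int k / r j))"
      unfolding Ik_def using pIk fI by (intro prod_eq_exp_sum_ln) auto
    ultimately show ?thesis by (simp add: mult_exp_exp add.commute)
  qed
  have lat: "A * (Zw / Zk) \<le> 2 * exp (pi * \<bar>Im w\<bar>)"
  proof -
    have "{-int M..int M} - {k} = ({-int m..int m}-{k}) \<union> Z"
      using k M by (auto simp: Z_def shell_def)
    then have "(\<Prod>j\<in>{-int M..int M}-{k}. norm (w - of_int j) / \<bar>real_of_int k - real_of_int j\<bar>)
       = A * (\<Prod>j\<in>Z. norm (w - of_int j) / \<bar>real_of_int k - real_of_int j\<bar>)"
    proof -
      have "({-int m..int m}-{k}) \<inter> Z = {}" by (auto simp: Z_def shell_def)
      moreover have "finite Z" by (simp add: Z_def)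
      ultimately show ?thesis unfolding A_def \<open>{-int M..int M} - {k} = _\<close> by (intro prod.union_disjoint) auto
    qed
    also have "(\<Prod>j\<in>Z. norm (w - of_int j) / \<bar>real_of_int k - real_of_int j\<bar>) = Zw / Zk"
      unfolding Zw_def Zk_def prod_dividef[symmetric]
    proof (rule prod.cong[OF refl])
      fix j assume j: "j \<in> Z"
      have j0: "j \<noteq> 0" using j by (auto simp: Z_def shell_def)
      have "w - of_int j = - of_int j * (1 - w / of_int j)" using j0 by (simp add: field_simps)
      then have n: "norm (w - of_int j) = \<bar>real_of_int j\<bar> * norm (1 - w / of_int j)"
        by (simp only: norm_mult norm_minus_cancel norm_of_int)
      have "real_of_int k - real_of_int j = - real_of_int j * (1 - real_of_int k / real_of_int j)"
        using j0 by (simp add: field_simps)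
      then have d: "\<bar>real_of_int k - real_of_int j\<bar> = \<bar>real_of_int j\<bar> * (1 - real_of_int k / real_of_int j)"
        using pZk[OF j] by (simp only: abs_mult abs_minus_cancel abs_of_pos)
      show "norm (w - of_int j) / \<bar>real_of_int k - real_of_int j\<bar> = norm (1 - w / of_int j) / (1 - real_of_int k / real_of_int j)"
        unfolding n d using j0 by simp
    qed
    finally have "(\<Prod>j\<in>{-int M..int M}-{k}. norm (w - of_int j) / \<bar>real_of_int k - real_of_int j\<bar>) = A * (Zw / Zk)" .
    moreover have "(\<Prod>j\<in>{-int M..int M}-{k}. norm (w - of_int j) / \<bar>real_of_int k - real_of_int j\<bar>) \<le> 2 * exp (pi * \<bar>Im w\<bar>)"
    proof (rule lagrange_lattice_bound)
      have "0 < R\<^sup>2" using R by (intro zero_less_power) linarith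
      then have "0 < real M" using M by linarith
      then show "1 \<le> M" by simp
      have "(norm w)\<^sup>2 \<le> (R / 4)\<^sup>2" using w by (intro power_mono) auto
      also have "\<dots> = R\<^sup>2 / 16" by (simp add: power_divide)
      also have "\<dots> \<le> real M / 4" using M by simp
      finally show "(norm w)\<^sup>2 \<le> real M / 4" .
      show "\<bar>k\<bar> \<le> int M" using k M by linarith
    qed
    ultimately show ?thesis by simp
  qed
  have Zk0: "0 < Zk" unfolding Zk_def by (rule prod_pos) (rule pZk)
  have A0: "0 \<le> A" unfolding A_def by (intro prod_nonneg) auto
  have "A * Iw \<le> A * (exp (8 * \<eta> * R) * Zw)" using comp A0 by (intro mult_left_mono)
  also have "\<dots> = (A * (Zw / Zk)) * (exp (8 * \<eta> * R) * Zk)" using Zk0 by simp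
  also have "\<dots> \<le> (2 * exp (pi * \<bar>Im w\<bar>)) * (exp (8 * \<eta> * R) * (exp (3 * \<eta> * R) * Ik))"
    by (rule mult_mono[OF lat mult_left_mono[OF ZkIk]]) (use Zk0 in auto)
  also have "\<dots> = 2 * exp (pi * \<bar>Im w\<bar> + 11 * \<eta> * R) * Ik"
  proof -
    have "exp (pi * \<bar>Im w\<bar> + 11 * \<eta> * R) = exp (pi * \<bar>Im w\<bar>) * (exp (8 * \<eta> * R) * exp (3 * \<eta> * R))"
      by (simp add: exp_add[symmetric])
    then show ?thesis by simp
  qed
  finally show "(\<Prod>j\<in>{-int m..int m}-{k}. norm (w - of_int j) / \<bar>real_of_int k - real_of_int j\<bar>) *
      (\<Prod>j\<in>I. norm (1 - w / of_real (r j))) \<le> 2 * exp (pi * \<bar>Im w\<bar> + 11 * \<eta> * R) * (\<Prod>j\<in>I. 1 - real_of_int k / r j)"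
    unfolding A_def Iw_def Ik_def .
qed

text \<open>The product of \<open>sin_prod m\<close> with the factors over I imitates
  \<open>sin_prod M\<close>. The lower bound concerns complex points where the sine is large, and
  the two-sided comparison applies. The upper bound concerns real points up to R, where only the
  one-sided comparison is left; hence, in contrast to \<open>lagrange_term_bound\<close>, I is
  contained in the shell and \<open>r j\<close> lies inside j.\<close>

lemma nodal_product_bounds:
  fixes r :: "int \<Rightarrow> real" and R \<eta> c :: real and I :: "int set" and m M :: nat
  assumes fI: "finite I" and R: "8 \<le> R" and eta: "0 < \<eta>" "\<eta> \<le> 1/10"
    and I: "\<And>j. j \<in> I \<Longrightarrow> R / 2 \<le> \<bar>real_of_int j\<bar>"
    and m: "R / 2 \<le> real m"
    and M: "m \<le> M" "4 * R\<^sup>2 \<le> real M"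
    and r: "\<And>j. j \<in> I \<Longrightarrow> \<bar>r j - real_of_int j\<bar> \<le> 2 * \<eta> * \<bar>real_of_int j\<bar>"
    and sum_r: "\<bar>\<Sum>j\<in>I. 1 / r j\<bar> \<le> \<eta>"
    and sub: "I \<subseteq> shell m M"
    and c: "0 < c" "c \<le> 1"
    and card: "real (card (shell m M - I)) * (1 - ln c) \<le> \<eta> * R"
    and r1: "\<And>j. j \<in> I \<Longrightarrow> \<bar>r j\<bar> \<le> \<bar>real_of_int j\<bar> \<and> 0 \<le> r j * real_of_int j"
  shows "norm w \<le> R / 4 \<Longrightarrow> Re w = real_of_int K + 1/2 \<or> 1 \<le> \<bar>Im w\<bar> \<Longrightarrow>
      exp (pi * \<bar>Im w\<bar> - 8 * \<eta> * R) \<le> 8 * pi * (norm (sin_prod m w) * (\<Prod>j\<in>I. norm (1 - w / of_real (r j))))"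
    and "\<lbrakk>\<bar>z\<bar> \<le> R; \<And>j. j \<in> I \<Longrightarrow> \<bar>z\<bar> < \<bar>r j\<bar>; \<And>j. j \<in> shell m M - I \<Longrightarrow> \<bar>z\<bar> \<le> (1 - c) * \<bar>real_of_int j\<bar>\<rbrakk>
      \<Longrightarrow> norm (sin_prod m (of_real z)) * (\<Prod>j\<in>I. 1 - z / r j) \<le> exp (2 * \<eta> * R)"
proof -
  have M1: "1 \<le> M"
  proof -
    have "0 < R\<^sup>2" using R by (intro zero_less_power) linarith
    then have "0 < real M" using M by linarith
    then show ?thesis by simp
  qed
  have nrm: "(norm w)\<^sup>2 \<le> real M / 4" if "norm w \<le> R" for w :: complex
    using power_mono[OF that norm_ge_zero, of 2] M by linarith
  have ln: "1 \<le> 1 - ln c" using c by simp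
  have card0: "real (card (shell m M - I)) \<le> \<eta> * R"
    using card mult_left_mono[OF ln, of "real (card (shell m M - I))"] by simp
  have cardE: "real (card (I - shell m M)) \<le> \<eta> * R"
    using sub eta R by (simp add: Diff_eq_empty_iff[THEN iffD2])
  {
    assume w: "norm w \<le> R / 4" "Re w = real_of_int K + 1/2 \<or> 1 \<le> \<bar>Im w\<bar>"
    define Iw where "Iw = (\<Prod>j\<in>I. norm (1 - w / of_real (r j)))"
    define Zw where "Zw = (\<Prod>j\<in>shell m M. norm (1 - w / of_int j))"
    have Z: "Zw \<le> exp (8 * \<eta> * R) * Iw"
      unfolding Iw_def Zw_def
      by (rule prod_compare_complex_exp(4)[where R = R and \<eta> = \<eta> and I = I]) (use assms card0 cardE w in simp_all)
    have "exp (pi * \<bar>Im w\<bar>) / 4 \<le> norm (sin (of_real pi * w))" by (rule norm_sin_pi_ge[OF w(2)])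
    also have "\<dots> \<le> 2 * (pi * norm (sin_prod (int M) w))"
      by (rule sin_prod_bounds(1)[OF M1 nrm]) (use w R in linarith)
    also have "norm (sin_prod (int M) w) = norm (sin_prod (int m) w) * Zw"
      using M by (simp add: sin_prod_split[of "int m" "int M"] norm_mult prod_norm Zw_def)
    also have "2 * (pi * (norm (sin_prod (int m) w) * Zw)) \<le> 2 * (pi * (norm (sin_prod (int m) w) * (exp (8 * \<eta> * R) * Iw)))"
      using Z by (intro mult_left_mono) auto
    finally have "exp (pi * \<bar>Im w\<bar>) \<le> exp (8 * \<eta> * R) * (8 * pi * (norm (sin_prod (int m) w) * Iw))"
      by (simp add: mult_ac)
    then have "exp (pi * \<bar>Im w\<bar>) / exp (8 * \<eta> * R) \<le> 8 * pi * (norm (sin_prod (int m) w) * Iw)"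
      by (simp add: divide_le_eq mult_ac)
    then show "exp (pi * \<bar>Im w\<bar> - 8 * \<eta> * R) \<le> 8 * pi * (norm (sin_prod m w) * (\<Prod>j\<in>I. norm (1 - w / of_real (r j))))"
      by (simp add: exp_diff Iw_def)
  }
  {
    assume z: "\<bar>z\<bar> \<le> R" and zI: "\<And>j. j \<in> I \<Longrightarrow> \<bar>z\<bar> < \<bar>r j\<bar>"
      and zS: "\<And>j. j \<in> shell m M - I \<Longrightarrow> \<bar>z\<bar> \<le> (1 - c) * \<bar>real_of_int j\<bar>"
    define Iz where "Iz = (\<Prod>j\<in>I. 1 - z / r j)"
    define Zz where "Zz = (\<Prod>j\<in>shell m M. 1 - z / real_of_int j)"
    have j0: "0 < \<bar>real_of_int j\<bar>" if "j \<in> shell m M" for j using that by (auto simp: shell_def)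
    have zj: "\<bar>z\<bar> < \<bar>real_of_int j\<bar>" if "j \<in> shell m M" for j
    proof (cases "j \<in> I")
      case True
      then show ?thesis using zI r1 by fastforce
    next
      case False
      then have "\<bar>z\<bar> \<le> (1 - c) * \<bar>real_of_int j\<bar>" using zS that by blast
      also have "\<dots> < 1 * \<bar>real_of_int j\<bar>" using c j0[OF that] by (intro mult_strict_right_mono) auto
      finally show ?thesis by simp
    qed
    have pI: "0 < 1 - z / r j" if "j \<in> I" for j using zI[OF that] by (rule one_minus_pos)
    have pZ: "0 < 1 - z / real_of_int j" if "j \<in> shell m M" for j using zj[OF that] by (rule one_minus_pos)
    have "(\<Sum>j\<in>I. ln (1 - z / r j))
         \<le> (\<Sum>j\<in>shell m M. ln (1 - z / real_of_int j)) + \<bar>z\<bar> * \<eta> + real (card (shell m M - I)) * (1 - ln c)"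
    proof (rule prod_compare_real_upper[OF sub c(1) _ _ sum_r])
      show "\<bar>r j\<bar> \<le> \<bar>real_of_int j\<bar> \<and> 0 \<le> r j * real_of_int j \<and> \<bar>z\<bar> < \<bar>r j\<bar>" if "j \<in> I" for j
        using r1 zI that by blast
      show "\<bar>z / real_of_int j\<bar> \<le> 1 - c" if j: "j \<in> shell m M - I" for j
        using zS[OF j] j0[of j] j by (simp add: abs_divide divide_le_eq)
    qed
    also have "\<bar>z\<bar> * \<eta> \<le> R * \<eta>" using z eta by (intro mult_right_mono) auto
    finally have le: "(\<Sum>j\<in>I. ln (1 - z / r j)) \<le> (\<Sum>j\<in>shell m M. ln (1 - z / real_of_int j)) + 2 * \<eta> * R"
      using card by (simp add: mult_ac)
    have "Iz = exp (\<Sum>j\<in>I. ln (1 - z / r j))" unfolding Iz_def using pI fI by (intro prod_eq_exp_sum_ln) auto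
    moreover have "Zz = exp (\<Sum>j\<in>shell m M. ln (1 - z / real_of_int j))"
      unfolding Zz_def using pZ by (intro prod_eq_exp_sum_ln) auto
    ultimately have IZ: "Iz \<le> exp (2 * \<eta> * R) * Zz" using le by (simp add: mult_exp_exp add.commute)
    have Zn: "norm (\<Prod>j\<in>shell m M. 1 - of_real z / of_int j :: complex) = Zz"
      unfolding prod_norm[symmetric] Zz_def
    proof (rule prod.cong[OF refl])
      fix j assume "j \<in> shell (int m) (int M)"
      have "1 - of_real z / of_int j = (of_real (1 - z / real_of_int j) :: complex)" by simp
      then show "norm (1 - of_real z / of_int j :: complex) = 1 - z / real_of_int j"
        using pZ[OF \<open>j \<in> _\<close>] by (simp only: norm_of_real abs_of_pos)
    qed
    have "norm (sin_prod (int m) (of_real z)) * Zz = norm (sin_prod (int M) (of_real z))"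
      using M by (simp add: sin_prod_split[of "int m" "int M"] norm_mult Zn)
    also have "\<dots> \<le> 1"
    proof -
      have "pi * norm (sin_prod (int M) (of_real z)) \<le> 2 * norm (sin (of_real pi * complex_of_real z))"
        by (rule sin_prod_bounds(2)[OF M1 nrm]) (use z in auto)
      also have "sin (of_real pi * complex_of_real z) = of_real (sin (pi * z))"
        by (simp add: sin_of_real[symmetric] del: sin_of_real)
      also have "2 * norm (complex_of_real (sin (pi * z))) \<le> 2" by simp
      finally have "pi * norm (sin_prod (int M) (of_real z)) \<le> 2" .
      moreover have "2 * norm (sin_prod (int M) (of_real z)) \<le> pi * norm (sin_prod (int M) (of_real z))"
        using pi_ge_two by (intro mult_right_mono) auto
      ultimately show ?thesis by linarith
    qed
    finally have "norm (sin_prod (int m) (of_real z)) * Zz \<le> 1" .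
    then have "exp (2 * \<eta> * R) * (norm (sin_prod (int m) (of_real z)) * Zz) \<le> exp (2 * \<eta> * R) * 1"
      by (intro mult_left_mono) auto
    moreover have "norm (sin_prod (int m) (of_real z)) * Iz \<le> norm (sin_prod (int m) (of_real z)) * (exp (2 * \<eta> * R) * Zz)"
      using IZ by (intro mult_left_mono) auto
    moreover have "norm (sin_prod (int m) (of_real z)) * (exp (2 * \<eta> * R) * Zz)
        = exp (2 * \<eta> * R) * (norm (sin_prod (int m) (of_real z)) * Zz)" by simp
    ultimately show "norm (sin_prod m (of_real z)) * (\<Prod>j\<in>I. 1 - z / r j) \<le> exp (2 * \<eta> * R)"
      unfolding Iz_def[symmetric] mult_1_right by linarith
  }
qed

section \<open>The limiting weight\<close>

lemma abs_ln_one_minus_plus_le: "\<bar>ln (1 - x) + x\<bar> \<le> 2 * x\<^sup>2" if "\<bar>x\<bar> \<le> 1/2" for x :: real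
  using abs_ln_one_plus_x_minus_x_bound[of "-x"] that by simp

lemma abs_ln_one_minus_le: "\<bar>ln (1 - x)\<bar> \<le> 2 * \<bar>x\<bar>" if "\<bar>x\<bar> \<le> 1/2" for x :: real
proof -
  have "2 * x\<^sup>2 \<le> \<bar>x\<bar>"
    using mult_right_mono[of "\<bar>x\<bar>" "1/2" "\<bar>x\<bar>"] that by (simp add: power2_eq_square)
  then show ?thesis using abs_ln_one_minus_plus_le[OF that] by linarith
qed

context points
begin

definition trunc :: "real \<Rightarrow> nat \<Rightarrow> real \<Rightarrow> real" where
  "trunc R M t = (\<Prod>n\<in>outer R M. 1 - t / p n)"

lemma factor_pos:
  assumes "n \<notin> inner R" "\<bar>t\<bar> \<le> R"
  shows "0 < 1 - t / p n"
proof -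
  have "\<bar>t\<bar> < \<bar>p n\<bar>" using assms by (auto simp: inner_def)
  then have "\<bar>t / p n\<bar> < 1" by (simp add: abs_divide divide_less_eq)
  then show ?thesis by linarith
qed

lemma trunc_eq_exp: "trunc R M t = exp (\<Sum>n\<in>outer R M. ln (1 - t / p n))" if "\<bar>t\<bar> \<le> R"
  unfolding trunc_def using factor_pos[OF _ that]
  by (intro prod_eq_exp_sum_ln) (auto simp: outer_def)

text \<open>The linear parts of the logarithms form a block of the series of 1 / p n, which
  converges by its symmetric truncation; the quadratic remainders are bounded by the sum of 1 / n^2
  over |n| \<ge> M.\<close>

lemma ln_trunc_diff_le:
  assumes "0 < R"
  obtains M0 where "\<And>M M' t. M0 \<le> M \<Longrightarrow> M \<le> M' \<Longrightarrow> \<bar>t\<bar> \<le> R \<Longrightarrow>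
     \<bar>(\<Sum>n\<in>outer R M'. ln (1 - t / p n)) - (\<Sum>n\<in>outer R M. ln (1 - t / p n))\<bar>
     \<le> R * \<bar>(\<Sum>n\<in>outer R M'. 1 / p n) - (\<Sum>n\<in>outer R M. 1 / p n)\<bar> + 32 * R\<^sup>2 / real M"
proof -
  obtain n0 where n0: "1 \<le> n0" "\<And>n. n0 \<le> \<bar>real_of_int n\<bar> \<Longrightarrow> \<bar>p n - real_of_int n\<bar> \<le> 1/2 * \<bar>real_of_int n\<bar>"
    using near_lattice[of "1/2"] by auto
  \<comment> \<open>Beyond M0 the point p n has at least half the size of n, so 4 R makes |t / p n|
    \<le> 1/2.\<close>
  define M0 where "M0 = nat \<lceil>max n0 (4 * R) + 2\<rceil>"
  show ?thesis
  proof (rule that[of M0])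
    fix M M' t assume M: "M0 \<le> M" "M \<le> M'" and t: "\<bar>t\<bar> \<le> R"
    have Mr: "n0 \<le> real M" "4 * R \<le> real M" "2 \<le> real M"
      using M(1) n0(1) assms unfolding M0_def by linarith+
    define D where "D = outer R M' - outer R M"
    have sub: "outer R M \<subseteq> outer R M'" using M(2) by (auto simp: outer_def)
    have Dn: "real M \<le> \<bar>real_of_int n\<bar>" if "n \<in> D" for n
      using that by (auto simp: D_def outer_def)
    have pn: "1/2 * \<bar>real_of_int n\<bar> \<le> \<bar>p n\<bar>" if "n \<in> D" for n
      using n0(2)[of n] Dn[OF that] Mr by linarith
    have sd: "(\<Sum>n\<in>outer R M'. f n) - (\<Sum>n\<in>outer R M. f n) = (\<Sum>n\<in>D. f n)" for f :: "int \<Rightarrow> real"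
      unfolding D_def by (subst sum_diff) (use sub in auto)
    have "(\<Sum>n\<in>D. ln (1 - t / p n)) = (\<Sum>n\<in>D. ln (1 - t / p n) + t / p n) - t * (\<Sum>n\<in>D. 1 / p n)"
      by (simp add: sum.distrib sum_distrib_left)
    moreover have "\<bar>\<Sum>n\<in>D. ln (1 - t / p n) + t / p n\<bar> \<le> 32 * R\<^sup>2 / real M"
    proof -
      have "\<bar>\<Sum>n\<in>D. ln (1 - t / p n) + t / p n\<bar> \<le> (\<Sum>n\<in>D. 8 * R\<^sup>2 * (1 / (real_of_int n)\<^sup>2))"
      proof (rule order_trans[OF sum_abs sum_mono])
        fix n assume n: "n \<in> D"
        have pos: "0 < \<bar>real_of_int n\<bar>" using Dn[OF n] Mr by linarith
        have "\<bar>t / p n\<bar> \<le> R / (1/2 * \<bar>real_of_int n\<bar>)"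
          unfolding abs_divide using t pn[OF n] pos assms by (intro frac_le) auto
        then have x: "\<bar>t / p n\<bar> \<le> 2 * R / \<bar>real_of_int n\<bar>" by (simp add: mult.commute)
        also have "\<dots> \<le> 1/2" using Dn[OF n] Mr pos by (simp add: divide_le_eq)
        finally have "\<bar>ln (1 - t / p n) + t / p n\<bar> \<le> 2 * \<bar>t / p n\<bar>\<^sup>2"
          using abs_ln_one_minus_plus_le[of "t / p n"] by (simp only: power2_abs)
        also have "\<dots> \<le> 2 * (2 * R / \<bar>real_of_int n\<bar>)\<^sup>2" using x by (intro mult_left_mono power_mono) auto
        also have "\<dots> = 8 * R\<^sup>2 * (1 / (real_of_int n)\<^sup>2)" by (simp add: power_divide power_mult_distrib)
        finally show "\<bar>ln (1 - t / p n) + t / p n\<bar> \<le> 8 * R\<^sup>2 * (1 / (real_of_int n)\<^sup>2)" .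
      qed
      also have "\<dots> = 8 * R\<^sup>2 * (\<Sum>n\<in>D. 1 / (real_of_int n)\<^sup>2)" by (simp add: sum_distrib_left)
      also have "\<dots> \<le> 8 * R\<^sup>2 * (4 / real M)"
        using Dn Mr by (intro mult_left_mono sum_inverse_squares_int) (auto simp: D_def)
      finally show ?thesis by simp
    qed
    moreover have "\<bar>t * (\<Sum>n\<in>D. 1 / p n)\<bar> \<le> R * \<bar>\<Sum>n\<in>D. 1 / p n\<bar>"
      unfolding abs_mult using t by (intro mult_right_mono) auto
    ultimately show "\<bar>(\<Sum>n\<in>outer R M'. ln (1 - t / p n)) - (\<Sum>n\<in>outer R M. ln (1 - t / p n))\<bar>
       \<le> R * \<bar>(\<Sum>n\<in>outer R M'. 1 / p n) - (\<Sum>n\<in>outer R M. 1 / p n)\<bar> + 32 * R\<^sup>2 / real M"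
      unfolding sd by linarith
  qed
qed

lemma ln_trunc_uniform_limit:
  assumes R: "0 < R"
  obtains l where "uniform_limit {-R..R} (\<lambda>M t. \<Sum>n\<in>outer R M. ln (1 - t / p n)) l sequentially"
proof -
  obtain M0 where M0: "\<And>M M' t. M0 \<le> M \<Longrightarrow> M \<le> M' \<Longrightarrow> \<bar>t\<bar> \<le> R \<Longrightarrow>
     \<bar>(\<Sum>n\<in>outer R M'. ln (1 - t / p n)) - (\<Sum>n\<in>outer R M. ln (1 - t / p n))\<bar>
     \<le> R * \<bar>(\<Sum>n\<in>outer R M'. 1 / p n) - (\<Sum>n\<in>outer R M. 1 / p n)\<bar> + 32 * R\<^sup>2 / real M"
    using ln_trunc_diff_le[OF R] by blast
  have "uniformly_Cauchy_on {-R..R} (\<lambda>M t. \<Sum>n\<in>outer R M. ln (1 - t / p n))"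
  proof (rule uniformly_Cauchy_onI')
    fix e :: real assume e: "0 < e"
    have "Cauchy (\<lambda>M. \<Sum>n\<in>outer R M. 1 / p n)" by (rule LIMSEQ_imp_Cauchy[OF outer_sum_limit])
    then obtain N1 where N1: "\<And>m n. N1 \<le> m \<Longrightarrow> N1 \<le> n \<Longrightarrow>
       \<bar>(\<Sum>n\<in>outer R m. 1 / p n) - (\<Sum>n\<in>outer R n. 1 / p n)\<bar> < e / (4 * R)"
      using metric_CauchyD[of _ "e / (4 * R)"] e R by (metis dist_real_def divide_pos_pos mult_pos_pos zero_less_numeral)
    \<comment> \<open>The quadratic error is then below e / 2, and the linear one is at most e / 4
      by the choice of N1.\<close>
    define N where "N = max M0 (max N1 (nat \<lceil>64 * R\<^sup>2 / e\<rceil> + 1))"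
    show "\<exists>N. \<forall>t\<in>{-R..R}. \<forall>m\<ge>N. \<forall>n>m. dist (\<Sum>n\<in>outer R m. ln (1 - t / p n)) (\<Sum>n\<in>outer R n. ln (1 - t / p n)) < e"
    proof (intro exI[of _ N] ballI allI impI)
      fix t m n assume t: "t \<in> {-R..R}" and m: "N \<le> m" and n: "m < n"
      have mN: "M0 \<le> m" "N1 \<le> m" "64 * R\<^sup>2 / e < real m" using m unfolding N_def by linarith+
      have "32 * R\<^sup>2 / real m < e / 2"
      proof -
        have "0 < 64 * R\<^sup>2 / e" using R e by simp
        then have "0 < real m" using mN(3) by linarith
        then show ?thesis using mN(3) e by (simp add: divide_less_eq mult.commute)
      qed
      moreover have "R * \<bar>(\<Sum>n\<in>outer R n. 1 / p n) - (\<Sum>n\<in>outer R m. 1 / p n)\<bar> \<le> R * (e / (4 * R))"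
        using N1[of n m] mN n R by (intro mult_left_mono) auto
      moreover have "R * (e / (4 * R)) = e / 4" using R by simp
      ultimately have "\<bar>(\<Sum>n\<in>outer R n. ln (1 - t / p n)) - (\<Sum>n\<in>outer R m. ln (1 - t / p n))\<bar> < e"
        using M0[of m n t] mN n t e by fastforce
      then show "dist (\<Sum>n\<in>outer R m. ln (1 - t / p n)) (\<Sum>n\<in>outer R n. ln (1 - t / p n)) < e"
        by (simp add: dist_real_def abs_minus_commute)
    qed
  qed
  then show ?thesis
    using that uniformly_convergent_Cauchy[of "{-R..R}"] Cauchy_uniformly_convergent unfolding uniformly_convergent_on_def by metis
qed

text \<open>The logarithms converge uniformly, so the truncations approximate g up to a factor
  exp(\<plusminus>e). A relative error of this kind passes to values and to integrals of squares
  against any polynomial, whatever its degree and coefficients.\<close>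

lemma point_weight_limit:
  assumes R: "0 < R"
  obtains g where "continuous_on {-R..R} g" "\<And>t. \<bar>t\<bar> \<le> R \<Longrightarrow> 0 < g t"
    "\<And>t. \<bar>t\<bar> \<le> R \<Longrightarrow> point_weight p R t = (g t)\<^sup>2"
    "\<And>e. 0 < e \<Longrightarrow> \<forall>\<^sub>F M in sequentially. \<forall>t\<in>{-R..R}. exp (- e) * trunc R M t \<le> g t \<and> g t \<le> exp e * trunc R M t"
proof -
  obtain l where ul: "uniform_limit {-R..R} (\<lambda>M t. \<Sum>n\<in>outer R M. ln (1 - t / p n)) l sequentially"
    using ln_trunc_uniform_limit[OF R] .
  define g where "g = (\<lambda>t. exp (l t))"
  have cl: "continuous_on {-R..R} l"
  proof (rule uniform_limit_theorem[OF _ ul])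
    have "0 < 1 - t / p n" if "n \<in> outer R M" "t \<in> {-R..R}" for n M t
      using factor_pos[of n R t] that by (auto simp: outer_def)
    then show "\<forall>\<^sub>F M in sequentially. continuous_on {-R..R} (\<lambda>t. \<Sum>n\<in>outer R M. ln (1 - t / p n))"
      by (intro always_eventually allI continuous_on_sum continuous_on_ln continuous_on_diff
          continuous_on_divide continuous_on_const continuous_on_id) (force simp: outer_def inner_def)+
  qed simp
  have approx: "\<forall>\<^sub>F M in sequentially. \<forall>t\<in>{-R..R}. exp (- e) * trunc R M t \<le> g t \<and> g t \<le> exp e * trunc R M t"
    if "0 < e" for e
    using uniform_limitD[OF ul that]
  proof eventually_elim
    case (elim M)
    show ?case
    proof
      fix t assume t: "t \<in> {-R..R}"
      then have "\<bar>(\<Sum>n\<in>outer R M. ln (1 - t / p n)) - l t\<bar> < e" using elim by (simp add: dist_real_def)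
      then show "exp (- e) * trunc R M t \<le> g t \<and> g t \<le> exp e * trunc R M t"
        using t by (simp add: trunc_eq_exp abs_le_iff g_def mult_exp_exp) linarith
    qed
  qed
  have weight: "point_weight p R t = (g t)\<^sup>2" if t: "\<bar>t\<bar> \<le> R" for t
  proof -
    define B where "B = (\<lambda>S. {n. R < \<bar>p n\<bar> \<and> \<bar>p n\<bar> < S})"
    have fB: "finite (B S)" for S
      by (rule finite_subset[OF _ finite_less(1)[of S]]) (auto simp: B_def)
    have posB: "0 < 1 - t / p n" if "n \<in> B S" for n S
      using factor_pos[OF _ t, of n] that by (auto simp: B_def inner_def)
    have nf: "filterlim (\<lambda>S::real. nat \<lfloor>S\<rfloor>) sequentially at_top"
      by (rule filterlim_compose[OF filterlim_nat_sequentially filterlim_floor_sequentially])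
    have lt: "(\<lambda>M. \<Sum>n\<in>outer R M. ln (1 - t / p n)) \<longlonglongrightarrow> l t"
      by (rule tendsto_uniform_limitI[OF ul]) (use t in auto)
    have l1: "((\<lambda>S::real. \<Sum>n\<in>outer R (nat \<lfloor>S\<rfloor>). ln (1 - t / p n)) \<longlongrightarrow> l t) at_top"
      by (rule filterlim_compose[OF lt nf])
    \<comment> \<open>The two truncations differ on \<open>trunc_diff S\<close>, where each
      logarithm is at most 2 R / |p n| in size.\<close>
    have l2: "((\<lambda>S::real. (\<Sum>n\<in>B S. ln (1 - t / p n)) - (\<Sum>n\<in>outer R (nat \<lfloor>S\<rfloor>). ln (1 - t / p n))) \<longlongrightarrow> 0) at_top"
    proof (rule tendstoI)
      fix e :: real assume e: "0 < e"
      define \<delta> where "\<delta> = min (1/2) (e / (4 * R))"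
      have \<delta>: "0 < \<delta>" "\<delta> \<le> 1/2" "2 * R * \<delta> < e"
      proof -
        show "0 < \<delta>" "\<delta> \<le> 1/2" using e R by (auto simp: \<delta>_def)
        have "2 * R * \<delta> \<le> 2 * R * (e / (4 * R))" using R by (intro mult_left_mono) (auto simp: \<delta>_def)
        also have "\<dots> < e" using R e by simp
        finally show "2 * R * \<delta> < e" .
      qed
      show "\<forall>\<^sub>F S::real in at_top. dist ((\<Sum>n\<in>B S. ln (1 - t / p n)) - (\<Sum>n\<in>outer R (nat \<lfloor>S\<rfloor>). ln (1 - t / p n))) 0 < e"
        using trunc_diff_bounds[OF \<delta>(1,2)] eventually_ge_at_top[of "8 * R"]
      proof eventually_elim
        case (elim S)
        define A where "A = outer R (nat \<lfloor>S\<rfloor>)"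
        have S0: "0 \<le> S" "4 * R < S" using elim R by linarith+
        have inA: "n \<in> A \<longleftrightarrow> \<bar>real_of_int n\<bar> \<le> S \<and> R < \<bar>p n\<bar>" for n
        proof -
          have "n \<in> {- int (nat \<lfloor>S\<rfloor>)..int (nat \<lfloor>S\<rfloor>)} \<longleftrightarrow> \<bar>n\<bar> \<le> \<lfloor>S\<rfloor>" using S0 by auto
          also have "\<dots> \<longleftrightarrow> \<bar>real_of_int n\<bar> \<le> S" by (simp add: le_floor_iff)
          finally show ?thesis unfolding A_def outer_def inner_def by auto
        qed
        \<comment> \<open>On \<open>trunc_diff S\<close> one has |p n| \<ge> S / 4 > R, so removing
          \<open>inner R\<close> leaves the symmetric difference unchanged.\<close>
        have far: "R < \<bar>p n\<bar>" if "n \<in> trunc_diff S" for n using elim that S0 by force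
        have D: "trunc_diff S = (B S - A) \<union> (A - B S)"
        proof (rule set_eqI)
          fix n show "n \<in> trunc_diff S \<longleftrightarrow> n \<in> (B S - A) \<union> (A - B S)"
            using far[of n] unfolding trunc_diff_def B_def Un_iff Diff_iff inA mem_Collect_eq by blast
        qed
        have fA: "finite A" by (simp add: A_def)
        have "\<bar>(\<Sum>n\<in>B S. ln (1 - t / p n)) - (\<Sum>n\<in>A. ln (1 - t / p n))\<bar>
            = \<bar>(\<Sum>n\<in>B S - A. ln (1 - t / p n)) - (\<Sum>n\<in>A - B S. ln (1 - t / p n))\<bar>"
          using sum.Int_Diff[OF fA, of "\<lambda>n. ln (1 - t / p n)" "B S"] sum.Int_Diff[OF fB[of S], of "\<lambda>n. ln (1 - t / p n)" A]
          by (simp add: Int_commute)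
        also have "\<dots> \<le> (\<Sum>n\<in>B S - A. \<bar>ln (1 - t / p n)\<bar>) + (\<Sum>n\<in>A - B S. \<bar>ln (1 - t / p n)\<bar>)"
          using sum_abs[of "\<lambda>n. ln (1 - t / p n)" "B S - A"] sum_abs[of "\<lambda>n. ln (1 - t / p n)" "A - B S"] by linarith
        also have "\<dots> = (\<Sum>n\<in>trunc_diff S. \<bar>ln (1 - t / p n)\<bar>)"
          unfolding D by (subst sum.union_disjoint) (use fA fB in auto)
        also have "\<dots> \<le> (\<Sum>n\<in>trunc_diff S. 2 * R * (1 / \<bar>p n\<bar>))"
        proof (rule sum_mono)
          fix n assume n: "n \<in> trunc_diff S"
          have pn: "S / 4 \<le> \<bar>p n\<bar>" using elim n by blast
          have tp: "\<bar>t / p n\<bar> \<le> R / \<bar>p n\<bar>" unfolding abs_divide using t by (intro divide_right_mono) auto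
          also have "\<dots> \<le> 1/2" using pn elim R by (simp add: divide_le_eq)
          finally have "\<bar>ln (1 - t / p n)\<bar> \<le> 2 * \<bar>t / p n\<bar>" by (rule abs_ln_one_minus_le)
          then show "\<bar>ln (1 - t / p n)\<bar> \<le> 2 * R * (1 / \<bar>p n\<bar>)" using tp by simp
        qed
        also have "\<dots> = 2 * R * (\<Sum>n\<in>trunc_diff S. 1 / \<bar>p n\<bar>)" by (simp add: sum_distrib_left)
        also have "\<dots> \<le> 2 * R * \<delta>" using elim R by (intro mult_left_mono) auto
        finally show ?case using \<delta>(3) by (simp add: A_def)
      qed
    qed
    have "((\<lambda>S. \<Sum>n\<in>B S. ln (1 - t / p n)) \<longlongrightarrow> 0 + l t) at_top"
      using tendsto_add[OF l2 l1] by simp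
    then have "((\<lambda>S. (exp (\<Sum>n\<in>B S. ln (1 - t / p n)))\<^sup>2) \<longlongrightarrow> (g t)\<^sup>2) at_top"
      unfolding g_def by (intro tendsto_intros) simp
    moreover have "(exp (\<Sum>n\<in>B S. ln (1 - t / p n)))\<^sup>2 = (\<Prod>n\<in>B S. (1 - t / p n)\<^sup>2)" for S
    proof -
      have "(\<Prod>n\<in>B S. 1 - t / p n) = exp (\<Sum>n\<in>B S. ln (1 - t / p n))"
        by (rule prod_eq_exp_sum_ln[OF fB]) (rule posB)
      then show ?thesis by (simp only: prod_power_distrib[symmetric])
    qed
    ultimately have "((\<lambda>S. \<Prod>n | R < \<bar>p n\<bar> \<and> \<bar>p n\<bar> < S. (1 - t / p n)\<^sup>2) \<longlongrightarrow> (g t)\<^sup>2) at_top"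
      by (simp add: B_def)
    then have "Lim at_top (\<lambda>S. \<Prod>n | R < \<bar>p n\<bar> \<and> \<bar>p n\<bar> < S. (1 - t / p n)\<^sup>2) = (g t)\<^sup>2"
      by (intro tendsto_Lim) auto
    then show ?thesis using t by (simp add: point_weight_def abs_le_iff)
  qed
  show ?thesis
    by (rule that[of g]) (use cl approx weight in \<open>auto simp: g_def intro!: continuous_on_exp\<close>)
qed

end

section \<open>Growth of weighted polynomials\<close>

lemma poly_map_of_real: "poly (map_poly of_real q) (of_real x) = (of_real (poly q x) :: complex)"
  by (induction q) (auto simp: map_poly_pCons)

lemma lagrange_interpolation:
  fixes Q :: "'a::field poly" and x :: "'i \<Rightarrow> 'a"
  assumes fin: "finite K" and inj: "inj_on x K" and deg: "degree Q < card K"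
  shows "poly Q w = (\<Sum>k\<in>K. poly Q (x k) * (\<Prod>j\<in>K-{k}. (w - x j) / (x k - x j)))"
proof -
  define l where "l = (\<lambda>k. \<Prod>j\<in>K-{k}. [:- x j / (x k - x j), 1 / (x k - x j):])"
  have pl: "poly (l k) v = (\<Prod>j\<in>K-{k}. (v - x j) / (x k - x j))" for k v
    unfolding l_def poly_prod by (intro prod.cong) (auto simp: diff_divide_distrib)
  have K1: "0 < card K" using deg by simp
  have dl: "degree (l k) \<le> card K - 1" if "k \<in> K" for k
  proof -
    have "degree (l k) \<le> sum (degree \<circ> (\<lambda>j. [:- x j / (x k - x j), 1 / (x k - x j):])) (K-{k})"
      unfolding l_def by (rule degree_prod_sum_le) (use fin in auto)
    also have "\<dots> \<le> (\<Sum>j\<in>K-{k}. 1)" by (intro sum_mono) (auto simp: degree_pCons_le[THEN order_trans])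
    finally show ?thesis using that fin by simp
  qed
  define S where "S = (\<Sum>k\<in>K. smult (poly Q (x k)) (l k))"
  have "degree (smult (poly Q (x k)) (l k)) \<le> card K - 1" if "k \<in> K" for k
    using dl[OF that] degree_smult_le order_trans by blast
  then have dS: "degree S \<le> card K - 1" unfolding S_def by (intro degree_sum_le fin)
  have *: "poly (l k) (x i) = (if i = k then 1 else 0)" if "k \<in> K" "i \<in> K" for i k
  proof (cases "i = k")
    case True
    have "(x k - x j) / (x k - x j) = 1" if "j \<in> K-{k}" for j
      using inj that \<open>k \<in> K\<close> by (auto dest: inj_onD)
    then show ?thesis unfolding pl using True by simp
  next
    case False
    then show ?thesis unfolding pl using that fin by (auto intro!: prod_zero bexI[of _ i])
  qed
  have eq: "poly S (x i) = poly Q (x i)" if "i \<in> K" for i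
  proof -
    have "poly S (x i) = (\<Sum>k\<in>K. if i = k then poly Q (x k) else 0)"
      unfolding S_def poly_sum poly_smult by (intro sum.cong) (auto simp: *[OF _ that])
    then show ?thesis using that fin by simp
  qed
  have "Q - S = 0"
  proof (rule ccontr)
    assume ne: "Q - S \<noteq> 0"
    have "card K = card (x ` K)" by (rule card_image[OF inj, symmetric])
    also have "\<dots> \<le> card {v. poly (Q - S) v = 0}"
      by (rule card_mono) (use poly_roots_finite[OF ne] eq in auto)
    also have "\<dots> \<le> degree (Q - S)" by (rule card_poly_roots_bound[OF ne])
    also have "\<dots> \<le> card K - 1" by (rule degree_diff_le) (use deg dS in auto)
    finally show False using K1 by simp
  qed
  then have "Q = S" by simp
  then have "poly Q w = poly S w" by simp
  then show ?thesis by (simp add: S_def poly_sum pl)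
qed

context points
begin

text \<open>The conclusion of \<open>inner_interval\<close> as a predicate, so that the estimates
  can be stated for a single R.\<close>

definition regular :: "real \<Rightarrow> real \<Rightarrow> int \<Rightarrow> int \<Rightarrow> bool" where
  "regular \<delta> R a b \<longleftrightarrow> inner R = {-a..b} \<and>
     (1 - \<delta>) * R \<le> real_of_int a \<and> real_of_int a \<le> (1 + \<delta>) * R \<and>
     (1 - \<delta>) * R \<le> real_of_int b \<and> real_of_int b \<le> (1 + \<delta>) * R \<and>
     (\<forall>n. n \<notin> inner R \<longrightarrow> \<bar>p n - real_of_int n\<bar> \<le> \<delta> * \<bar>real_of_int n\<bar>)"

text \<open>An index not matched by the lattice costs up to \<open>1 - ln (\<eta> / 3)\<close> in the exponent; there are
  \<open>O(tol \<eta> * R)\<close> of them, so that their total cost stays below \<open>\<eta> * R\<close>.\<close>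

definition tol :: "real \<Rightarrow> real" where "tol \<eta> = \<eta> / (8 * (1 - ln (\<eta> / 3)))"

text \<open>Beyond it \<eta> R \<ge> 64 (1 - ln(\<eta>/3)). The number of integers with modulus
  between (1 - tol) R and (1 + tol) R is at most \<open>4 * tol \<eta> * R + 8\<close>;
  \<open>tol\<close> makes the first part cost \<eta> R / 2, and the threshold makes the 8 cost at
  most \<eta> R / 8.\<close>

definition threshold :: "real \<Rightarrow> real" where "threshold \<eta> = 64 * (1 - ln (\<eta> / 3)) / \<eta>"

lemma parameter_bounds:
  assumes eta: "0 < \<eta>" "\<eta> \<le> 1/10" and R: "threshold \<eta> \<le> R"
  shows "1 \<le> 1 - ln (\<eta> / 3)" "0 < tol \<eta>" "tol \<eta> \<le> \<eta> / 8" "640 \<le> R" "64 \<le> \<eta> * R"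
    "(4 * tol \<eta> * R + 8) * (1 - ln (\<eta> / 3)) \<le> \<eta> * R"
proof -
  define K where "K = 1 - ln (\<eta> / 3)"
  have K: "1 \<le> K" using eta by (simp add: K_def)
  show "1 \<le> 1 - ln (\<eta> / 3)" using K by (simp add: K_def)
  have t: "tol \<eta> = \<eta> / (8 * K)" by (simp add: tol_def K_def)
  show "0 < tol \<eta>" unfolding t using eta K by simp
  show "tol \<eta> \<le> \<eta> / 8" unfolding t using eta K by (simp add: field_simps)
  have R': "64 * K \<le> \<eta> * R" using R eta unfolding threshold_def K_def[symmetric] by (simp add: divide_le_eq mult.commute)
  then show R64: "64 \<le> \<eta> * R" using K by linarith
  have "0 \<le> R" using R64 eta by (smt (verit) mult_nonneg_nonpos)
  then have "\<eta> * R \<le> 1/10 * R" using eta by (intro mult_right_mono) auto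
  then show "640 \<le> R" using R64 by linarith
  have "tol \<eta> * K = \<eta> / 8" unfolding t using K by simp
  then have "(4 * tol \<eta> * R + 8) * K = \<eta> * R / 2 + 8 * K" by (simp add: algebra_simps)
  then show "(4 * tol \<eta> * R + 8) * (1 - ln (\<eta> / 3)) \<le> \<eta> * R"
    unfolding K_def[symmetric] using R' R64 by linarith
qed

lemma eventually_regular:
  assumes eta: "0 < \<eta>" "\<eta> \<le> 1/10"
  shows "\<forall>\<^sub>F R in at_top. threshold \<eta> \<le> R \<and> (\<exists>a b. regular (tol \<eta>) R a b) \<and>
    (\<forall>\<^sub>F M in sequentially. \<bar>\<Sum>n\<in>outer R M. 1 / p n\<bar> < tol \<eta>)"
proof -
  have t: "0 < tol \<eta>" "tol \<eta> \<le> \<eta> / 8" using parameter_bounds[OF eta order_refl] by auto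
  then have "tol \<eta> \<le> 1/2" using eta by linarith
  show ?thesis
    using eventually_ge_at_top[of "threshold \<eta>"] inner_interval[OF t(1) \<open>tol \<eta> \<le> 1/2\<close>] outer_sum_small[OF t(1)]
  proof eventually_elim
    case (elim R)
    then show ?case unfolding regular_def by blast
  qed
qed

definition ctrunc :: "real \<Rightarrow> nat \<Rightarrow> complex \<Rightarrow> complex" where
  "ctrunc R M z = (\<Prod>n\<in>outer R M. 1 - z / of_real (p n))"

lemma ctrunc_of_real: "ctrunc R M (of_real t) = of_real (trunc R M t)"
  by (simp add: ctrunc_def trunc_def)

lemma outer_far:
  assumes reg: "regular \<delta> R a b" and j: "j \<in> outer R M"
  shows "(1 - \<delta>) * R < \<bar>real_of_int j\<bar>" "\<bar>p j - real_of_int j\<bar> \<le> \<delta> * \<bar>real_of_int j\<bar>" "R < \<bar>p j\<bar>"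
    "- a > j \<or> j > b" "\<bar>j\<bar> \<le> int M"
proof -
  have jn: "j \<notin> inner R" "\<bar>j\<bar> \<le> int M" using j by (auto simp: outer_def)
  show "- a > j \<or> j > b" using jn reg by (auto simp: regular_def)
  then have "real_of_int j < - real_of_int a \<or> real_of_int b < real_of_int j" by linarith
  then show "(1 - \<delta>) * R < \<bar>real_of_int j\<bar>" using reg unfolding regular_def by linarith
  show "\<bar>p j - real_of_int j\<bar> \<le> \<delta> * \<bar>real_of_int j\<bar>" using jn reg by (auto simp: regular_def)
  show "R < \<bar>p j\<bar>" using jn by (auto simp: inner_def)
  show "\<bar>j\<bar> \<le> int M" by (rule jn(2))
qed

text \<open>A shift by at most 1 changes 1 / p n by O(1 / n^2), and over |n| \<ge> R / 2 these
  changes add up to O(1 / R).\<close>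

lemma shifted_sum_small:
  assumes eta: "0 < \<eta>" "\<eta> \<le> 1/10" and R: "threshold \<eta> \<le> R" and reg: "regular (tol \<eta>) R a b"
    and sum: "\<bar>\<Sum>n\<in>outer R M. 1 / p n\<bar> < tol \<eta>" and s: "0 \<le> s" "s \<le> 1"
  shows "\<bar>\<Sum>n\<in>outer R M. 1 / (p n - s)\<bar> \<le> \<eta> / 2"
proof -
  note pb = parameter_bounds[OF eta R]
  have t: "tol \<eta> \<le> 1/80" using pb eta by linarith
  have far: "R / 2 \<le> \<bar>real_of_int j\<bar> \<and> 9/10 * \<bar>real_of_int j\<bar> \<le> \<bar>p j\<bar> \<and> 8/10 * \<bar>real_of_int j\<bar> \<le> \<bar>p j - s\<bar>"
    if j: "j \<in> outer R M" for j
  proof -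
    have "1/2 * R \<le> (1 - tol \<eta>) * R" using t pb by (intro mult_right_mono) auto
    then have a: "R / 2 \<le> \<bar>real_of_int j\<bar>" using outer_far(1)[OF reg j] by linarith
    have "tol \<eta> * \<bar>real_of_int j\<bar> \<le> 1/80 * \<bar>real_of_int j\<bar>" using t by (intro mult_right_mono) auto
    then have "\<bar>p j - real_of_int j\<bar> \<le> 1/80 * \<bar>real_of_int j\<bar>" using outer_far(2)[OF reg j] by linarith
    then show ?thesis using a pb s by linarith
  qed
  have "(\<Sum>n\<in>outer R M. 1 / (p n - s)) = (\<Sum>n\<in>outer R M. 1 / p n) + (\<Sum>n\<in>outer R M. 1 / (p n - s) - 1 / p n)"
    by (simp add: sum_subtractf)
  moreover have "\<bar>\<Sum>n\<in>outer R M. 1 / (p n - s) - 1 / p n\<bar> \<le> (\<Sum>n\<in>outer R M. 2 * (1 / (real_of_int n)\<^sup>2))"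
  proof (rule order_trans[OF sum_abs sum_mono])
    fix n assume n: "n \<in> outer R M"
    have pos: "0 < \<bar>real_of_int n\<bar>" using far[OF n] pb by linarith
    then have ne: "p n \<noteq> 0" "p n - s \<noteq> 0" using far[OF n] by auto
    have "1 / (p n - s) - 1 / p n = s / ((p n - s) * p n)" using ne by (simp add: diff_divide_eq_iff divide_diff_eq_iff)
    then have "\<bar>1 / (p n - s) - 1 / p n\<bar> = s / (\<bar>p n - s\<bar> * \<bar>p n\<bar>)" using s by (simp add: abs_mult)
    also have "\<dots> \<le> 1 / ((8/10 * \<bar>real_of_int n\<bar>) * (9/10 * \<bar>real_of_int n\<bar>))"
    proof (rule frac_le)
      show "0 < (8/10 * \<bar>real_of_int n\<bar>) * (9/10 * \<bar>real_of_int n\<bar>)" using pos by (intro mult_pos_pos) auto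
      show "(8/10 * \<bar>real_of_int n\<bar>) * (9/10 * \<bar>real_of_int n\<bar>) \<le> \<bar>p n - s\<bar> * \<bar>p n\<bar>"
        using far[OF n] by (intro mult_mono) auto
    qed (use s in auto)
    also have "\<dots> \<le> 1 / (1/2 * (real_of_int n)\<^sup>2)"
    proof (rule divide_left_mono)
      have "(8/10 * \<bar>real_of_int n\<bar>) * (9/10 * \<bar>real_of_int n\<bar>) = 72/100 * (real_of_int n)\<^sup>2"
        by (simp add: power2_eq_square abs_mult[symmetric])
      then show "1/2 * (real_of_int n)\<^sup>2 \<le> (8/10 * \<bar>real_of_int n\<bar>) * (9/10 * \<bar>real_of_int n\<bar>)" by simp
      show "0 < 8/10 * \<bar>real_of_int n\<bar> * (9/10 * \<bar>real_of_int n\<bar>) * (1/2 * (real_of_int n)\<^sup>2)"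
        using pos by (intro mult_pos_pos) auto
    qed auto
    finally show "\<bar>1 / (p n - s) - 1 / p n\<bar> \<le> 2 * (1 / (real_of_int n)\<^sup>2)" by simp
  qed
  moreover have "(\<Sum>n\<in>outer R M. 2 * (1 / (real_of_int n)\<^sup>2)) \<le> 2 * (4 / (R/2))"
    unfolding sum_distrib_left[symmetric]
    by (intro mult_left_mono sum_inverse_squares_int) (use far pb in auto)
  moreover have "2 * (4 / (R/2)) \<le> \<eta> / 4" using pb by (simp add: divide_le_eq)
  ultimately show ?thesis using sum pb by linarith
qed

end

text \<open>Integrating over the shift s turns the square of a node value into an integral over a
  unit interval, and so into part of the weighted norm.\<close>

lemma integral_shift_le:
  fixes f :: "real \<Rightarrow> real"
  assumes f: "continuous_on {-R..R} f" and c: "-R \<le> c" "c + 1 \<le> R"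
  shows "((\<lambda>s. (f (c + s))\<^sup>2) has_integral integral {c..c+1} (\<lambda>t. (f t)\<^sup>2)) {0..1}"
    and "integral {c..c+1} (\<lambda>t. (f t)\<^sup>2) \<le> integral {-R..R} (\<lambda>t. (f t)\<^sup>2)"
proof -
  have cf: "continuous_on {-R..R} (\<lambda>t. (f t)\<^sup>2)" using f by (intro continuous_intros)
  have sub: "{c..c+1} \<subseteq> {-R..R}" using c by auto
  have int: "(\<lambda>t. (f t)\<^sup>2) integrable_on {c..c+1}"
    by (rule integrable_continuous_real[OF continuous_on_subset[OF cf sub]])
  have "((\<lambda>t. (f t)\<^sup>2) has_integral integral {c..c+1} (\<lambda>t. (f t)\<^sup>2)) {c..c+1}"
    using int by (rule integrable_integral)
  then have "((\<lambda>s. (f (1 *\<^sub>R s + c))\<^sup>2) has_integral 1 *\<^sub>R integral {c..c+1} (\<lambda>t. (f t)\<^sup>2)) ((\<lambda>x. (1/1) *\<^sub>R x - (1/1) *\<^sub>R c) ` {c..c+1})"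
    using has_integral_affinity[of "\<lambda>t. (f t)\<^sup>2" "integral {c..c+1} (\<lambda>t. (f t)\<^sup>2)" c "c+1" 1 c] by simp
  moreover have "(\<lambda>x::real. (1/1) *\<^sub>R x - (1/1) *\<^sub>R c) ` {c..c+1} = {0..1}"
    using image_diff_atLeastAtMost[of c c "c+1"] by (auto simp: image_def intro: bexI[of _ "_ + c"])
  ultimately show "((\<lambda>s. (f (c + s))\<^sup>2) has_integral integral {c..c+1} (\<lambda>t. (f t)\<^sup>2)) {0..1}"
    by (simp add: add.commute)
  show "integral {c..c+1} (\<lambda>t. (f t)\<^sup>2) \<le> integral {-R..R} (\<lambda>t. (f t)\<^sup>2)"
    by (rule integral_subset_le[OF sub int integrable_continuous_real[OF cf]]) auto
qed

context points
begin

text \<open>In the coordinate (w - s) / (1 - \<eta>) the nodes become integers and the points become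
  \<open>r j\<close>. Since p j - s differs from j by at most (\<eta>/4) |j|, division by 1 - \<eta>
  pushes \<open>r j\<close> outside j, as \<open>lagrange_term_bound\<close> demands. The degree of
  q is below a + b + 1, which is at most the number 2 m + 1 of nodes.\<close>

lemma growth_at_nodes:
  assumes eta: "0 < \<eta>" "\<eta> \<le> 1/10" and R: "threshold \<eta> \<le> R" and reg: "regular (tol \<eta>) R a b"
    and sum: "\<bar>\<Sum>n\<in>outer R M. 1 / p n\<bar> < tol \<eta>"
    and M: "a \<le> int M" "b \<le> int M" "4 * R\<^sup>2 \<le> real M"
    and s: "0 \<le> s" "s \<le> 1" and q: "degree q < card (inner R)" and w: "norm w \<le> R / 5"
  defines "m \<equiv> nat (max a b)"
  shows "norm (poly (map_poly of_real q) w * ctrunc R M w) \<le> 2 * exp (pi * \<bar>Im w\<bar> / (1 - \<eta>) + 11 * \<eta> * R) *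
     (\<Sum>k\<in>{-int m..int m}. \<bar>poly q ((1 - \<eta>) * real_of_int k + s) * trunc R M ((1 - \<eta>) * real_of_int k + s)\<bar>)"
proof -
  note pb = parameter_bounds[OF eta R]
  define \<rho> where "\<rho> = 1 - \<eta>"
  define I where "I = outer R M"
  define r where "r = (\<lambda>j. (p j - s) / \<rho>)"
  define x where "x = (\<lambda>k::int. \<rho> * real_of_int k + s)"
  define w' where "w' = (w - of_real s) / of_real \<rho>"
  define c where "c = \<eta> / 3"
  have rho: "9/10 \<le> \<rho>" "\<rho> < 1" using eta by (auto simp: \<rho>_def)
  have t: "tol \<eta> \<le> \<eta> / 8" "tol \<eta> \<le> 1/80" "0 < tol \<eta>" using pb eta by linarith+
  have ab: "(1 - tol \<eta>) * R \<le> real_of_int a" "real_of_int a \<le> (1 + tol \<eta>) * R"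
     "(1 - tol \<eta>) * R \<le> real_of_int b" "real_of_int b \<le> (1 + tol \<eta>) * R" "inner R = {-a..b}"
    using reg by (auto simp: regular_def)
  have half: "R / 2 \<le> (1 - tol \<eta>) * R" using mult_right_mono[of "1/2" "1 - tol \<eta>" R] t pb by simp
  have ab0: "0 < a" "0 < b"
  proof -
    have "0 < real_of_int a" "0 < real_of_int b" using ab half pb by linarith+
    then show "0 < a" "0 < b" by simp_all
  qed
  have m: "int m = max a b" using ab0 by (simp add: m_def)
  have mr: "real m = max (real_of_int a) (real_of_int b)"
    using m by (metis of_int_max of_int_of_nat_eq)
  have mlow: "R / 2 \<le> real m" using ab half mr by linarith
  have mup: "real m \<le> (1 + tol \<eta>) * R" using ab mr by linarith
  have mup2: "real m \<le> 2 * R" using mup mult_right_mono[of "1 + tol \<eta>" 2 R] t pb by linarith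
  have far: "R / 2 \<le> \<bar>real_of_int j\<bar>" if "j \<in> I" for j
    using outer_far(1)[OF reg, of j M] that half by (simp add: I_def)
  have pj: "\<bar>p j - s - real_of_int j\<bar> \<le> \<eta> / 4 * \<bar>real_of_int j\<bar>" if j: "j \<in> I" for j
  proof -
    have "tol \<eta> * \<bar>real_of_int j\<bar> \<le> \<eta> / 8 * \<bar>real_of_int j\<bar>" using t by (intro mult_right_mono) auto
    moreover have "1 \<le> \<eta> / 8 * \<bar>real_of_int j\<bar>"
    proof -
      have "\<eta> / 8 * (R / 2) \<le> \<eta> / 8 * \<bar>real_of_int j\<bar>" using far[OF j] eta by (intro mult_left_mono) auto
      then show ?thesis using pb by linarith
    qed
    moreover have "\<bar>p j - real_of_int j\<bar> \<le> tol \<eta> * \<bar>real_of_int j\<bar>"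
      using outer_far(2)[OF reg, of j M] j by (simp add: I_def)
    ultimately show ?thesis using s by linarith
  qed
  have rnear: "\<bar>r j - real_of_int j\<bar> \<le> 2 * \<eta> * \<bar>real_of_int j\<bar>" if j: "j \<in> I" for j
  proof -
    have "r j - real_of_int j = (p j - s - real_of_int j + \<eta> * real_of_int j) / \<rho>"
      using rho by (simp add: r_def field_simps \<rho>_def)
    then have "\<bar>r j - real_of_int j\<bar> = \<bar>p j - s - real_of_int j + \<eta> * real_of_int j\<bar> / \<rho>" using rho by simp
    also have "\<dots> \<le> (\<eta> / 4 * \<bar>real_of_int j\<bar> + \<eta> * \<bar>real_of_int j\<bar>) / (9/10)"
    proof (rule frac_le)
      have "\<bar>\<eta> * real_of_int j\<bar> = \<eta> * \<bar>real_of_int j\<bar>" using eta by (simp add: abs_mult)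
      then show "\<bar>p j - s - real_of_int j + \<eta> * real_of_int j\<bar> \<le> \<eta> / 4 * \<bar>real_of_int j\<bar> + \<eta> * \<bar>real_of_int j\<bar>"
        using pj[OF j] by linarith
    qed (use rho eta in auto)
    also have "\<dots> \<le> 2 * \<eta> * \<bar>real_of_int j\<bar>" using eta by (simp add: field_simps)
    finally show ?thesis .
  qed
  have sumr: "\<bar>\<Sum>j\<in>I. 1 / r j\<bar> \<le> \<eta>"
  proof -
    have "(\<Sum>j\<in>I. 1 / r j) = \<rho> * (\<Sum>j\<in>I. 1 / (p j - s))" by (simp add: r_def sum_distrib_left)
    then have "\<bar>\<Sum>j\<in>I. 1 / r j\<bar> \<le> 1 * (\<eta> / 2)"
      unfolding I_def using shifted_sum_small[OF eta R reg sum s] rho by (simp only: abs_mult) (intro mult_mono, auto)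
    then show ?thesis using eta by linarith
  qed
  have sub: "shell (int m) (int M) \<subseteq> I"
    using m ab(5) by (auto simp: I_def outer_def shell_def)
  have c: "0 < c" "c \<le> 1" using eta by (auto simp: c_def)
  have card: "real (card (I - shell m M)) * (1 - ln c) \<le> \<eta> * R"
  proof -
    have AB: "(1 - tol \<eta>) * R \<le> (1 + tol \<eta>) * R" using t pb by (intro mult_right_mono) auto
    have "I - shell m M \<subseteq> {n. (1 - tol \<eta>) * R \<le> \<bar>real_of_int n\<bar> \<and> \<bar>real_of_int n\<bar> \<le> (1 + tol \<eta>) * R}"
    proof
      fix n assume n: "n \<in> I - shell m M"
      have "\<bar>n\<bar> \<le> int m" using n outer_far(5)[OF reg, of n M] by (auto simp: shell_def I_def)
      then have "\<bar>real_of_int n\<bar> \<le> real m" by linarith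
      then show "n \<in> {n. (1 - tol \<eta>) * R \<le> \<bar>real_of_int n\<bar> \<and> \<bar>real_of_int n\<bar> \<le> (1 + tol \<eta>) * R}"
        using mup outer_far(1)[OF reg, of n M] n by (auto simp: I_def)
    qed
    from card_mono[OF card_int_annulus_le(1)[OF AB] this]
    have "real (card (I - shell m M)) \<le> 2 * ((1 + tol \<eta>) * R - (1 - tol \<eta>) * R + 1)"
      using card_int_annulus_le(2)[OF AB] by linarith
    also have "\<dots> \<le> 4 * tol \<eta> * R + 8" by (simp add: algebra_simps)
    finally have "real (card (I - shell m M)) * (1 - ln c) \<le> (4 * tol \<eta> * R + 8) * (1 - ln c)"
      using pb(1) by (intro mult_right_mono) (auto simp: c_def)
    then show ?thesis using pb(6) by (simp add: c_def)
  qed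
  have r1: "\<bar>real_of_int j\<bar> \<le> \<bar>r j\<bar> \<and> 0 \<le> r j * real_of_int j" if "j \<in> shell m M" for j
  proof -
    have j: "j \<in> I" using that sub by auto
    have d: "\<bar>real_of_int j\<bar> - \<eta> / 4 * \<bar>real_of_int j\<bar> \<le> \<bar>p j - s\<bar>" using pj[OF j] by linarith
    have "\<rho> * \<bar>real_of_int j\<bar> \<le> \<bar>p j - s\<bar>"
    proof -
      have "\<eta> / 4 * \<bar>real_of_int j\<bar> \<le> \<eta> * \<bar>real_of_int j\<bar>" using eta by (intro mult_right_mono) auto
      then show ?thesis using d unfolding \<rho>_def left_diff_distrib by linarith
    qed
    then have "\<bar>real_of_int j\<bar> \<le> \<bar>r j\<bar>" using rho by (simp add: r_def abs_divide le_divide_eq mult.commute)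
    moreover have "0 \<le> (p j - s) * real_of_int j"
    proof -
      have "\<eta> / 4 * \<bar>real_of_int j\<bar> \<le> 1 * \<bar>real_of_int j\<bar>" using eta by (intro mult_right_mono) auto
      then have "\<bar>p j - s - real_of_int j\<bar> \<le> \<bar>real_of_int j\<bar>" using pj[OF j] by linarith
      then have "0 \<le> p j - s \<and> 0 \<le> real_of_int j \<or> p j - s \<le> 0 \<and> real_of_int j \<le> 0" by linarith
      then show ?thesis by (auto simp: zero_le_mult_iff)
    qed
    ultimately show ?thesis using rho by (simp add: r_def)
  qed
  \<comment> \<open>Unpaired points still exceed R in size, while the outermost node (1 - \<eta>) m
    is at most (1 - 3 \<eta>/4) R; the gap leaves room for the margin c = \<eta>/3 and for the shift
    s.\<close>
  have r2: "real m \<le> (1 - c) * \<bar>r j\<bar>" if "j \<in> I - shell m M" for j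
  proof -
    have "R < \<bar>p j\<bar>" using outer_far(3)[OF reg, of j M] that by (auto simp: I_def)
    then have ps: "R - 1 \<le> \<bar>p j - s\<bar>" using s by linarith
    have "real m * \<rho> \<le> ((1 + tol \<eta>) * R) * \<rho>" using mup rho by (intro mult_right_mono) auto
    also have "\<dots> = ((1 + tol \<eta>) * \<rho>) * R" by simp
    also have "\<dots> \<le> (1 - 3/4 * \<eta>) * R"
    proof (rule mult_right_mono)
      have "tol \<eta> * \<rho> \<le> \<eta> / 8 * 1" using t rho by (intro mult_mono) auto
      then show "(1 + tol \<eta>) * \<rho> \<le> 1 - 3/4 * \<eta>" using eta unfolding \<rho>_def by (simp add: distrib_right)
    qed (use pb in auto)
    also have "\<dots> \<le> (1 - c) * (R - 1)"
    proof -
      have "(1 - c) * (R - 1) = R - 1 - \<eta> * R / 3 + \<eta> / 3" by (simp add: c_def field_simps)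
      moreover have "(1 - 3/4 * \<eta>) * R = R - 3/4 * (\<eta> * R)" by (simp add: algebra_simps)
      ultimately show ?thesis using pb(5) eta by linarith
    qed
    also have "\<dots> \<le> (1 - c) * \<bar>p j - s\<bar>" using ps c by (intro mult_left_mono) auto
    finally show ?thesis using rho by (simp add: r_def abs_divide le_divide_eq)
  qed
  have w'4: "norm w' \<le> R / 4"
  proof -
    have "norm w' = norm (w - of_real s) / \<rho>" using rho by (simp add: w'_def norm_divide)
    also have "\<dots> \<le> (R / 5 + 1) / (9/10)"
      using norm_triangle_ineq4[of w "of_real s"] w s rho pb(4) by (intro frac_le) auto
    also have "\<dots> \<le> R / 4" using pb by simp
    finally show ?thesis .
  qed
  \<comment> \<open>Moving the origin to s multiplies the product by the same constant at every
    argument, so it appears on both sides of the bound.\<close>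
  define c0 where "c0 = (\<Prod>j\<in>I. (p j - s) / p j)"
  have pne: "p j \<noteq> 0" "p j - s \<noteq> 0" if "j \<in> I" for j
    using outer_far(3)[OF reg, of j M] that s pb by (auto simp: I_def)
  have cw: "norm (ctrunc R M w) = \<bar>c0\<bar> * (\<Prod>j\<in>I. norm (1 - w' / of_real (r j)))"
  proof -
    have "ctrunc R M w = (\<Prod>j\<in>I. of_real ((p j - s) / p j) * (1 - w' / of_real (r j)))"
      unfolding ctrunc_def I_def[symmetric]
    proof (rule prod.cong[OF refl])
      fix j assume j: "j \<in> I"
      have "of_real (p j - s) \<noteq> (0::complex)" using pne(2)[OF j] by (simp only: of_real_eq_0_iff not_False_eq_True)
      moreover have "of_real (p j) \<noteq> (0::complex)" "of_real \<rho> \<noteq> (0::complex)" using pne(1)[OF j] rho by auto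
      moreover have "w' / of_real (r j) = (w - of_real s) / of_real (p j - s)"
        using rho unfolding w'_def r_def of_real_divide by simp
      ultimately show "1 - w / of_real (p j) = of_real ((p j - s) / p j) * (1 - w' / of_real (r j))"
        by (simp only: of_real_divide) (simp add: field_simps)
    qed
    then have "norm (ctrunc R M w) = (\<Prod>j\<in>I. norm (of_real ((p j - s) / p j) * (1 - w' / of_real (r j))))"
      by (simp only: prod_norm)
    also have "\<dots> = (\<Prod>j\<in>I. \<bar>(p j - s) / p j\<bar> * norm (1 - w' / of_real (r j)))"
      by (simp only: norm_mult norm_of_real)
    finally show ?thesis by (simp only: prod.distrib c0_def abs_prod)
  qed
  have cx: "trunc R M (x k) = c0 * (\<Prod>j\<in>I. 1 - real_of_int k / r j)" for k
    unfolding trunc_def I_def[symmetric] c0_def prod.distrib[symmetric]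
  proof (rule prod.cong[OF refl])
    fix j assume j: "j \<in> I"
    show "1 - x k / p j = (p j - s) / p j * (1 - real_of_int k / r j)"
      using pne[OF j] rho by (simp add: x_def r_def field_simps)
  qed
  define E where "E = exp (pi * \<bar>Im w\<bar> / (1 - \<eta>) + 11 * \<eta> * R)"
  have node_bound: "norm (ctrunc R M w) * (\<Prod>j\<in>{-int m..int m}-{k}. norm (w' - of_int j) / \<bar>real_of_int k - real_of_int j\<bar>)
      \<le> 2 * E * \<bar>trunc R M (x k)\<bar>" if k: "k \<in> {-int m..int m}" for k
  proof -
    define A where "A = (\<Prod>j\<in>{-int m..int m}-{k}. norm (w' - of_int j) / \<bar>real_of_int k - real_of_int j\<bar>)"
    define Iw where "Iw = (\<Prod>j\<in>I. norm (1 - w' / of_real (r j)))"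
    define Ik where "Ik = (\<Prod>j\<in>I. 1 - real_of_int k / r j)"
    have kk: "\<bar>k\<bar> \<le> int m" using k by auto
    have mM: "m \<le> M" using M m by linarith
    have "0 \<le> R\<^sup>2" by simp
    then have M2: "R\<^sup>2 \<le> 4 * real M" using M(3) by linarith
    have R8: "8 \<le> R" using pb by linarith
    have fI: "finite I" by (simp add: I_def)
    note L = lagrange_term_bound[OF fI R8 eta far mlow mup2 mM M2 rnear sumr sub c card r1 r2 w'4 kk]
    have "A * Iw \<le> 2 * exp (pi * \<bar>Im w'\<bar> + 11 * \<eta> * R) * Ik"
      unfolding A_def Iw_def Ik_def by (rule L(1))
    also have "Im w' = Im w / \<rho>" by (simp add: w'_def Im_divide_of_real)
    also have "exp (pi * \<bar>Im w / \<rho>\<bar> + 11 * \<eta> * R) = E"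
      using rho by (simp add: E_def \<rho>_def)
    finally have "\<bar>c0\<bar> * (A * Iw) \<le> \<bar>c0\<bar> * (2 * E * Ik)" by (intro mult_left_mono) auto
    moreover have "0 < Ik" unfolding Ik_def by (rule L(2))
    ultimately show ?thesis unfolding cw cx A_def[symmetric] Iw_def[symmetric] Ik_def[symmetric]
      by (simp add: abs_mult mult_ac)
  qed
  have "poly (map_poly of_real q) w = (\<Sum>k\<in>{-int m..int m}. poly (map_poly of_real q) (of_real (x k)) *
     (\<Prod>j\<in>{-int m..int m}-{k}. (w - of_real (x j)) / (of_real (x k) - of_real (x j))))"
  proof (rule lagrange_interpolation)
    show "inj_on (\<lambda>k. complex_of_real (x k)) {-int m..int m}" using rho by (auto simp: inj_on_def x_def)
    have "degree (map_poly complex_of_real q) = degree q" by (rule degree_map_poly) auto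
    also have "\<dots> < card {-int m..int m}" using q m ab0 unfolding ab(5) by simp
    finally show "degree (map_poly complex_of_real q) < card {-int m..int m}" .
  qed simp
  also have "\<dots> = (\<Sum>k\<in>{-int m..int m}. of_real (poly q (x k)) * (\<Prod>j\<in>{-int m..int m}-{k}. (w' - of_int j) / of_real (real_of_int k - real_of_int j)))"
  proof (intro sum.cong refl arg_cong2[where f = "(*)"] prod.cong)
    fix k show "poly (map_poly of_real q) (of_real (x k)) = (of_real (poly q (x k)) :: complex)" by (rule poly_map_of_real)
    fix j
    have "w - of_real (x j) = of_real \<rho> * (w' - of_int j)" using rho by (simp add: w'_def x_def field_simps)
    moreover have "of_real (x k) - of_real (x j) = of_real \<rho> * (of_real (real_of_int k - real_of_int j) :: complex)"
      by (simp add: x_def algebra_simps)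
    ultimately show "(w - of_real (x j)) / (of_real (x k) - of_real (x j)) = (w' - of_int j) / of_real (real_of_int k - real_of_int j)"
      using rho by simp
  qed
  finally have "norm (poly (map_poly of_real q) w) \<le> (\<Sum>k\<in>{-int m..int m}. \<bar>poly q (x k)\<bar> * (\<Prod>j\<in>{-int m..int m}-{k}. norm (w' - of_int j) / \<bar>real_of_int k - real_of_int j\<bar>))"
    by (simp only:) (rule order_trans[OF norm_sum], simp add: norm_mult prod_norm[symmetric] norm_divide flip: of_int_diff)
  then have "norm (poly (map_poly of_real q) w * ctrunc R M w) \<le>
     (\<Sum>k\<in>{-int m..int m}. \<bar>poly q (x k)\<bar> * (\<Prod>j\<in>{-int m..int m}-{k}. norm (w' - of_int j) / \<bar>real_of_int k - real_of_int j\<bar>)) * norm (ctrunc R M w)"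
    unfolding norm_mult by (intro mult_right_mono) auto
  also have "\<dots> = (\<Sum>k\<in>{-int m..int m}. \<bar>poly q (x k)\<bar> * (norm (ctrunc R M w) * (\<Prod>j\<in>{-int m..int m}-{k}. norm (w' - of_int j) / \<bar>real_of_int k - real_of_int j\<bar>)))"
    unfolding sum_distrib_right by (intro sum.cong) (simp_all only: mult_ac)
  also have "\<dots> \<le> (\<Sum>k\<in>{-int m..int m}. \<bar>poly q (x k)\<bar> * (2 * E * \<bar>trunc R M (x k)\<bar>))"
    by (intro sum_mono mult_left_mono node_bound) auto
  also have "\<dots> = 2 * E * (\<Sum>k\<in>{-int m..int m}. \<bar>poly q (x k) * trunc R M (x k)\<bar>)"
    by (simp add: sum_distrib_left abs_mult mult_ac)
  finally show ?thesis unfolding E_def x_def \<rho>_def .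
qed

lemma trunc_continuous: "continuous_on A (trunc R M)"
proof -
  have "continuous_on A (\<lambda>t. \<Prod>n\<in>outer R M. 1 - t * (1 / p n))"
    by (intro continuous_on_prod continuous_on_diff continuous_on_mult continuous_on_const continuous_on_id)
  then show ?thesis by (simp add: trunc_def[abs_def])
qed

text \<open>For each shift, Cauchy-Schwarz over at most 5 R nodes bounds the squared sum;
  integration over s in [0, 1] replaces the node values by integrals over unit intervals in [-R, R],
  each at most the full norm. The overlaps are counted crudely, since a factor polynomial in R is
  harmless beside exp(11 \<eta> R).\<close>

lemma polynomial_growth:
  assumes eta: "0 < \<eta>" "\<eta> \<le> 1/10" and R: "threshold \<eta> \<le> R" and reg: "regular (tol \<eta>) R a b"
    and sum: "\<bar>\<Sum>n\<in>outer R M. 1 / p n\<bar> < tol \<eta>"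
    and M: "a \<le> int M" "b \<le> int M" "4 * R\<^sup>2 \<le> real M"
    and q: "degree q < card (inner R)" and w: "norm w \<le> R / 5"
  shows "norm (poly (map_poly of_real q) w * ctrunc R M w) \<le> 10 * R * exp (pi * \<bar>Im w\<bar> / (1 - \<eta>) + 11 * \<eta> * R) *
     sqrt (integral {-R..R} (\<lambda>t. (poly q t * trunc R M t)\<^sup>2))"
proof -
  note pb = parameter_bounds[OF eta R]
  define m where "m = nat (max a b)"
  define f where "f = (\<lambda>t. poly q t * trunc R M t)"
  define X where "X = norm (poly (map_poly of_real q) w * ctrunc R M w)"
  define E where "E = exp (pi * \<bar>Im w\<bar> / (1 - \<eta>) + 11 * \<eta> * R)"
  define J where "J = integral {-R..R} (\<lambda>t. (f t)\<^sup>2)"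
  define K where "K = {-int m..int m}"
  have t: "tol \<eta> \<le> \<eta> / 8" "tol \<eta> \<le> 1/80" "0 < tol \<eta>" using pb eta by linarith+
  have ab: "real_of_int a \<le> (1 + tol \<eta>) * R" "real_of_int b \<le> (1 + tol \<eta>) * R"
    using reg by (auto simp: regular_def)
  have mup: "real m \<le> (1 + tol \<eta>) * R"
  proof (cases "0 \<le> max a b")
    case True
    then have "real m = real_of_int (max a b)" by (simp add: m_def)
    then show ?thesis using ab by (simp add: of_int_max)
  next
    case False
    then have "m = 0" by (auto simp: m_def not_le)
    moreover have "0 \<le> (1 + tol \<eta>) * R" using t pb by (intro mult_nonneg_nonneg) auto
    ultimately show ?thesis by simp
  qed
  have m2: "2 * real m + 1 \<le> 5 * R"
  proof -
    have "(1 + tol \<eta>) * R \<le> 3/2 * R" using t pb by (intro mult_right_mono) auto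
    then show ?thesis using mup pb by linarith
  qed
  have cardK: "real (card K) \<le> 5 * R" using m2 by (simp add: K_def)
  have cf: "continuous_on {-R..R} f" unfolding f_def
    by (intro continuous_intros trunc_continuous)
  \<comment> \<open>The spacing 1 - \<eta> leaves at both ends of [-R, R] a margin \<eta> R / 2
    \<ge> 1, room for the shift.\<close>
  have inside: "-R \<le> (1 - \<eta>) * real_of_int k \<and> (1 - \<eta>) * real_of_int k + 1 \<le> R" if "k \<in> K" for k
  proof -
    have k: "\<bar>real_of_int k\<bar> \<le> real m" using that by (auto simp: K_def)
    have "\<bar>(1 - \<eta>) * real_of_int k\<bar> = (1 - \<eta>) * \<bar>real_of_int k\<bar>" using eta by (simp add: abs_mult)
    also have "\<dots> \<le> (1 - \<eta>) * ((1 + tol \<eta>) * R)" using k mup eta by (intro mult_left_mono) auto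
    also have "\<dots> = ((1 - \<eta>) * (1 + tol \<eta>)) * R" by simp
    also have "\<dots> \<le> (1 - \<eta> / 2) * R"
    proof (rule mult_right_mono)
      have "0 \<le> \<eta> * tol \<eta>" using eta t by simp
      moreover have "(1 - \<eta>) * (1 + tol \<eta>) = 1 + tol \<eta> - \<eta> - \<eta> * tol \<eta>" by (simp add: algebra_simps)
      ultimately show "(1 - \<eta>) * (1 + tol \<eta>) \<le> 1 - \<eta> / 2" using t eta by linarith
    qed (use pb in auto)
    also have "\<dots> \<le> R - 1" using pb by (simp add: algebra_simps)
    finally show ?thesis by linarith
  qed
  define S where "S = (\<lambda>s. \<Sum>k\<in>K. (f ((1 - \<eta>) * real_of_int k + s))\<^sup>2)"
  have bound: "X\<^sup>2 \<le> 4 * E\<^sup>2 * (5 * R) * S s" if s: "s \<in> {0..1}" for s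
  proof -
    have "X \<le> 2 * E * (\<Sum>k\<in>K. \<bar>f ((1 - \<eta>) * real_of_int k + s)\<bar>)"
      unfolding X_def E_def K_def f_def m_def
      by (rule growth_at_nodes[OF eta R reg sum M _ _ q w]) (use s in auto)
    then have "X\<^sup>2 \<le> (2 * E * (\<Sum>k\<in>K. \<bar>f ((1 - \<eta>) * real_of_int k + s)\<bar>))\<^sup>2"
      by (intro power_mono) (auto simp: X_def)
    also have "\<dots> = 4 * E\<^sup>2 * (\<Sum>k\<in>K. \<bar>f ((1 - \<eta>) * real_of_int k + s)\<bar>)\<^sup>2"
      by (simp add: power_mult_distrib)
    also have "\<dots> \<le> 4 * E\<^sup>2 * (S s * real (card K))"
      unfolding S_def
      using sum_squared_le_sum_of_squares[of "\<lambda>k. \<bar>f ((1 - \<eta>) * real_of_int k + s)\<bar>" K]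
      by (intro mult_left_mono) (auto simp: K_def)
    also have "\<dots> \<le> 4 * E\<^sup>2 * (S s * (5 * R))"
      by (intro mult_left_mono cardK) (auto simp: S_def intro!: sum_nonneg)
    finally show ?thesis by (simp add: mult_ac)
  qed
  have iS: "(S has_integral (\<Sum>k\<in>K. integral {(1 - \<eta>) * real_of_int k..(1 - \<eta>) * real_of_int k+1} (\<lambda>t. (f t)\<^sup>2))) {0..1}"
    unfolding S_def using inside by (intro has_integral_sum integral_shift_le(1)[OF cf]) (auto simp: K_def)
  have "((\<lambda>s::real. X\<^sup>2) has_integral X\<^sup>2) {0..1}" using has_integral_const_real[of "X\<^sup>2" 0 1] by simp
  from has_integral_le[OF this has_integral_mult_right[OF iS, of "4 * E\<^sup>2 * (5 * R)"]] bound
  have "X\<^sup>2 \<le> 4 * E\<^sup>2 * (5 * R) * (\<Sum>k\<in>K. integral {(1 - \<eta>) * real_of_int k..(1 - \<eta>) * real_of_int k+1} (\<lambda>t. (f t)\<^sup>2))"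
    by auto
  also have "\<dots> \<le> 4 * E\<^sup>2 * (5 * R) * (\<Sum>k\<in>K. J)"
    unfolding J_def using inside pb by (intro mult_left_mono sum_mono integral_shift_le(2)[OF cf]) auto
  also have "(\<Sum>k\<in>K. J) = real (card K) * J" by simp
  also have "4 * E\<^sup>2 * (5 * R) * (real (card K) * J) \<le> 4 * E\<^sup>2 * (5 * R) * (5 * R * J)"
  proof -
    have "0 \<le> J" unfolding J_def by (intro integral_nonneg integrable_continuous_real continuous_intros cf) auto
    then show ?thesis using cardK pb by (intro mult_left_mono mult_right_mono) auto
  qed
  also have "\<dots> = (10 * R * E)\<^sup>2 * J" by (simp add: power_mult_distrib power2_eq_square)
  finally have "sqrt (X\<^sup>2) \<le> sqrt ((10 * R * E)\<^sup>2 * J)" by (rule real_sqrt_le_mono)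
  then have "X \<le> 10 * R * E * sqrt J"
    using pb by (simp add: real_sqrt_mult X_def E_def)
  then show ?thesis by (simp add: X_def E_def J_def f_def)
qed

end

section \<open>The upper estimate\<close>

text \<open>Near the real axis the exponential does not help, but that piece is short: up to height
  sqrt L the kernel is at most 2 / L, which gives 2 / sqrt L. Above this height the exponential is
  at most exp(- sqrt L).\<close>

lemma vertical_kernel_bound:
  fixes \<tau> L y x :: real
  assumes \<tau>: "1 \<le> \<tau>" and L: "1 \<le> L" and y: "\<bar>y\<bar> \<le> L / 2" and x: "\<bar>x\<bar> = L"
  shows "norm (contour_integral (linepath (of_real x) (Complex x L)) (\<lambda>w. exp (\<i> * of_real \<tau> * (w - of_real y)) / (w - of_real y))) \<le> 4 / sqrt L"
proof -
  define k where "k = (\<lambda>w::complex. exp (\<i> * of_real \<tau> * (w - of_real y)) / (w - of_real y))"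
  define d where "d = sqrt L"
  have d: "1 \<le> d" "d \<le> L" "d * d = L"
    using L real_sqrt_le_mono[of L "L\<^sup>2"] by (auto simp: d_def power2_eq_square)
  have far: "L / 2 \<le> norm (w - of_real y)" if "Re w = x" for w
    using abs_Re_le_cmod[of "w - of_real y"] that y x by auto
  have nk: "norm (k w) \<le> exp (- \<tau> * h) / (L / 2)" if "Re w = x" "h \<le> Im w" for w h
    unfolding k_def norm_divide using far[OF that(1)] L \<tau> that(2) by (intro frac_le) auto
  have cont: "continuous_on (closed_segment (of_real x) (Complex x L)) k"
  proof -
    have "w - of_real y \<noteq> 0" if "w \<in> closed_segment (of_real x) (Complex x L)" for w
    proof -
      have "Re w = x" using that by (auto simp: closed_segment_same_Re)
      then show ?thesis using far[of w] L by auto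
    qed
    then show ?thesis unfolding k_def by (intro continuous_intros) auto
  qed
  have seg: "Complex x d \<in> closed_segment (of_real x) (Complex x L)"
    using d L by (simp add: closed_segment_same_Re closed_segment_eq_real_ivl)
  have sub1: "closed_segment (of_real x) (Complex x d) \<subseteq> closed_segment (of_real x) (Complex x L)"
    and sub2: "closed_segment (Complex x d) (Complex x L) \<subseteq> closed_segment (of_real x) (Complex x L)"
    using seg by (simp_all add: subset_closed_segment)
  have "norm (contour_integral (linepath (of_real x) (Complex x d)) k) \<le> 2 / L * norm (Complex x d - of_real x)"
  proof (rule contour_integral_bound_linepath)
    show "k contour_integrable_on linepath (of_real x) (Complex x d)"
      by (rule contour_integrable_continuous_linepath[OF continuous_on_subset[OF cont sub1]])
    fix w assume "w \<in> closed_segment (complex_of_real x) (Complex x d)"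
    then have "Re w = x" "0 \<le> Im w" using d by (auto simp: closed_segment_same_Re closed_segment_eq_real_ivl)
    then show "norm (k w) \<le> 2 / L" using nk[of w 0] by simp
  qed (use L in auto)
  also have "norm (Complex x d - of_real x) = d"
    using d by (simp add: complex_eq_iff cmod_def)
  also have "2 / L * d = 2 / d" using d by (simp add: divide_simps)
  finally have p1: "norm (contour_integral (linepath (of_real x) (Complex x d)) k) \<le> 2 / d" .
  have "norm (contour_integral (linepath (Complex x d) (Complex x L)) k) \<le> (2 * exp (- d) / L) * norm (Complex x L - Complex x d)"
  proof (rule contour_integral_bound_linepath)
    show "k contour_integrable_on linepath (Complex x d) (Complex x L)"
      by (rule contour_integrable_continuous_linepath[OF continuous_on_subset[OF cont sub2]])
    fix w assume "w \<in> closed_segment (Complex x d) (Complex x L)"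
    then have "Re w = x" "d \<le> Im w" using d by (auto simp: closed_segment_same_Re closed_segment_eq_real_ivl)
    then have "norm (k w) \<le> exp (- \<tau> * d) / (L / 2)" by (rule nk)
    also have "\<dots> \<le> exp (- d) / (L / 2)" using \<tau> d L mult_right_mono[of 1 \<tau> d] by (intro divide_right_mono) auto
    finally show "norm (k w) \<le> 2 * exp (- d) / L" by (simp add: field_simps)
  qed (use L in auto)
  also have "norm (Complex x L - Complex x d) = L - d"
    using d by (simp add: cmod_def)
  also have "(2 * exp (- d) / L) * (L - d) \<le> (2 * exp (- d) / L) * L"
    using d L by (intro mult_left_mono) auto
  also have "\<dots> = 2 * exp (- d)" using L by simp
  also have "exp (- d) \<le> 1 / d"
  proof -
    have "d \<le> exp d" using exp_ge_add_one_self[of d] by linarith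
    then show ?thesis using d by (simp add: exp_minus field_simps)
  qed
  finally have p2: "norm (contour_integral (linepath (Complex x d) (Complex x L)) k) \<le> 2 / d" by simp
  have "contour_integral (linepath (of_real x) (Complex x L)) k =
     contour_integral (linepath (of_real x) (Complex x d)) k + contour_integral (linepath (Complex x d) (Complex x L)) k"
    by (rule contour_integral_split_linepath[OF cont seg])
  then have "norm (contour_integral (linepath (of_real x) (Complex x L)) k) \<le> 2 / d + 2 / d"
    using norm_triangle_mono[OF p1 p2] by simp
  then show ?thesis by (simp add: k_def d_def)
qed

text \<open>Subtracting u(y) before dividing by w - y makes the integrand entire, so its integral
  around the rectangle above [-L, L] vanishes. As g is real, the imaginary part of the bottom side
  is pi times the difference to be estimated. One half plane suffices, and there the decay of exp(i
  \<tau> w) offsets the growth of u. The other three sides cost 8 A for u and 10 |g y| / sqrt L for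
  the subtracted constant.\<close>

lemma sinc_evaluation:
  fixes u :: "complex \<Rightarrow> complex" and g :: "real \<Rightarrow> real" and \<tau> L y A :: real
  assumes holo: "u holomorphic_on UNIV" and real: "\<And>t. u (of_real t) = of_real (g t)"
    and \<tau>: "1 \<le> \<tau>" and L: "1 \<le> L" and y: "\<bar>y\<bar> \<le> L / 2" and A: "0 \<le> A"
    and bound: "\<And>w. \<lbrakk>0 \<le> Im w; Im w \<le> L; \<bar>Re w\<bar> \<le> L; \<bar>Re w\<bar> = L \<or> Im w = L\<rbrakk> \<Longrightarrow> norm (u w) * exp (- \<tau> * Im w) \<le> A"
  shows "\<bar>integral {-L..L} (\<lambda>t. g t * (\<tau> / pi * sinc (\<tau> * (t - y)))) - g y * integral {-L..L} (\<lambda>t. \<tau> / pi * sinc (\<tau> * (t - y)))\<bar>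
     \<le> 8 * A + 10 * \<bar>g y\<bar> / sqrt L"
proof -
  define e where "e = (\<lambda>w::complex. exp (\<i> * of_real \<tau> * (w - of_real y)))"
  define v where "v = (\<lambda>w. if w = of_real y then deriv u (of_real y) else (u w - u (of_real y)) / (w - of_real y))"
  define h where "h = (\<lambda>w. v w * e w)"
  define k where "k = (\<lambda>w::complex. e w / (w - of_real y))"
  define k' where "k' = (\<lambda>w. u w * e w / (w - of_real y))"
  define a1 where "a1 = complex_of_real (-L)"
  define a2 where "a2 = complex_of_real L"
  define a3 where "a3 = Complex L L"
  define a4 where "a4 = Complex (-L) L"
  note adefs = a1_def a2_def a3_def a4_def
  have v: "v holomorphic_on UNIV" unfolding v_def by (rule pole_lemma_open[OF holo]) simp
  have h: "h holomorphic_on UNIV" unfolding h_def e_def by (intro holomorphic_intros v)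
  have hc: "continuous_on S h" for S using h holomorphic_on_imp_continuous_on continuous_on_subset by blast
  have uc: "continuous_on S u" for S using holo holomorphic_on_imp_continuous_on continuous_on_subset by blast
  have hi: "h contour_integrable_on linepath a b" for a b by (rule contour_integrable_continuous_linepath[OF hc])
  have "(h has_contour_integral 0) (rectpath a1 a3)"
    by (rule Cauchy_theorem_convex_simple[OF h]) auto
  then have "contour_integral (rectpath a1 a3) h = 0" by (rule contour_integral_unique)
  moreover have "rectpath a1 a3 = linepath a1 a2 +++ linepath a2 a3 +++ linepath a3 a4 +++ linepath a4 a1"
    by (simp add: rectpath_def adefs complex_of_real_def Let_def)
  ultimately have sides: "contour_integral (linepath a1 a2) h + (contour_integral (linepath a2 a3) h +
      (contour_integral (linepath a3 a4) h + contour_integral (linepath a4 a1) h)) = 0"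
    by (simp add: hi contour_integrable_joinI)
  have enorm: "norm (e w) = exp (- \<tau> * Im w)" for w by (simp add: e_def)
  define D where "D = (\<lambda>w::complex. 0 \<le> Im w \<and> Im w \<le> L \<and> \<bar>Re w\<bar> \<le> L \<and> (\<bar>Re w\<bar> = L \<or> Im w = L))"
  have far: "L / 2 \<le> norm (w - of_real y)" if "D w" for w
    using abs_Re_le_cmod[of "w - of_real y"] abs_Im_le_cmod[of "w - of_real y"] that y L unfolding D_def by auto
  have s23: "D w" if "w \<in> closed_segment a2 a3" for w
    using that L by (auto simp: D_def adefs closed_segment_same_Re closed_segment_eq_real_ivl)
  have s34: "D w" if "w \<in> closed_segment a3 a4" for w
    using that L by (auto simp: D_def adefs closed_segment_same_Im closed_segment_eq_real_ivl)
  have s41: "D w" if "w \<in> closed_segment a4 a1" for w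
    using that L by (auto simp: D_def adefs closed_segment_same_Re closed_segment_eq_real_ivl)
  \<comment> \<open>On these sides w keeps the distance L / 2 from y, so u and the subtracted
    constant can be separated again.\<close>
  have side: "norm (contour_integral (linepath a b) h) \<le> (2 * A / L) * norm (b - a) + \<bar>g y\<bar> * norm (contour_integral (linepath a b) k)"
    if ab: "\<And>w. w \<in> closed_segment a b \<Longrightarrow> D w" for a b
  proof -
    have ne: "w - of_real y \<noteq> 0" if "w \<in> closed_segment a b" for w using far[OF ab[OF that]] L by auto
    have kc: "continuous_on (closed_segment a b) k" unfolding k_def e_def using ne by (intro continuous_intros) auto
    have k'c: "continuous_on (closed_segment a b) k'" unfolding k'_def e_def using ne by (intro continuous_intros uc) auto
    note ki = contour_integrable_continuous_linepath[OF kc] and k'i = contour_integrable_continuous_linepath[OF k'c]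
    have "contour_integral (linepath a b) h = contour_integral (linepath a b) (\<lambda>w. k' w - u (of_real y) * k w)"
    proof (rule contour_integral_eq)
      fix w assume "w \<in> path_image (linepath a b)"
      then have "w - of_real y \<noteq> 0" using ne by simp
      then show "h w = k' w - u (of_real y) * k w"
        by (simp add: h_def v_def k'_def k_def diff_divide_distrib left_diff_distrib)
    qed
    also have "\<dots> = contour_integral (linepath a b) k' - u (of_real y) * contour_integral (linepath a b) k"
      using ki k'i by (simp add: contour_integral_diff contour_integral_lmul contour_integrable_lmul)
    finally have "norm (contour_integral (linepath a b) h) \<le> norm (contour_integral (linepath a b) k') + norm (u (of_real y) * contour_integral (linepath a b) k)"
      using norm_triangle_ineq4 by simp
    moreover have "norm (contour_integral (linepath a b) k') \<le> (2 * A / L) * norm (b - a)"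
    proof (rule contour_integral_bound_linepath[OF k'i])
      fix w assume w: "w \<in> closed_segment a b"
      have "norm (k' w) = norm (u w) * exp (- \<tau> * Im w) / norm (w - of_real y)"
        by (simp add: k'_def norm_divide norm_mult enorm)
      also have "\<dots> \<le> A / (L / 2)"
        using bound[of w] ab[OF w] far[OF ab[OF w]] A L by (intro frac_le) (auto simp: D_def)
      finally show "norm (k' w) \<le> 2 * A / L" by (simp add: mult.commute)
    qed (use A L in auto)
    ultimately show ?thesis by (simp add: norm_mult real)
  qed
  have sq: "1 \<le> sqrt L" "sqrt L \<le> L" using L real_sqrt_le_mono[of L "L\<^sup>2"] by (auto simp: power2_eq_square)
  have k23: "norm (contour_integral (linepath a2 a3) k) \<le> 4 / sqrt L"
    using vertical_kernel_bound[OF \<tau> L y, of L] L by (simp add: adefs k_def e_def)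
  have kcont41: "continuous_on (closed_segment a4 a1) k"
  proof -
    have "w - of_real y \<noteq> 0" if "w \<in> closed_segment a4 a1" for w using far[OF s41[OF that]] L by auto
    then show ?thesis unfolding k_def e_def by (intro continuous_intros) auto
  qed
  have k41: "norm (contour_integral (linepath a4 a1) k) \<le> 4 / sqrt L"
    unfolding contour_integral_reverse_linepath[OF kcont41]
    using vertical_kernel_bound[OF \<tau> L y, of "-L"] L by (simp add: adefs k_def e_def)
  have len34: "norm (a4 - a3) = 2 * L"
  proof -
    have "a4 - a3 = of_real (- 2 * L)" by (simp add: adefs complex_eq_iff)
    then show ?thesis using L by (simp only: norm_of_real)
  qed
  have k34: "norm (contour_integral (linepath a3 a4) k) \<le> 2 / sqrt L"
  proof -
    have kc: "continuous_on (closed_segment a3 a4) k"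
    proof -
      have "w - of_real y \<noteq> 0" if "w \<in> closed_segment a3 a4" for w using far[OF s34[OF that]] L by auto
      then show ?thesis unfolding k_def e_def by (intro continuous_intros) auto
    qed
    have "norm (contour_integral (linepath a3 a4) k) \<le> (1 / (L * L)) * norm (a4 - a3)"
    proof (rule contour_integral_bound_linepath[OF contour_integrable_continuous_linepath[OF kc]])
      fix w assume w: "w \<in> closed_segment a3 a4"
      then have Im: "Im w = L" using L by (auto simp: adefs closed_segment_same_Im)
      have "L \<le> norm (w - of_real y)" using abs_Im_le_cmod[of "w - of_real y"] Im L by auto
      then have "norm (k w) \<le> exp (- \<tau> * L) / L"
        unfolding k_def norm_divide enorm Im using L by (intro frac_le) auto
      also have "\<dots> \<le> exp (- L) / L" using \<tau> L mult_right_mono[of 1 \<tau> L] by (intro divide_right_mono) auto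
      also have "\<dots> \<le> (1 / L) / L"
      proof (rule divide_right_mono)
        have "L \<le> exp L" using exp_ge_add_one_self[of L] by linarith
        then show "exp (- L) \<le> 1 / L" using L by (simp add: exp_minus field_simps)
      qed (use L in auto)
      finally show "norm (k w) \<le> 1 / (L * L)" by simp
    qed (use L in auto)
    also have "norm (a4 - a3) = 2 * L" by (rule len34)
    also have "1 / (L * L) * (2 * L) = 2 / L" using L by simp
    also have "2 / L \<le> 2 / sqrt L" using sq by (intro divide_left_mono mult_pos_pos) auto
    finally show ?thesis .
  qed
  have lens: "norm (a3 - a2) = L" "norm (a4 - a3) = 2 * L" "norm (a1 - a4) = L"
    using L len34 by (simp_all add: adefs cmod_def)
  have "contour_integral (linepath a1 a2) h = - (contour_integral (linepath a2 a3) h +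
      (contour_integral (linepath a3 a4) h + contour_integral (linepath a4 a1) h))"
    using sides by (simp only: eq_neg_iff_add_eq_0)
  then have "norm (contour_integral (linepath a1 a2) h) \<le> norm (contour_integral (linepath a2 a3) h) +
      (norm (contour_integral (linepath a3 a4) h) + norm (contour_integral (linepath a4 a1) h))"
    using norm_triangle_ineq[of "contour_integral (linepath a2 a3) h" "contour_integral (linepath a3 a4) h + contour_integral (linepath a4 a1) h"]
      norm_triangle_ineq[of "contour_integral (linepath a3 a4) h" "contour_integral (linepath a4 a1) h"]
    by (simp only: norm_minus_cancel)
  also have "\<dots> \<le> (2 * A + \<bar>g y\<bar> * (4 / sqrt L)) + ((4 * A + \<bar>g y\<bar> * (2 / sqrt L)) + (2 * A + \<bar>g y\<bar> * (4 / sqrt L)))"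
  proof (intro add_mono)
    have c: "(2 * A / L) * L = 2 * A" "(2 * A / L) * (2 * L) = 4 * A" using L by auto
    show "norm (contour_integral (linepath a2 a3) h) \<le> 2 * A + \<bar>g y\<bar> * (4 / sqrt L)"
      using side[of a2 a3, OF s23] mult_left_mono[OF k23 abs_ge_zero[of "g y"]] unfolding lens c by linarith
    show "norm (contour_integral (linepath a3 a4) h) \<le> 4 * A + \<bar>g y\<bar> * (2 / sqrt L)"
      using side[of a3 a4, OF s34] mult_left_mono[OF k34 abs_ge_zero[of "g y"]] unfolding lens c by linarith
    show "norm (contour_integral (linepath a4 a1) h) \<le> 2 * A + \<bar>g y\<bar> * (4 / sqrt L)"
      using side[of a4 a1, OF s41] mult_left_mono[OF k41 abs_ge_zero[of "g y"]] unfolding lens c by linarith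
  qed
  also have "\<dots> = 8 * A + 10 * \<bar>g y\<bar> / sqrt L" by (simp add: mult_ac)
  finally have main: "norm (contour_integral (linepath a1 a2) h) \<le> 8 * A + 10 * \<bar>g y\<bar> / sqrt L" .
  have gc: "continuous_on S g" for S
  proof -
    have "continuous_on S (\<lambda>t. Re (u (of_real t)))" by (intro continuous_intros continuous_on_compose2[OF uc[of UNIV]]) auto
    then show ?thesis by (simp add: real)
  qed
  have "(h has_contour_integral contour_integral (linepath a1 a2) h) (linepath a1 a2)"
    by (rule has_contour_integral_integral[OF hi])
  then have "((\<lambda>t. h (of_real t)) has_integral contour_integral (linepath a1 a2) h) {-L..L}"
    using L by (subst (asm) has_contour_integral_linepath_Reals_iff) (auto simp: adefs)
  then have "((\<lambda>t. Im (h (of_real t))) has_integral Im (contour_integral (linepath a1 a2) h)) {-L..L}"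
    by (rule has_integral_Im)
  \<comment> \<open>At t = y the function h is defined through a derivative; the single point is
    ignored.\<close>
  then have "((\<lambda>t. pi * (g t * (\<tau> / pi * sinc (\<tau> * (t - y))) - g y * (\<tau> / pi * sinc (\<tau> * (t - y))))) has_integral Im (contour_integral (linepath a1 a2) h)) {-L..L}"
  proof (rule has_integral_spike[of "{y}", rotated 2])
    fix t assume "t \<in> {-L..L} - {y}"
    then have ty: "t \<noteq> y" by auto
    have "h (of_real t) = of_real ((g t - g y) / (t - y)) * exp (\<i> * of_real (\<tau> * (t - y)))"
      using ty by (simp add: h_def v_def e_def real mult.assoc)
    then have "Im (h (of_real t)) = (g t - g y) / (t - y) * sin (\<tau> * (t - y))"
    proof -
      have "Im (of_real a * cis b) = a * sin b" for a b by simp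
      then show ?thesis unfolding \<open>h (of_real t) = _\<close> cis_conv_exp[symmetric] .
    qed
    also have "\<dots> = pi * (g t * (\<tau> / pi * sinc (\<tau> * (t - y))) - g y * (\<tau> / pi * sinc (\<tau> * (t - y))))"
    proof -
      have "(a - b) / d * S = pi * (a * (S / (pi * d)) - b * (S / (pi * d)))" for a b d S :: real
        by (simp add: diff_divide_distrib left_diff_distrib right_diff_distrib)
      moreover have "\<tau> / pi * sinc (\<tau> * (t - y)) = sin (\<tau> * (t - y)) / (pi * (t - y))" using ty \<tau> by simp
      ultimately show ?thesis by metis
    qed
    finally show "pi * (g t * (\<tau> / pi * sinc (\<tau> * (t - y))) - g y * (\<tau> / pi * sinc (\<tau> * (t - y)))) = Im (h (of_real t))" by simp
  qed simp
  moreover have "((\<lambda>t. pi * (g t * (\<tau> / pi * sinc (\<tau> * (t - y))) - g y * (\<tau> / pi * sinc (\<tau> * (t - y))))) has_integral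
     pi * (integral {-L..L} (\<lambda>t. g t * (\<tau> / pi * sinc (\<tau> * (t - y)))) - g y * integral {-L..L} (\<lambda>t. \<tau> / pi * sinc (\<tau> * (t - y))))) {-L..L}"
    by (intro has_integral_mult_right has_integral_diff integrable_integral integrable_continuous_real
        continuous_intros gc continuous_on_compose2[OF continuous_on_sinc]) auto
  ultimately have eq: "Im (contour_integral (linepath a1 a2) h) =
     pi * (integral {-L..L} (\<lambda>t. g t * (\<tau> / pi * sinc (\<tau> * (t - y)))) - g y * integral {-L..L} (\<lambda>t. \<tau> / pi * sinc (\<tau> * (t - y))))"
    by (rule has_integral_unique)
  define Z where "Z = \<bar>integral {-L..L} (\<lambda>t. g t * (\<tau> / pi * sinc (\<tau> * (t - y)))) - g y * integral {-L..L} (\<lambda>t. \<tau> / pi * sinc (\<tau> * (t - y)))\<bar>"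
  have "1 * Z \<le> pi * Z" using pi_gt3 by (intro mult_right_mono) (auto simp: Z_def)
  also have "\<dots> = \<bar>Im (contour_integral (linepath a1 a2) h)\<bar>" unfolding eq by (simp add: abs_mult Z_def)
  also have "\<dots> \<le> norm (contour_integral (linepath a1 a2) h)" by (rule abs_Im_le_cmod)
  finally show ?thesis using main by (simp add: Z_def)
qed

text \<open>On vertical sides |X - y| \<ge> 7 R / 80 and the Gaussian decays; its growth in the
  imaginary direction, Y^2 / R \<le> |Y| / 8, is absorbed by the term - \<kappa> |Y|. On horizontal
  sides |Y| = L \<ge> R / 10 and that term alone suffices. A Gaussian of variance proportional to R
  thus gains a multiple of R on the contour and still tends to 1 at bounded arguments; the term -
  \<kappa> |Y| is slack in the exponential type.\<close>

lemma gauss_exponent_bound: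
  fixes X Y L R y \<kappa> :: real
  assumes \<kappa>: "0 < \<kappa>" and R: "0 < R" and L: "R / 10 \<le> L" "L \<le> R / 8" and y: "\<bar>y\<bar> \<le> R / 80"
    and XY: "\<bar>X\<bar> = L \<or> \<bar>Y\<bar> = L" "\<bar>Y\<bar> \<le> L"
  shows "- \<kappa> * \<bar>Y\<bar> - \<kappa> * ((X - y)\<^sup>2 - Y\<^sup>2) / R \<le> - \<kappa> * R / 200"
proof -
  have Y: "Y\<^sup>2 / R \<le> \<bar>Y\<bar> / 8"
  proof -
    have "Y\<^sup>2 = \<bar>Y\<bar> * \<bar>Y\<bar>" by (simp add: power2_eq_square)
    also have "\<dots> \<le> \<bar>Y\<bar> * (R / 8)" using XY L by (intro mult_left_mono) auto
    finally show ?thesis using R by (simp add: divide_le_eq mult.commute)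
  qed
  have "R / 200 \<le> \<bar>Y\<bar> + ((X - y)\<^sup>2 - Y\<^sup>2) / R"
    using XY(1)
  proof
    assume "\<bar>X\<bar> = L"
    then have "7 * R / 80 \<le> \<bar>X - y\<bar>" using L y by linarith
    then have "(7 * R / 80)\<^sup>2 \<le> \<bar>X - y\<bar>\<^sup>2" using R by (intro power_mono) auto
    then have "(7 * R / 80)\<^sup>2 / R \<le> (X - y)\<^sup>2 / R" using R by (simp add: divide_right_mono)
    moreover have "(7 * R / 80)\<^sup>2 / R = 49 / 6400 * R" using R by (simp add: power2_eq_square)
    moreover have "((X - y)\<^sup>2 - Y\<^sup>2) / R = (X - y)\<^sup>2 / R - Y\<^sup>2 / R" by (rule diff_divide_distrib)
    moreover have "R / 200 \<le> 49 / 6400 * R" using R by simp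
    ultimately show ?thesis using Y abs_ge_zero[of Y] by linarith
  next
    assume "\<bar>Y\<bar> = L"
    moreover have "0 \<le> (X - y)\<^sup>2 / R" using R by simp
    moreover have "((X - y)\<^sup>2 - Y\<^sup>2) / R = (X - y)\<^sup>2 / R - Y\<^sup>2 / R" by (rule diff_divide_distrib)
    ultimately show ?thesis using Y L R by linarith
  qed
  then have "\<kappa> * (R / 200) \<le> \<kappa> * (\<bar>Y\<bar> + ((X - y)\<^sup>2 - Y\<^sup>2) / R)" using \<kappa> by (intro mult_left_mono) auto
  then show ?thesis by (simp add: algebra_simps)
qed

lemma norm_gauss: "norm (exp (- of_real \<kappa> * (w - of_real y)\<^sup>2 / of_real R)) = exp (- \<kappa> * ((Re w - y)\<^sup>2 - (Im w)\<^sup>2) / R)"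
  for w :: complex
proof -
  have "Re (- of_real \<kappa> * (w - of_real y)\<^sup>2 / of_real R) = - \<kappa> * ((Re w - y)\<^sup>2 - (Im w)\<^sup>2) / R"
    by (simp add: Re_divide_of_real Re_power2)
  then show ?thesis by (simp only: norm_exp_eq_Re)
qed

text \<open>As sqrt 2 / 8 < 1/5, the squares in use fit into the disc where the growth and nodal
  estimates hold.\<close>

lemma norm_le_of_square:
  fixes w :: complex
  assumes "\<bar>Re w\<bar> \<le> R / 8" "\<bar>Im w\<bar> \<le> R / 8" "0 \<le> R"
  shows "norm w \<le> R / 5"
proof (rule power2_le_imp_le)
  have "(Re w)\<^sup>2 \<le> (R / 8)\<^sup>2" "(Im w)\<^sup>2 \<le> (R / 8)\<^sup>2"
    using assms by (auto intro!: power2_le_iff_abs_le[THEN iffD2])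
  then have "(norm w)\<^sup>2 \<le> 2 * (R / 8)\<^sup>2" unfolding cmod_power2 by linarith
  also have "\<dots> \<le> (R / 5)\<^sup>2" by (simp add: power_divide)
  finally show "(norm w)\<^sup>2 \<le> (R / 5)\<^sup>2" .
qed (use assms in simp)

lemma pi_divide_le:
  fixes \<eta> :: real
  assumes "0 < \<eta>" "\<eta> \<le> 1/2"
  shows "pi / (1 - \<eta>) \<le> pi * (1 + 2 * \<eta>)"
proof -
  have "0 \<le> \<eta> * (1 - 2 * \<eta>)" using assms by simp
  then have "1 \<le> (1 + 2 * \<eta>) * (1 - \<eta>)" by (simp add: algebra_simps)
  then have "pi * 1 \<le> pi * ((1 + 2 * \<eta>) * (1 - \<eta>))" by (intro mult_left_mono) auto
  then show ?thesis using assms by (simp add: divide_le_eq)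
qed

context points
begin

lemma ctrunc_holomorphic: "ctrunc R M holomorphic_on S"
proof -
  have "(\<lambda>z. \<Prod>n\<in>outer R M. 1 - z * of_real (1 / p n)) holomorphic_on S"
    by (intro holomorphic_intros)
  then show ?thesis by (simp add: ctrunc_def[abs_def])
qed

text \<open>The damped function g has the same value at y as f and no larger norm. The type \<tau> =
  pi (1 + \<kappa>) exceeds pi / (1 - \<eta>) by at least \<kappa>, the slack used in
  \<open>gauss_exponent_bound\<close>; with \<eta> = \<kappa> / 20000 the loss 11 \<eta> R consumes
  at most half of the gain \<kappa> R / 200. Cauchy-Schwarz against a cardinal sine of squared norm
  at most \<tau> / pi then gives the constant 1 + \<kappa>.\<close>

lemma upper_pointwise:
  assumes \<kappa>: "0 < \<kappa>" "\<kappa> \<le> 1" and eta: "\<eta> = \<kappa> / 20000" and R: "threshold \<eta> \<le> R" and reg: "regular (tol \<eta>) R a b"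
    and sum: "\<bar>\<Sum>n\<in>outer R M. 1 / p n\<bar> < tol \<eta>"
    and M: "a \<le> int M" "b \<le> int M" "4 * R\<^sup>2 \<le> real M"
    and q: "degree q < card (inner R)" and y: "\<bar>y\<bar> \<le> R / 80"
  defines "H \<equiv> R / 8" and "\<tau> \<equiv> pi * (1 + \<kappa>)" and "f \<equiv> \<lambda>t. poly q t * trunc R M t"
  shows "\<bar>f y\<bar> * (integral {-H..H} (\<lambda>t. \<tau> / pi * sinc (\<tau> * (t - y))) - 10 / sqrt H)
     \<le> sqrt (integral {-R..R} (\<lambda>t. (f t)\<^sup>2)) * (sqrt (1 + \<kappa>) + 80 * R * exp (- \<kappa> * R / 400))"
proof -
  have e: "0 < \<eta>" "\<eta> \<le> 1/10" using \<kappa> by (auto simp: eta)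
  note pb = parameter_bounds[OF e R]
  define J where "J = integral {-R..R} (\<lambda>t. (f t)\<^sup>2)"
  define u where "u = (\<lambda>w. poly (map_poly of_real q) w * ctrunc R M w * exp (- of_real \<kappa> * (w - of_real y)\<^sup>2 / of_real R))"
  define g where "g = (\<lambda>t. f t * exp (- \<kappa> * (t - y)\<^sup>2 / R))"
  define A where "A = 10 * R * exp (- \<kappa> * R / 400) * sqrt J"
  define E where "E = (\<lambda>t. \<tau> / pi * sinc (\<tau> * (t - y)))"
  have tau: "1 \<le> \<tau>" "0 < \<tau>"
  proof -
    have "1 * 1 \<le> pi * (1 + \<kappa>)" using pi_gt3 \<kappa> by (intro mult_mono) auto
    then show "1 \<le> \<tau>" by (simp add: \<tau>_def)
    then show "0 < \<tau>" by simp
  qed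
  have fc: "continuous_on S f" for S unfolding f_def by (intro continuous_intros trunc_continuous)
  have gc: "continuous_on S g" for S unfolding g_def by (intro continuous_intros fc) (use pb in auto)
  have J0: "0 \<le> J" unfolding J_def by (intro integral_nonneg integrable_continuous_real continuous_intros fc) auto
  have Ec: "continuous_on S E" for S
    unfolding E_def by (intro continuous_intros continuous_on_compose2[OF continuous_on_sinc]) auto
  have main: "\<bar>integral {-H..H} (\<lambda>t. g t * (\<tau> / pi * sinc (\<tau> * (t - y)))) - g y * integral {-H..H} (\<lambda>t. \<tau> / pi * sinc (\<tau> * (t - y)))\<bar>
     \<le> 8 * A + 10 * \<bar>g y\<bar> / sqrt H"
  proof (rule sinc_evaluation[where u = u])
    show "u holomorphic_on UNIV" unfolding u_def
      by (intro holomorphic_intros ctrunc_holomorphic) (use pb in auto)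
    show "u (of_real t) = of_real (g t)" for t
    proof -
      have "exp (- of_real \<kappa> * (of_real t - of_real y)\<^sup>2 / of_real R) = complex_of_real (exp (- \<kappa> * (t - y)\<^sup>2 / R))"
        by (simp add: exp_of_real[symmetric])
      then show ?thesis by (simp only: u_def g_def f_def poly_map_of_real ctrunc_of_real of_real_mult)
    qed
    show "1 \<le> H" "\<bar>y\<bar> \<le> H / 2" using pb y by (auto simp: H_def)
    show "0 \<le> A" using pb J0 by (simp add: A_def)
    fix w assume w: "0 \<le> Im w" "Im w \<le> H" "\<bar>Re w\<bar> \<le> H" "\<bar>Re w\<bar> = H \<or> Im w = H"
    define Y where "Y = Im w"
    have "norm w \<le> R / 5" by (rule norm_le_of_square) (use w pb in \<open>auto simp: H_def\<close>)
    from polynomial_growth[OF e R reg sum M q this]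
    have gr: "norm (poly (map_poly of_real q) w * ctrunc R M w) \<le> 10 * R * exp (pi * Y / (1 - \<eta>) + 11 * \<eta> * R) * sqrt J"
      using w by (simp add: J_def f_def Y_def)
    define G where "G = - \<kappa> * ((Re w - y)\<^sup>2 - Y\<^sup>2) / R"
    have "norm (u w) * exp (- \<tau> * Im w) = norm (poly (map_poly of_real q) w * ctrunc R M w) * (exp G * exp (- \<tau> * Y))"
      unfolding u_def norm_mult[of _ "exp _"] norm_gauss by (simp add: G_def Y_def)
    also have "\<dots> \<le> (10 * R * exp (pi * Y / (1 - \<eta>) + 11 * \<eta> * R) * sqrt J) * (exp G * exp (- \<tau> * Y))"
      using gr by (intro mult_right_mono) auto
    also have "\<dots> = 10 * R * sqrt J * exp (pi * Y / (1 - \<eta>) + 11 * \<eta> * R + G - \<tau> * Y)"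
      by (simp add: exp_add[symmetric] exp_diff)
    also have "\<dots> \<le> 10 * R * sqrt J * exp (- \<kappa> * R / 400)"
    proof -
      have "pi / (1 - \<eta>) * Y \<le> pi * (1 + 2 * \<eta>) * Y"
        using pi_divide_le[of \<eta>] e w by (intro mult_right_mono) (auto simp: Y_def)
      also have "\<dots> \<le> (\<tau> - \<kappa>) * Y"
      proof (rule mult_right_mono)
        have "1 * \<kappa> \<le> pi * (\<kappa> - 2 * \<eta>) "
        proof -
          have "2 * (\<kappa> / 2) \<le> pi * (\<kappa> - 2 * \<eta>)" using pi_ge_two \<kappa> by (intro mult_mono) (auto simp: eta)
          then show ?thesis by simp
        qed
        then show "pi * (1 + 2 * \<eta>) \<le> \<tau> - \<kappa>" by (simp add: \<tau>_def algebra_simps)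
      qed (use w in \<open>auto simp: Y_def\<close>)
      finally have 1: "pi * Y / (1 - \<eta>) \<le> \<tau> * Y - \<kappa> * Y" by (simp add: left_diff_distrib)
      have 2: "- \<kappa> * \<bar>Y\<bar> + G \<le> - \<kappa> * R / 200"
        using gauss_exponent_bound[of \<kappa> R H y "Re w" Y] \<kappa> pb y w by (auto simp: G_def H_def Y_def)
      have 3: "11 * \<eta> * R \<le> \<kappa> * R / 400"
      proof -
        have "11 * \<eta> * R \<le> \<kappa> / 400 * R" using \<kappa> pb by (intro mult_right_mono) (auto simp: eta)
        then show ?thesis by simp
      qed
      have "\<bar>Y\<bar> = Y" using w by (simp add: Y_def)
      then have "pi * Y / (1 - \<eta>) + 11 * \<eta> * R + G - \<tau> * Y \<le> - \<kappa> * R / 400"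
        using 1 2 3 by simp
      then show ?thesis using pb J0 by (intro mult_left_mono) auto
    qed
    finally show "norm (u w) * exp (- \<tau> * Im w) \<le> A" by (simp add: A_def mult_ac)
  qed (rule tau)
  have gy: "g y = f y" by (simp add: g_def)
  have "(integral {-H..H} (\<lambda>t. g t * E t))\<^sup>2 \<le> integral {-H..H} (\<lambda>t. (g t)\<^sup>2) * integral {-H..H} (\<lambda>t. (E t)\<^sup>2)"
    by (rule integral_Cauchy_Schwarz[OF gc Ec])
  also have "\<dots> \<le> J * (1 + \<kappa>)"
  proof (rule mult_mono)
    have "integral {-H..H} (\<lambda>t. (g t)\<^sup>2) \<le> integral {-H..H} (\<lambda>t. (f t)\<^sup>2)"
    proof (intro integral_le integrable_continuous_real continuous_intros fc gc)
      fix t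
      have "\<bar>g t\<bar> \<le> \<bar>f t\<bar> * 1" unfolding g_def abs_mult using \<kappa> pb by (intro mult_left_mono) auto
      then show "(g t)\<^sup>2 \<le> (f t)\<^sup>2" by (simp add: abs_le_square_iff)
    qed
    also have "\<dots> \<le> J" unfolding J_def
      by (intro integral_subset_le integrable_continuous_real continuous_intros fc) (use pb in \<open>auto simp: H_def\<close>)
    finally show "integral {-H..H} (\<lambda>t. (g t)\<^sup>2) \<le> J" .
    have "integral {-H..H} (\<lambda>t. (E t)\<^sup>2) \<le> \<tau> / pi" unfolding E_def by (rule integral_sinc2_le[OF tau(2)])
    then show "integral {-H..H} (\<lambda>t. (E t)\<^sup>2) \<le> 1 + \<kappa>" by (simp add: \<tau>_def)
    show "0 \<le> integral {-H..H} (\<lambda>t. (E t)\<^sup>2)"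
      by (intro integral_nonneg integrable_continuous_real continuous_intros Ec) auto
  qed (rule J0)
  finally have "sqrt ((integral {-H..H} (\<lambda>t. g t * E t))\<^sup>2) \<le> sqrt (J * (1 + \<kappa>))" by (rule real_sqrt_le_mono)
  then have cs: "\<bar>integral {-H..H} (\<lambda>t. g t * E t)\<bar> \<le> sqrt J * sqrt (1 + \<kappa>)" by (simp add: real_sqrt_mult)
  define c where "c = integral {-H..H} E"
  have main': "\<bar>integral {-H..H} (\<lambda>t. g t * E t) - f y * c\<bar> \<le> 8 * A + 10 * \<bar>f y\<bar> / sqrt H"
    using main by (simp only: gy E_def c_def)
  have "\<bar>f y\<bar> * c \<le> \<bar>f y * c\<bar>" by (simp add: abs_mult mult_left_mono)
  also have "\<dots> \<le> \<bar>integral {-H..H} (\<lambda>t. g t * E t)\<bar> + (8 * A + 10 * \<bar>f y\<bar> / sqrt H)"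
    using main' by linarith
  also have "\<dots> \<le> sqrt J * sqrt (1 + \<kappa>) + 8 * A + 10 * \<bar>f y\<bar> / sqrt H" using cs by simp
  finally have "\<bar>f y\<bar> * (c - 10 / sqrt H) \<le> sqrt J * sqrt (1 + \<kappa>) + 8 * A"
    by (simp add: algebra_simps)
  also have "\<dots> = sqrt J * (sqrt (1 + \<kappa>) + 80 * R * exp (- \<kappa> * R / 400))" by (simp add: A_def algebra_simps)
  finally show ?thesis by (simp add: c_def E_def J_def)
qed

lemma eventually_large_trunc: "\<forall>\<^sub>F M in sequentially. a \<le> int M \<and> b \<le> int M \<and> c \<le> real M"
proof -
  have "filterlim int at_top sequentially" by (rule filterlim_int_sequentially)
  then have "\<forall>\<^sub>F M in sequentially. a \<le> int M" "\<forall>\<^sub>F M in sequentially. b \<le> int M"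
    by (auto simp: filterlim_at_top)
  moreover have "\<forall>\<^sub>F M in sequentially. c \<le> real M"
    using filterlim_real_sequentially by (auto simp: filterlim_at_top)
  ultimately show ?thesis by eventually_elim auto
qed

lemma upper_estimate:
  assumes e: "0 < e" and T: "0 \<le> T"
  shows "\<forall>\<^sub>F R in at_top. \<forall>\<^sub>F M in sequentially. \<forall>q y. degree q < card (inner R) \<longrightarrow> \<bar>y\<bar> \<le> T \<longrightarrow>
     (poly q y * trunc R M y)\<^sup>2 \<le> (1 + e) * integral {-R..R} (\<lambda>t. (poly q t * trunc R M t)\<^sup>2)"
proof -
  define \<kappa> where "\<kappa> = min 1 (e / 2)"
  define \<eta> where "\<eta> = \<kappa> / 20000"
  define \<tau> where "\<tau> = pi * (1 + \<kappa>)"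
  \<comment> \<open>Solves \<open>sqrt (1 + \<kappa>) + \<zeta> = sqrt (1 + e) * (1 - 2 *
    \<zeta>)\<close>: one \<zeta> for the exponentially small error on the right, two on the left,
    for the missing tails of the sine integral and for \<open>10 / sqrt H\<close>.\<close>
  define \<zeta> where "\<zeta> = (sqrt (1 + e) - sqrt (1 + \<kappa>)) / (1 + 2 * sqrt (1 + e))"
  have \<kappa>: "0 < \<kappa>" "\<kappa> \<le> 1" "\<kappa> < e" using e by (auto simp: \<kappa>_def)
  have eta: "0 < \<eta>" "\<eta> \<le> 1/10" using \<kappa> by (auto simp: \<eta>_def)
  have tau: "1 \<le> \<tau>"
  proof -
    have "1 * 1 \<le> pi * (1 + \<kappa>)" using pi_gt3 \<kappa> by (intro mult_mono) auto
    then show "1 \<le> \<tau>" by (simp add: \<tau>_def)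
  qed
  have s0: "0 \<le> sqrt (1 + e)" "0 \<le> sqrt (1 + \<kappa>)" using e \<kappa> by auto
  have z0: "0 < \<zeta>" unfolding \<zeta>_def using \<kappa> s0 by (intro divide_pos_pos) (auto intro: add_pos_nonneg)
  have zeq: "sqrt (1 + \<kappa>) + \<zeta> = sqrt (1 + e) * (1 - 2 * \<zeta>)"
  proof -
    have "\<zeta> * (1 + 2 * sqrt (1 + e)) = sqrt (1 + e) - sqrt (1 + \<kappa>)"
    proof -
      have "1 + 2 * sqrt (1 + e) \<noteq> 0" using s0 by linarith
      then show ?thesis unfolding \<zeta>_def times_divide_eq_left by (rule nonzero_mult_div_cancel_right)
    qed
    then show ?thesis by (simp add: algebra_simps)
  qed
  have z1: "0 < 1 - 2 * \<zeta>"
  proof -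
    have "0 < sqrt (1 + \<kappa>) + \<zeta>" using z0 s0 by linarith
    then show ?thesis unfolding zeq using s0 by (simp add: zero_less_mult_iff)
  qed
  have "\<forall>\<^sub>F x in at_top. pi / 2 - \<zeta> < Si x" by (rule order_tendstoD(1)[OF Si_at_top]) (use z0 in simp)
  then obtain x0 where x0: "\<And>x. x0 \<le> x \<Longrightarrow> pi / 2 - \<zeta> < Si x" by (auto simp: eventually_at_top_linorder)
  have "((\<lambda>R::real. 80 * R * exp (- \<kappa> * R / 400)) \<longlongrightarrow> 0) at_top" using \<kappa>(1) by real_asymp
  then have ev1: "\<forall>\<^sub>F R in at_top. 80 * R * exp (- \<kappa> * R / 400) < \<zeta>" by (rule order_tendstoD(2)) (rule z0)
  have "((\<lambda>R::real. 10 / sqrt (R / 8)) \<longlongrightarrow> 0) at_top" by real_asymp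
  then have ev2: "\<forall>\<^sub>F R in at_top. 10 / sqrt (R / 8) < \<zeta>" by (rule order_tendstoD(2)) (rule z0)
  show ?thesis
    using eventually_regular[OF eta] ev1 ev2 eventually_ge_at_top[of "80 * T"] eventually_ge_at_top[of "8 * (T + \<bar>x0\<bar>)"]
  proof eventually_elim
    case (elim R)
    then obtain a b where reg: "regular (tol \<eta>) R a b" by blast
    have R: "threshold \<eta> \<le> R" using elim by blast
    note pb = parameter_bounds[OF eta R]
    have "\<forall>\<^sub>F M in sequentially. \<bar>\<Sum>n\<in>outer R M. 1 / p n\<bar> < tol \<eta>" using elim by blast
    then show ?case using eventually_large_trunc[of a b "4 * R\<^sup>2"]
    proof eventually_elim
      case M: (elim M)
      show ?case
      proof (intro allI impI)
        fix q :: "real poly" and y :: real assume q: "degree q < card (inner R)" and y: "\<bar>y\<bar> \<le> T"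
        define f where "f = (\<lambda>t. poly q t * trunc R M t)"
        define J where "J = integral {-R..R} (\<lambda>t. (f t)\<^sup>2)"
        define H where "H = R / 8"
        define c where "c = integral {-H..H} (\<lambda>t. \<tau> / pi * sinc (\<tau> * (t - y)))"
        have J0: "0 \<le> J" unfolding J_def f_def
          by (intro integral_nonneg integrable_continuous_real continuous_intros trunc_continuous) auto
        have "\<bar>f y\<bar> * (c - 10 / sqrt H) \<le> sqrt J * (sqrt (1 + \<kappa>) + 80 * R * exp (- \<kappa> * R / 400))"
          unfolding f_def J_def c_def H_def \<tau>_def
          by (rule upper_pointwise[OF \<kappa>(1,2) \<eta>_def R reg]) (use M q y elim in auto)
        also have "\<dots> \<le> sqrt J * (sqrt (1 + \<kappa>) + \<zeta>)" using elim J0 by (intro mult_left_mono) auto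
        finally have 1: "\<bar>f y\<bar> * (c - 10 / sqrt H) \<le> sqrt J * (sqrt (1 + e) * (1 - 2 * \<zeta>))" unfolding zeq .
        \<comment> \<open>c is the mass of the cardinal sine on [-H, H]; both end arguments are
          beyond x0, uniformly for |y| \<le> T.\<close>
        have c: "1 - \<zeta> \<le> c"
        proof -
          have Lx: "x0 \<le> \<tau> * (H - y)" "x0 \<le> \<tau> * (H + y)" "0 \<le> \<tau> * (H + y)"
          proof -
            have "\<bar>x0\<bar> \<le> H - y" "\<bar>x0\<bar> \<le> H + y" using elim y by (auto simp: H_def)
            then have "1 * \<bar>x0\<bar> \<le> \<tau> * (H - y)" "1 * \<bar>x0\<bar> \<le> \<tau> * (H + y)"
              using tau by (intro mult_mono; simp)+
            then show "x0 \<le> \<tau> * (H - y)" "x0 \<le> \<tau> * (H + y)" "0 \<le> \<tau> * (H + y)" by auto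
          qed
          have "c = (Si (\<tau> * (H - y)) - Si (\<tau> * (- H - y))) / pi"
            unfolding c_def by (rule integral_unique[OF has_integral_sinc_scaled]) (use pb in \<open>simp add: H_def\<close>)
          also have "Si (\<tau> * (- H - y)) = - Si (\<tau> * (H + y))"
            using Si_neg[OF Lx(3)] by (simp add: algebra_simps)
          finally have "c = (Si (\<tau> * (H - y)) + Si (\<tau> * (H + y))) / pi" by simp
          moreover have "pi - 2 * \<zeta> \<le> Si (\<tau> * (H - y)) + Si (\<tau> * (H + y))" using x0[OF Lx(1)] x0[OF Lx(2)] by linarith
          moreover have "pi * (1 - \<zeta>) \<le> pi - 2 * \<zeta>" using pi_ge_two mult_right_mono[of 2 pi \<zeta>] z0 by (simp add: algebra_simps)
          ultimately show ?thesis by (simp add: le_divide_eq mult.commute)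
        qed
        have "\<bar>f y\<bar> * (1 - 2 * \<zeta>) \<le> \<bar>f y\<bar> * (c - 10 / sqrt H)"
          using c elim by (intro mult_left_mono) (auto simp: H_def)
        then have "\<bar>f y\<bar> * (1 - 2 * \<zeta>) \<le> (sqrt J * sqrt (1 + e)) * (1 - 2 * \<zeta>)" using 1 by (simp add: mult_ac)
        then have "\<bar>f y\<bar> \<le> sqrt J * sqrt (1 + e)" using z1 by (simp add: mult_le_cancel_right)
        then have "\<bar>f y\<bar>\<^sup>2 \<le> (sqrt J * sqrt (1 + e))\<^sup>2" by (intro power_mono) auto
        then show "(poly q y * trunc R M y)\<^sup>2 \<le> (1 + e) * integral {-R..R} (\<lambda>t. (poly q t * trunc R M t)\<^sup>2)"
          using J0 e by (simp add: power_mult_distrib f_def J_def mult.commute)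
      qed
    qed
  qed
qed

end

section \<open>The lower estimate\<close>

lemma norm_rectpath_integral_le:
  assumes cont: "continuous_on (path_image (rectpath a b)) f" and B: "0 \<le> B"
    and bound: "\<And>w. w \<in> path_image (rectpath a b) \<Longrightarrow> norm (f w) \<le> B"
    and ab: "Re b - Re a = l" "Im b - Im a = l" "0 \<le> l"
  shows "norm (contour_integral (rectpath a b) f) \<le> 4 * l * B"
proof -
  define c where "c = Complex (Re b) (Im a)"
  define d where "d = Complex (Re a) (Im b)"
  have r: "rectpath a b = linepath a c +++ linepath c b +++ linepath b d +++ linepath d a"
    by (simp add: rectpath_def c_def d_def Let_def)
  have im: "path_image (rectpath a b) = closed_segment a c \<union> closed_segment c b \<union> closed_segment b d \<union> closed_segment d a"
    unfolding r by (simp add: path_image_join Un_assoc)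
  have i: "f contour_integrable_on linepath a c" "f contour_integrable_on linepath c b"
    "f contour_integrable_on linepath b d" "f contour_integrable_on linepath d a"
    by (intro contour_integrable_continuous_linepath continuous_on_subset[OF cont]; simp add: im; blast)+
  have n: "norm (c - a) = l" "norm (b - c) = l" "norm (d - b) = l" "norm (a - d) = l"
    using ab by (auto simp: c_def d_def cmod_def)
  have s: "norm (contour_integral (linepath a c) f) \<le> B * l" "norm (contour_integral (linepath c b) f) \<le> B * l"
    "norm (contour_integral (linepath b d) f) \<le> B * l" "norm (contour_integral (linepath d a) f) \<le> B * l"
    using contour_integral_bound_linepath[OF i(1) B] contour_integral_bound_linepath[OF i(2) B]
      contour_integral_bound_linepath[OF i(3) B] contour_integral_bound_linepath[OF i(4) B] bound
    unfolding im n by auto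
  have "contour_integral (rectpath a b) f = contour_integral (linepath a c) f + (contour_integral (linepath c b) f
     + (contour_integral (linepath b d) f + contour_integral (linepath d a) f))"
    unfolding r using i by (simp add: contour_integrable_joinI)
  also have "norm \<dots> \<le> B * l + (B * l + (B * l + B * l))"
    using s by (intro norm_triangle_mono)
  finally show ?thesis by (simp add: mult_ac)
qed

text \<open>Lagrange interpolation of \<open>g / G\<close> at those zeros of \<open>Q\<close> that lie in a square, with the Hermite
  remainder. Writing the interpolant as a contour integral of the difference quotient of \<open>Q\<close> gives
  the remainder formula outside the square too, without any residue calculus.\<close>

lemma hermite_interpolation:
  fixes Q :: "complex poly" and g G :: "complex \<Rightarrow> complex" and H :: real
  assumes H: "0 < H" and g: "g holomorphic_on UNIV" and G: "G holomorphic_on UNIV"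
  defines "S \<equiv> cbox (Complex (-H) (-H)) (Complex H H)" and "\<gamma> \<equiv> rectpath (Complex (-H) (-H)) (Complex H H)"
  assumes G0: "\<And>w. w \<in> S \<Longrightarrow> G w \<noteq> 0" and Q0: "\<And>w. w \<in> path_image \<gamma> \<Longrightarrow> poly Q w \<noteq> 0"
  obtains q where "degree q \<le> degree Q - 1"
    "\<And>z. z \<notin> path_image \<gamma> \<Longrightarrow> poly q z * G z = (if z \<in> S then g z else 0)
       - contour_integral \<gamma> (\<lambda>w. g w / (poly Q w * G w) * (poly Q z * G z) / (w - z)) / (2 * of_real pi * \<i>)"
proof -
  define h where "h = (\<lambda>w. g w / (poly Q w * G w))"
  define P where "P = (\<lambda>k. contour_integral \<gamma> (\<lambda>w. h w * w ^ k) / (2 * of_real pi * \<i>))"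
  \<comment> \<open>The divided difference \<open>(poly Q w - poly Q z) / (w - z)\<close> expanded
    in powers of z: integration against h turns the powers of w into the moments \<open>P\<close>,
    and the degree in z is one below that of Q.\<close>
  define q where "q = (\<Sum>n\<le>degree Q. \<Sum>i<n. monom (coeff Q n * P (n - Suc i)) i)"
  have im: "path_image \<gamma> = S - box (Complex (-H) (-H)) (Complex H H)"
    unfolding \<gamma>_def S_def using H by (intro path_image_rectpath_cbox_minus_box) auto
  have vp: "valid_path \<gamma>" "pathfinish \<gamma> = pathstart \<gamma>" by (auto simp: \<gamma>_def)
  have cint: "f contour_integrable_on \<gamma>" if "continuous_on (path_image \<gamma>) f" for f
  proof -
    let ?c = "Complex H (-H)" and ?d = "Complex (-H) H"
    have r: "\<gamma> = linepath (Complex (-H) (-H)) ?c +++ linepath ?c (Complex H H) +++ linepath (Complex H H) ?d +++ linepath ?d (Complex (-H) (-H))"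
      by (simp add: rectpath_def \<gamma>_def Let_def)
    have pim: "path_image \<gamma> = closed_segment (Complex (-H) (-H)) ?c \<union> closed_segment ?c (Complex H H) \<union> closed_segment (Complex H H) ?d \<union> closed_segment ?d (Complex (-H) (-H))"
      unfolding r by (simp add: path_image_join Un_assoc)
    show ?thesis
      by (subst r, intro contour_integrable_joinI contour_integrable_continuous_linepath continuous_on_subset[OF that])
        (auto simp: pim)
  qed
  have gc: "continuous_on A g" and Gc: "continuous_on A G" for A
    using g G holomorphic_on_imp_continuous_on continuous_on_subset by blast+
  have hc: "continuous_on (path_image \<gamma>) h"
    unfolding h_def using Q0 G0 im by (intro continuous_intros gc Gc) auto
  have pq: "poly q z = contour_integral \<gamma> (\<lambda>w. h w * ((poly Q w - poly Q z) / (w - z))) / (2 * of_real pi * \<i>)"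
    if z: "z \<notin> path_image \<gamma>" for z
  proof -
    have "(poly Q w - poly Q z) / (w - z) = (\<Sum>n\<le>degree Q. \<Sum>i<n. coeff Q n * w ^ (n - Suc i) * z ^ i)"
      if "w \<in> path_image \<gamma>" for w
    proof -
      have wz: "w - z \<noteq> 0" using that z by auto
      have "poly Q w - poly Q z = (\<Sum>n\<le>degree Q. coeff Q n * (w ^ n - z ^ n))"
        by (simp add: poly_altdef sum_subtractf right_diff_distrib)
      also have "\<dots> = (\<Sum>n\<le>degree Q. coeff Q n * ((w - z) * (\<Sum>i<n. w ^ (n - Suc i) * z ^ i)))"
      proof (intro sum.cong refl arg_cong2[where f = "(*)"])
        fix n show "w ^ n - z ^ n = (w - z) * (\<Sum>i<n. w ^ (n - Suc i) * z ^ i)"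
          using power_diff_sumr2[of z n w] by (metis minus_diff_eq mult_minus_left)
      qed
      also have "\<dots> = (w - z) * (\<Sum>n\<le>degree Q. \<Sum>i<n. coeff Q n * w ^ (n - Suc i) * z ^ i)"
        by (simp add: sum_distrib_left mult_ac)
      finally show ?thesis using wz by simp
    qed
    then have "contour_integral \<gamma> (\<lambda>w. h w * ((poly Q w - poly Q z) / (w - z))) =
      contour_integral \<gamma> (\<lambda>w. \<Sum>n\<le>degree Q. \<Sum>i<n. (coeff Q n * z ^ i) * (h w * w ^ (n - Suc i)))"
      by (intro contour_integral_eq) (simp add: sum_distrib_left mult_ac)
    also have "\<dots> = (\<Sum>n\<le>degree Q. \<Sum>i<n. (coeff Q n * z ^ i) * contour_integral \<gamma> (\<lambda>w. h w * w ^ (n - Suc i)))"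
    proof -
      have 1: "(\<lambda>w. c * (h w * w ^ k)) contour_integrable_on \<gamma>" for c k
        by (intro cint continuous_intros hc)
      have 2: "(\<lambda>w. \<Sum>i<n. (coeff Q n * z ^ i) * (h w * w ^ (n - Suc i))) contour_integrable_on \<gamma>" for n
        by (intro cint continuous_intros hc)
      show ?thesis
        by (simp add: contour_integral_sum[OF _ 2] contour_integral_sum[OF _ 1] contour_integral_lmul[OF cint] continuous_intros hc)
    qed
    also have "\<dots> / (2 * of_real pi * \<i>) = poly q z"
      unfolding q_def poly_sum poly_monom P_def sum_divide_distrib by (intro sum.cong) (simp_all add: mult_ac)
    finally show ?thesis by simp
  qed
  have "degree q \<le> degree Q - 1"
    unfolding q_def by (intro degree_sum_le) (auto intro!: order_trans[OF degree_monom_le])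
  moreover have "poly q z * G z = (if z \<in> S then g z else 0)
       - contour_integral \<gamma> (\<lambda>w. g w / (poly Q w * G w) * (poly Q z * G z) / (w - z)) / (2 * of_real pi * \<i>)"
    if z: "z \<notin> path_image \<gamma>" for z
  proof -
    have wz: "w - z \<noteq> 0" if "w \<in> path_image \<gamma>" for w using that z by auto
    define f where "f = (\<lambda>w. g w / G w)"
    have fhol: "f holomorphic_on S" unfolding f_def using G0
      by (intro holomorphic_intros holomorphic_on_subset[OF g] holomorphic_on_subset[OF G]) auto
    have imS: "path_image \<gamma> \<subseteq> S" using im by auto
    have fc: "continuous_on (path_image \<gamma>) f"
      using fhol holomorphic_on_imp_continuous_on continuous_on_subset imS by blast
    have cS: "convex S" by (simp add: S_def)
    \<comment> \<open>Cauchy's formula inside the square and Cauchy's theorem outside, with the same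
      polynomial q in both cases.\<close>
    have c1: "((\<lambda>w. f w / (w - z)) has_contour_integral (2 * of_real pi * \<i> * (if z \<in> S then f z else 0))) \<gamma>"
    proof (cases "z \<in> S")
      case True
      then have zb: "z \<in> box (Complex (-H) (-H)) (Complex H H)" using z im by auto
      have "((\<lambda>w. f w / (w - z)) has_contour_integral (2*pi * \<i> * winding_number \<gamma> z * f z)) \<gamma>"
      proof (rule Cauchy_integral_formula_convex_simple[OF cS fhol _ vp(1) _ vp(2)])
        show "z \<in> interior S" unfolding S_def using zb by (simp add: interior_cbox)
        show "path_image \<gamma> \<subseteq> S - {z}" using imS z by auto
      qed
      moreover have "winding_number \<gamma> z = 1" unfolding \<gamma>_def by (rule winding_number_rectpath[OF zb])
      ultimately show ?thesis using True by simp
    next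
      case False
      have "(\<lambda>w. f w / (w - z)) holomorphic_on S" using False by (intro holomorphic_intros fhol) auto
      then show ?thesis using False Cauchy_theorem_convex_simple[OF _ cS vp(1) imS vp(2)] by simp
    qed
    have i1: "(\<lambda>w. f w / (w - z) * G z) contour_integrable_on \<gamma>"
      using wz by (intro cint continuous_intros fc) auto
    have i2: "(\<lambda>w. h w * (poly Q z * G z) / (w - z)) contour_integrable_on \<gamma>"
      using wz by (intro cint continuous_intros hc) auto
    have i3: "(\<lambda>w. h w * ((poly Q w - poly Q z) / (w - z))) contour_integrable_on \<gamma>"
      using wz by (intro cint continuous_intros hc) auto
    have "contour_integral \<gamma> (\<lambda>w. h w * ((poly Q w - poly Q z) / (w - z))) * G z =
      contour_integral \<gamma> (\<lambda>w. h w * ((poly Q w - poly Q z) / (w - z)) * G z)"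
      by (rule contour_integral_rmul[OF i3, symmetric])
    also have "\<dots> = contour_integral \<gamma> (\<lambda>w. f w / (w - z) * G z - h w * (poly Q z * G z) / (w - z))"
    proof (rule contour_integral_eq)
      fix w assume w: "w \<in> path_image \<gamma>"
      have "h w * poly Q w = f w" using Q0[OF w] by (simp add: h_def f_def)
      moreover have "h w * ((poly Q w - poly Q z) / (w - z)) * G z = (h w * poly Q w) / (w - z) * G z - h w * (poly Q z * G z) / (w - z)"
        by (simp add: diff_divide_distrib right_diff_distrib left_diff_distrib)
      ultimately show "h w * ((poly Q w - poly Q z) / (w - z)) * G z = f w / (w - z) * G z - h w * (poly Q z * G z) / (w - z)"
        by simp
    qed
    also have "\<dots> = contour_integral \<gamma> (\<lambda>w. f w / (w - z) * G z) - contour_integral \<gamma> (\<lambda>w. h w * (poly Q z * G z) / (w - z))"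
      by (rule contour_integral_diff[OF i1 i2])
    also have "contour_integral \<gamma> (\<lambda>w. f w / (w - z) * G z) = (2 * of_real pi * \<i> * (if z \<in> S then f z else 0)) * G z"
      by (intro contour_integral_unique has_contour_integral_rmul c1)
    finally have eq: "contour_integral \<gamma> (\<lambda>w. h w * ((poly Q w - poly Q z) / (w - z))) * G z =
      2 * of_real pi * \<i> * (if z \<in> S then g z else 0) - contour_integral \<gamma> (\<lambda>w. h w * (poly Q z * G z) / (w - z))"
      using G0[of z] by (auto simp: f_def)
    have "poly q z * G z = contour_integral \<gamma> (\<lambda>w. h w * ((poly Q w - poly Q z) / (w - z))) * G z / (2 * of_real pi * \<i>)"
      unfolding pq[OF z] by simp
    also have "\<dots> = (2 * of_real pi * \<i> * (if z \<in> S then g z else 0) -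
        contour_integral \<gamma> (\<lambda>w. h w * (poly Q z * G z) / (w - z))) / (2 * of_real pi * \<i>)"
      by (simp only: eq)
    also have "\<dots> = (if z \<in> S then g z else 0) - contour_integral \<gamma> (\<lambda>w. h w * (poly Q z * G z) / (w - z)) / (2 * of_real pi * \<i>)"
      unfolding diff_divide_distrib by simp
    finally show ?thesis unfolding h_def .
  qed
  ultimately show ?thesis by (rule that)
qed

section \<open>The complex cardinal sine and the node polynomial\<close>

definition csinc :: "complex \<Rightarrow> complex" where "csinc z = (if z = 0 then 1 else sin z / z)"

lemma csinc_holomorphic: "csinc holomorphic_on UNIV"
proof -
  have "(\<lambda>z. if z = 0 then deriv sin 0 else (sin z - sin 0) / (z - 0)) holomorphic_on (UNIV :: complex set)"
    by (rule pole_lemma_open) (auto intro: holomorphic_intros)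
  moreover have "deriv sin (0::complex) = 1" using DERIV_imp_deriv[OF DERIV_sin[of "0::complex"]] by simp
  ultimately show ?thesis by (simp add: csinc_def[abs_def] cong: if_cong)
qed

lemma csinc_of_real: "csinc (of_real t) = of_real (sinc t)"
  by (simp add: csinc_def sin_of_real[symmetric])

lemma norm_csinc_le: "norm (csinc z) \<le> exp \<bar>Im z\<bar>"
  using norm_sin_le_mult_exp[of z] by (auto simp: csinc_def norm_divide divide_le_eq mult.commute)

lemma abs_sinc_le_1: "\<bar>sinc x\<bar> \<le> 1"
  using norm_csinc_le[of "of_real x"] by (simp add: csinc_of_real)

context points
begin

definition node_poly :: "real \<Rightarrow> nat \<Rightarrow> complex poly" where
  "node_poly \<rho> m = [:0, of_real (1 / \<rho>):] * (\<Prod>j\<in>shell 0 (int m). [:1, - of_real (1 / (\<rho> * real_of_int j)):])"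

lemma poly_node_poly: "poly (node_poly \<rho> m) w = sin_prod (int m) (w / of_real \<rho>)"
  by (simp add: node_poly_def sin_prod_def poly_prod mult.commute)

lemma degree_node_poly: "degree (node_poly \<rho> m) \<le> 2 * m + 1"
proof -
  have "degree (\<Prod>j\<in>shell 0 (int m). [:1, - of_real (1 / (\<rho> * real_of_int j)) :: complex:])
     \<le> sum (degree \<circ> (\<lambda>j. [:1, - of_real (1 / (\<rho> * real_of_int j)) :: complex:])) (shell 0 (int m))"
    by (rule degree_prod_sum_le) simp
  also have "\<dots> \<le> (\<Sum>j\<in>shell 0 (int m). 1)" by (intro sum_mono) (simp add: degree_pCons_le[THEN order_trans])
  also have "\<dots> \<le> 2 * m"
  proof -
    have "card (shell 0 (int m)) \<le> card ({-int m..int m} - {0})"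
      by (rule card_mono) (auto simp: shell_def)
    then show ?thesis by simp
  qed
  finally have 1: "degree (\<Prod>j\<in>shell 0 (int m). [:1, - of_real (1 / (\<rho> * real_of_int j)) :: complex:]) \<le> 2 * m" .
  have "degree (node_poly \<rho> m) \<le> degree [:0, of_real (1 / \<rho>) :: complex:] +
     degree (\<Prod>j\<in>shell 0 (int m). [:1, - of_real (1 / (\<rho> * real_of_int j)) :: complex:])"
    unfolding node_poly_def by (rule degree_mult_le)
  also have "\<dots> \<le> 1 + 2 * m" by (intro add_mono 1) (simp add: degree_pCons_le[THEN order_trans])
  finally show ?thesis by simp
qed

text \<open>The counterpart of \<open>growth_at_nodes\<close> with spacing 1 + \<eta>: the division
  pulls \<open>r j\<close> inside j, the direction required by \<open>nodal_product_bounds\<close>.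
  Taking m = min a b - 1 instead of min a b keeps two degrees free below
  \<open>card (inner R)\<close>, for the quadratic factor in \<open>lower_pointwise\<close>.\<close>

lemma node_poly_bounds:
  assumes e: "0 < \<eta>" "\<eta> \<le> 1/10" and R: "threshold \<eta> \<le> R" and reg: "regular (tol \<eta>) R a b"
    and sum: "\<bar>\<Sum>n\<in>outer R M. 1 / p n\<bar> < tol \<eta>"
    and M: "a \<le> int M" "b \<le> int M" "4 * R\<^sup>2 \<le> real M"
  defines "m \<equiv> nat (min a b - 1)" and "\<rho> \<equiv> 1 + \<eta>"
  shows "2 * m + 3 \<le> card (inner R)"
    and "\<lbrakk>norm w \<le> R / 5; Re w = \<rho> * (real_of_int K + 1/2) \<or> \<rho> \<le> \<bar>Im w\<bar>\<rbrakk> \<Longrightarrow>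
      exp (pi * \<bar>Im w\<bar> / \<rho> - 8 * \<eta> * R) \<le> 8 * pi * norm (poly (node_poly \<rho> m) w * ctrunc R M w)"
    and "\<bar>z\<bar> \<le> R \<Longrightarrow> norm (poly (node_poly \<rho> m) (of_real z) * ctrunc R M (of_real z)) \<le> exp (2 * \<eta> * R)"
proof -
  note pb = parameter_bounds[OF e R]
  define I where "I = outer R M"
  define r where "r = (\<lambda>j. p j / \<rho>)"
  define c where "c = \<eta> / 3"
  have rho: "1 < \<rho>" "\<rho> \<le> 11/10" using e by (auto simp: \<rho>_def)
  have t: "tol \<eta> \<le> \<eta> / 8" "tol \<eta> \<le> 1/80" "0 < tol \<eta>" using pb e by linarith+
  have ab: "(1 - tol \<eta>) * R \<le> real_of_int a" "real_of_int a \<le> (1 + tol \<eta>) * R"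
     "(1 - tol \<eta>) * R \<le> real_of_int b" "real_of_int b \<le> (1 + tol \<eta>) * R" "inner R = {-a..b}"
    using reg by (auto simp: regular_def)
  have half: "79 / 80 * R \<le> (1 - tol \<eta>) * R" using t pb by (intro mult_right_mono) auto
  have ab1: "2 \<le> a" "2 \<le> b"
  proof -
    have "2 \<le> real_of_int a" "2 \<le> real_of_int b" using ab half pb by linarith+
    then show "2 \<le> a" "2 \<le> b" by simp_all
  qed
  have m: "int m = min a b - 1" using ab1 by (simp add: m_def)
  have mr: "real m = real_of_int (min a b) - 1" using m by (metis of_int_of_nat_eq of_int_diff of_int_1)
  have mlow: "R / 2 \<le> real m"
  proof -
    have "real m = min (real_of_int a) (real_of_int b) - 1" using mr by (simp add: of_int_min)
    then show ?thesis using ab(1,3) half pb(4) by linarith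
  qed
  show "2 * m + 3 \<le> card (inner R)" unfolding ab(5) using m ab1 by (simp add: min_def split: if_splits)
  have fI: "finite I" by (simp add: I_def)
  have R8: "8 \<le> R" using pb by linarith
  have far: "R / 2 \<le> \<bar>real_of_int j\<bar>" if "j \<in> I" for j
    using outer_far(1)[OF reg that[unfolded I_def]] half pb(4) by linarith
  have mM: "m \<le> M" using M m by linarith
  have pj: "\<bar>p j - real_of_int j\<bar> \<le> \<eta> / 8 * \<bar>real_of_int j\<bar>" if j: "j \<in> I" for j
    using outer_far(2)[OF reg, of j M] j mult_right_mono[OF t(1), of "\<bar>real_of_int j\<bar>"] by (simp add: I_def)
  have rnear: "\<bar>r j - real_of_int j\<bar> \<le> 2 * \<eta> * \<bar>real_of_int j\<bar>" if j: "j \<in> I" for j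
  proof -
    have "r j - real_of_int j = (p j - real_of_int j - \<eta> * real_of_int j) / \<rho>"
      using rho by (simp add: r_def field_simps \<rho>_def)
    then have "\<bar>r j - real_of_int j\<bar> = \<bar>p j - real_of_int j - \<eta> * real_of_int j\<bar> / \<rho>" using rho by simp
    also have "\<dots> \<le> (\<eta> / 8 * \<bar>real_of_int j\<bar> + \<eta> * \<bar>real_of_int j\<bar>) / 1"
    proof (rule frac_le)
      have "\<bar>\<eta> * real_of_int j\<bar> = \<eta> * \<bar>real_of_int j\<bar>" using e by (simp add: abs_mult)
      then show "\<bar>p j - real_of_int j - \<eta> * real_of_int j\<bar> \<le> \<eta> / 8 * \<bar>real_of_int j\<bar> + \<eta> * \<bar>real_of_int j\<bar>"
        using pj[OF j] by linarith
    qed (use rho e in auto)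
    also have "\<dots> \<le> 2 * \<eta> * \<bar>real_of_int j\<bar>" using e by (simp add: field_simps)
    finally show ?thesis .
  qed
  have sumr: "\<bar>\<Sum>j\<in>I. 1 / r j\<bar> \<le> \<eta>"
  proof -
    have "(\<Sum>j\<in>I. 1 / r j) = \<rho> * (\<Sum>j\<in>I. 1 / p j)" by (simp add: r_def sum_distrib_left)
    then have "\<bar>\<Sum>j\<in>I. 1 / r j\<bar> \<le> 2 * tol \<eta>"
      unfolding I_def using sum rho by (simp only: abs_mult) (intro mult_mono, auto)
    then show ?thesis using t e by linarith
  qed
  have sub: "I \<subseteq> shell (int m) (int M)"
  proof
    fix j assume j: "j \<in> I"
    have "- a > j \<or> j > b" "\<bar>j\<bar> \<le> int M" using outer_far(4,5)[OF reg, of j M] j by (auto simp: I_def)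
    then show "j \<in> shell (int m) (int M)" using m ab1 by (auto simp: shell_def)
  qed
  have c: "0 < c" "c \<le> 1" using e by (auto simp: c_def)
  \<comment> \<open>A shell index missing from I is an inner index beyond m, so its modulus lies
    between min a b and max a b.\<close>
  have shell_I: "(1 - tol \<eta>) * R \<le> \<bar>real_of_int n\<bar> \<and> \<bar>real_of_int n\<bar> \<le> (1 + tol \<eta>) * R"
    if n: "n \<in> shell m M - I" for n
  proof -
    have "n \<in> {-a..b}" "int m < \<bar>n\<bar>" using n ab(5) by (auto simp: shell_def I_def outer_def)
    then have "\<bar>n\<bar> \<le> a \<or> \<bar>n\<bar> \<le> b" "a \<le> \<bar>n\<bar> \<or> b \<le> \<bar>n\<bar>" using m by auto
    then have "\<bar>real_of_int n\<bar> \<le> real_of_int a \<or> \<bar>real_of_int n\<bar> \<le> real_of_int b"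
       "real_of_int a \<le> \<bar>real_of_int n\<bar> \<or> real_of_int b \<le> \<bar>real_of_int n\<bar>" by linarith+
    then show ?thesis using ab by linarith
  qed
  have card: "real (card (shell m M - I)) * (1 - ln c) \<le> \<eta> * R"
  proof -
    have AB: "(1 - tol \<eta>) * R \<le> (1 + tol \<eta>) * R" using t pb by (intro mult_right_mono) auto
    have "shell m M - I \<subseteq> {n. (1 - tol \<eta>) * R \<le> \<bar>real_of_int n\<bar> \<and> \<bar>real_of_int n\<bar> \<le> (1 + tol \<eta>) * R}"
      using shell_I by blast
    from card_mono[OF card_int_annulus_le(1)[OF AB] this]
    have "real (card (shell m M - I)) \<le> 2 * ((1 + tol \<eta>) * R - (1 - tol \<eta>) * R + 1)"
      using card_int_annulus_le(2)[OF AB] by linarith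
    also have "\<dots> \<le> 4 * tol \<eta> * R + 8" by (simp add: algebra_simps)
    finally have "real (card (shell m M - I)) * (1 - ln c) \<le> (4 * tol \<eta> * R + 8) * (1 - ln c)"
      using pb(1) by (intro mult_right_mono) (auto simp: c_def)
    then show ?thesis using pb(6) by (simp add: c_def)
  qed
  have r1: "\<bar>r j\<bar> \<le> \<bar>real_of_int j\<bar> \<and> 0 \<le> r j * real_of_int j" if j: "j \<in> I" for j
  proof -
    have "\<bar>p j\<bar> \<le> \<bar>real_of_int j\<bar> + \<eta> / 8 * \<bar>real_of_int j\<bar>" using pj[OF j] by linarith
    also have "\<dots> \<le> \<bar>real_of_int j\<bar> + \<eta> * \<bar>real_of_int j\<bar>" using e by (intro add_left_mono mult_right_mono) auto
    finally have "\<bar>p j\<bar> \<le> \<rho> * \<bar>real_of_int j\<bar>" by (simp add: \<rho>_def algebra_simps)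
    then have "\<bar>r j\<bar> \<le> \<bar>real_of_int j\<bar>" using rho by (simp add: r_def abs_divide divide_le_eq mult.commute)
    moreover have "0 \<le> p j * real_of_int j"
    proof -
      have "\<eta> / 8 * \<bar>real_of_int j\<bar> \<le> 1 * \<bar>real_of_int j\<bar>" using e by (intro mult_right_mono) auto
      then have "\<bar>p j - real_of_int j\<bar> \<le> \<bar>real_of_int j\<bar>" using pj[OF j] by linarith
      then have "0 \<le> p j \<and> 0 \<le> real_of_int j \<or> p j \<le> 0 \<and> real_of_int j \<le> 0" by linarith
      then show ?thesis by (auto simp: zero_le_mult_iff)
    qed
    ultimately show ?thesis using rho by (simp add: r_def)
  qed
  note nb = nodal_product_bounds[OF fI R8 e far mlow mM M(3) rnear sumr sub c card r1]
  have ct: "norm (ctrunc R M w) = (\<Prod>j\<in>I. norm (1 - (w / of_real \<rho>) / of_real (r j)))" for w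
    unfolding ctrunc_def I_def[symmetric] prod_norm[symmetric] using rho by (simp add: r_def)
  {
    assume w: "norm w \<le> R / 5" "Re w = \<rho> * (real_of_int K + 1/2) \<or> \<rho> \<le> \<bar>Im w\<bar>"
    have "norm (w / of_real \<rho>) \<le> R / 5 / 1" unfolding norm_divide using w rho pb(4) by (intro frac_le) auto
    then have n4: "norm (w / of_real \<rho>) \<le> R / 4" using pb by simp
    have d: "Re (w / of_real \<rho>) = real_of_int K + 1/2 \<or> 1 \<le> \<bar>Im (w / of_real \<rho>)\<bar>"
      using w(2) rho by (auto simp: Re_divide_of_real Im_divide_of_real abs_divide le_divide_eq)
    show "exp (pi * \<bar>Im w\<bar> / \<rho> - 8 * \<eta> * R) \<le> 8 * pi * norm (poly (node_poly \<rho> m) w * ctrunc R M w)"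
    proof -
      have "exp (pi * \<bar>Im (w / of_real \<rho>)\<bar> - 8 * \<eta> * R)
          \<le> 8 * pi * (norm (sin_prod (int m) (w / of_real \<rho>)) * (\<Prod>j\<in>I. norm (1 - (w / of_real \<rho>) / of_real (r j))))"
        by (rule nb(1)[OF _ _ _ n4 d])
      then show ?thesis using rho unfolding norm_mult ct poly_node_poly by (simp add: Im_divide_of_real abs_divide)
    qed
  }
  {
    assume z: "\<bar>z\<bar> \<le> R"
    have zr: "\<bar>z / \<rho>\<bar> \<le> R"
    proof -
      have "\<bar>z / \<rho>\<bar> \<le> R / 1" unfolding abs_divide using z rho pb(4) by (intro frac_le) auto
      then show ?thesis by simp
    qed
    have zI: "\<bar>z / \<rho>\<bar> < \<bar>r j\<bar>" if "j \<in> I" for j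
      using outer_far(3)[OF reg, of j M] that z rho by (simp add: I_def r_def abs_divide divide_strict_right_mono)
    have zS: "\<bar>z / \<rho>\<bar> \<le> (1 - c) * \<bar>real_of_int j\<bar>" if j: "j \<in> shell m M - I" for j
    proof -
      \<comment> \<open>Here \<eta>/3 is the margin c and \<eta>/8 bounds \<open>tol \<eta>\<close>;
        the spacing 1 + \<eta> outweighs both.\<close>
      have "1 \<le> (1 - \<eta> / 3) * (1 - \<eta> / 8) * \<rho>"
      proof -
        have "1 - 11 / 24 * \<eta> \<le> (1 - \<eta> / 3) * (1 - \<eta> / 8)" using e by (simp add: algebra_simps)
        then have "(1 - 11 / 24 * \<eta>) * \<rho> \<le> (1 - \<eta> / 3) * (1 - \<eta> / 8) * \<rho>" using rho by (intro mult_right_mono) auto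
        moreover have "(1 - 11 / 24 * \<eta>) * \<rho> = 1 + \<eta> * (13 / 24 - 11 / 24 * \<eta>)" by (simp add: \<rho>_def field_simps)
        moreover have "0 \<le> \<eta> * (13 / 24 - 11 / 24 * \<eta>)" using e by (intro mult_nonneg_nonneg) auto
        ultimately show ?thesis by linarith
      qed
      then have "1 * R \<le> (1 - \<eta> / 3) * (1 - \<eta> / 8) * \<rho> * R" using pb by (intro mult_right_mono) auto
      then have "\<bar>z\<bar> \<le> (1 - \<eta> / 3) * ((1 - \<eta> / 8) * R) * \<rho>" using z by (simp add: mult_ac)
      also have "\<dots> \<le> (1 - \<eta> / 3) * \<bar>real_of_int j\<bar> * \<rho>"
      proof (intro mult_right_mono mult_left_mono)
        have "(1 - \<eta> / 8) * R \<le> (1 - tol \<eta>) * R" using t pb by (intro mult_right_mono) auto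
        then show "(1 - \<eta> / 8) * R \<le> \<bar>real_of_int j\<bar>" using shell_I[OF j] by linarith
      qed (use e rho in auto)
      finally show ?thesis using rho by (simp add: abs_divide divide_le_eq c_def)
    qed
    have cz: "norm (ctrunc R M (of_real z)) = (\<Prod>j\<in>I. 1 - (z / \<rho>) / r j)"
    proof -
      have "(\<Prod>j\<in>I. 1 - (z / \<rho>) / r j) = (\<Prod>j\<in>I. 1 - z / p j)" using rho by (simp add: r_def)
      moreover have "0 < (\<Prod>j\<in>I. 1 - z / p j)"
        by (rule prod_pos) (use factor_pos[OF _ z] in \<open>auto simp: I_def outer_def\<close>)
      ultimately show ?thesis by (simp only: ctrunc_of_real trunc_def I_def[symmetric] norm_of_real abs_of_pos)
    qed
    show "norm (poly (node_poly \<rho> m) (of_real z) * ctrunc R M (of_real z)) \<le> exp (2 * \<eta> * R)"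
    proof -
      have "norm (sin_prod (int m) (of_real (z / \<rho>))) * (\<Prod>j\<in>I. 1 - (z / \<rho>) / r j) \<le> exp (2 * \<eta> * R)"
        by (rule nb(2)[OF _ _ _ zr zI zS])
      then show ?thesis unfolding norm_mult cz poly_node_poly by simp
    qed
  }
qed

end

lemma poly_map_Re: "poly (map_poly Re q) t = Re (poly q (of_real t))"
  by (induction q) (auto simp: map_poly_pCons)

context points
begin

lemma ctrunc_nonzero:
  assumes "norm w < R"
  shows "ctrunc R M w \<noteq> 0"
proof -
  have "1 - w / of_real (p n) \<noteq> 0" if "n \<in> outer R M" for n
  proof -
    have "R < \<bar>p n\<bar>" using that by (auto simp: outer_def inner_def)
    then show ?thesis using norm_one_minus_pos[of w "p n"] assms by auto
  qed
  then show ?thesis unfolding ctrunc_def by (simp only: prod_zero_iff[OF finite_outer]) blast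
qed

text \<open>The contour crosses the real axis at \<open>\<plusminus>H\<close>; the factor \<open>1 - t\<^sup>2 / H\<^sup>2\<close> cancels the singularity of the Cauchy
  kernel there. The constant in \<open>\<eta>\<close> makes the Gaussian decay dominate the loss in the comparison of products.\<close>

lemma lower_pointwise:
  assumes \<kappa>: "0 < \<kappa>" "\<kappa> \<le> 1" and eta: "\<eta> = \<kappa> / 20000" and R: "threshold \<eta> \<le> R" and reg: "regular (tol \<eta>) R a b"
    and sum: "\<bar>\<Sum>n\<in>outer R M. 1 / p n\<bar> < tol \<eta>"
    and M: "a \<le> int M" "b \<le> int M" "4 * R\<^sup>2 \<le> real M"
    and y: "\<bar>y\<bar> \<le> R / 80"
  defines "\<tau> \<equiv> pi * (1 - \<kappa>)"
  obtains q H where "R / 10 \<le> H" "H \<le> R / 8" "degree q < card (inner R)"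
    "\<And>t. \<bar>t\<bar> \<le> R \<Longrightarrow> \<bar>t\<bar> \<noteq> H \<Longrightarrow> \<bar>poly q t * trunc R M t -
       (if \<bar>t\<bar> < H then (1 - t\<^sup>2 / H\<^sup>2) * (sinc (\<tau> * (t - y)) * exp (- \<kappa> * (t - y)\<^sup>2 / R)) else 0)\<bar> \<le> 3232 * exp (- \<kappa> * R / 400)"
proof -
  have e: "0 < \<eta>" "\<eta> \<le> 1/10" using \<kappa> by (auto simp: eta)
  note pb = parameter_bounds[OF e R]
  define m where "m = nat (min a b - 1)"
  define \<rho> where "\<rho> = 1 + \<eta>"
  have rho: "1 < \<rho>" "\<rho> \<le> 11/10" using e by (auto simp: \<rho>_def)
  define Q where "Q = node_poly \<rho> m"
  note nb = node_poly_bounds[OF e R reg sum M, folded m_def \<rho>_def, folded Q_def]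
  \<comment> \<open>The vertical sides of the square pass halfway between nodes, where the sine is
    large; R / 9 places H between R / 10 and R / 8.\<close>
  define K where "K = \<lfloor>R / 9\<rfloor>"
  define H where "H = \<rho> * (real_of_int K + 1/2)"
  have K: "R / 9 - 1 < real_of_int K" "real_of_int K \<le> R / 9" unfolding K_def by linarith+
  have K9: "R - 9 \<le> 9 * real_of_int K" using K(1) by simp
  have H: "R / 10 \<le> H" "H \<le> R / 8"
  proof -
    have "1 * (real_of_int K + 1/2) \<le> H" unfolding H_def using rho K pb by (intro mult_right_mono) auto
    then have "9 * real_of_int K + 9/2 \<le> 9 * H" by simp
    then have "10 * R \<le> 100 * H" using K9 pb(4) by linarith
    then show "R / 10 \<le> H" by simp
    have "H \<le> 101/100 * (R / 9 + 1/2)"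
      unfolding H_def \<rho>_def using K \<kappa> pb by (intro mult_mono) (auto simp: eta)
    also have "\<dots> \<le> R / 8" using pb(4) by (simp add: field_simps)
    finally show "H \<le> R / 8" .
  qed
  have H0: "0 < H" using H pb by linarith
  have tau: "0 \<le> \<tau>" using \<kappa> by (simp add: \<tau>_def)
  define g where "g = (\<lambda>w. csinc (of_real \<tau> * (w - of_real y)) * exp (- of_real \<kappa> * (w - of_real y)\<^sup>2 / of_real R))"
  define S where "S = cbox (Complex (-H) (-H)) (Complex H H)"
  define \<gamma> where "\<gamma> = rectpath (Complex (-H) (-H)) (Complex H H)"
  have gh: "g holomorphic_on UNIV"
  proof -
    have "(csinc \<circ> (\<lambda>w. of_real \<tau> * (w - of_real y))) holomorphic_on UNIV"
      by (rule holomorphic_on_compose_gen[OF _ csinc_holomorphic]) (auto intro!: holomorphic_intros)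
    then show ?thesis unfolding g_def o_def by (intro holomorphic_intros) (use pb in auto)
  qed
  have S: "w \<in> S \<longleftrightarrow> \<bar>Re w\<bar> \<le> H \<and> \<bar>Im w\<bar> \<le> H" for w
    by (auto simp: S_def in_cbox_complex_iff abs_le_iff)
  have im: "w \<in> path_image \<gamma> \<longleftrightarrow> (\<bar>Re w\<bar> = H \<or> \<bar>Im w\<bar> = H) \<and> \<bar>Re w\<bar> \<le> H \<and> \<bar>Im w\<bar> \<le> H" for w
    unfolding \<gamma>_def using H0 by (subst path_image_rectpath_cbox_minus_box)
      (auto simp: in_cbox_complex_iff in_box_complex_iff abs_if)
  have small: "norm w \<le> R / 5" if "\<bar>Re w\<bar> \<le> H" "\<bar>Im w\<bar> \<le> H" for w
    by (rule norm_le_of_square) (use that H pb in auto)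
  have G0: "ctrunc R M w \<noteq> 0" if "w \<in> S" for w
    by (rule ctrunc_nonzero) (use small[of w] that pb in \<open>auto simp: S\<close>)
  have low: "exp (pi * \<bar>Im w\<bar> / \<rho> - 8 * \<eta> * R) \<le> 8 * pi * norm (poly Q w * ctrunc R M w)" if w: "w \<in> path_image \<gamma>" for w
  proof -
    have n: "norm w \<le> R / 5" by (rule small) (use w im in auto)
    consider "Re w = H" | "Re w = - H" | "\<bar>Im w\<bar> = H" using w im by (auto simp: abs_if split: if_splits)
    then show ?thesis
    proof cases
      case 1
      then show ?thesis by (intro nb(2)[of w K] n) (simp add: H_def)
    next
      case 2
      then show ?thesis by (intro nb(2)[of w "- K - 1"] n) (simp add: H_def algebra_simps)
    next
      case 3
      then have "\<rho> \<le> \<bar>Im w\<bar>" using H pb rho by linarith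
      then show ?thesis by (intro nb(2)[of w K] n) simp
    qed
  qed
  have Q0: "poly Q w \<noteq> 0" if "w \<in> path_image \<gamma>" for w
  proof
    assume "poly Q w = 0"
    then have "exp (pi * \<bar>Im w\<bar> / \<rho> - 8 * \<eta> * R) \<le> 0" using low[OF that] by simp
    then show False by simp
  qed
  obtain q1 where q1: "degree q1 \<le> degree Q - 1"
    "\<And>z. z \<notin> path_image \<gamma> \<Longrightarrow> poly q1 z * ctrunc R M z = (if z \<in> S then g z else 0)
       - contour_integral \<gamma> (\<lambda>w. g w / (poly Q w * ctrunc R M w) * (poly Q z * ctrunc R M z) / (w - z)) / (2 * of_real pi * \<i>)"
  proof (rule hermite_interpolation[OF H0 gh ctrunc_holomorphic, of R M Q, folded S_def \<gamma>_def])
    show "ctrunc R M w \<noteq> 0" if "w \<in> S" for w using that by (rule G0)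
    show "poly Q w \<noteq> 0" if "w \<in> path_image \<gamma>" for w using that by (rule Q0)
  qed (rule that)
  define h where "h = (\<lambda>w. g w / (poly Q w * ctrunc R M w))"
  \<comment> \<open>The type pi (1 - \<kappa>) of the cardinal sine in g is below pi / (1 + \<eta>)
    by at least \<kappa>; this slack and the Gaussian make h small on the contour.\<close>
  have hbound: "norm (h w) \<le> 8 * pi * exp (- \<kappa> * R / 200 + 8 * \<eta> * R)" if w: "w \<in> path_image \<gamma>" for w
  proof -
    define Y where "Y = \<bar>Im w\<bar>"
    define G where "G = - \<kappa> * ((Re w - y)\<^sup>2 - (Im w)\<^sup>2) / R"
    have ne: "0 < norm (poly Q w * ctrunc R M w)" using Q0[OF w] G0[of w] w im S by auto
    have "norm (g w) \<le> exp (\<tau> * Y) * exp G"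
      unfolding g_def norm_mult norm_gauss G_def
      using norm_csinc_le[of "of_real \<tau> * (w - of_real y)"] tau by (intro mult_right_mono) (auto simp: Y_def abs_mult)
    also have "\<dots> = exp (\<tau> * Y + G)" by (simp add: exp_add)
    also have "\<dots> \<le> exp (- \<kappa> * R / 200 + 8 * \<eta> * R) * exp (pi * Y / \<rho> - 8 * \<eta> * R)"
    proof -
      have "(\<tau> + \<kappa>) * Y \<le> pi / \<rho> * Y"
      proof (rule mult_right_mono)
        have "pi * (1 - \<eta>) * \<rho> \<le> pi * 1"
        proof -
          have "(1 - \<eta>) * \<rho> \<le> 1" using e by (simp add: \<rho>_def algebra_simps)
          then show ?thesis unfolding mult.assoc by (intro mult_left_mono) auto
        qed
        then have "pi * (1 - \<eta>) \<le> pi / \<rho>" using rho by (simp add: le_divide_eq)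
        moreover have "\<kappa> \<le> pi * (\<kappa> - \<eta>)"
        proof -
          have "2 * (\<kappa> / 2) \<le> pi * (\<kappa> - \<eta>)" using pi_ge_two \<kappa> by (intro mult_mono) (auto simp: eta)
          then show ?thesis by simp
        qed
        ultimately show "\<tau> + \<kappa> \<le> pi / \<rho>" by (simp add: \<tau>_def algebra_simps)
      qed (simp add: Y_def)
      then have "\<tau> * Y + \<kappa> * Y \<le> pi * Y / \<rho>" by (simp add: distrib_right)
      moreover have "- \<kappa> * Y + G \<le> - \<kappa> * R / 200"
      proof -
        have "- \<kappa> * \<bar>Im w\<bar> - \<kappa> * ((Re w - y)\<^sup>2 - (Im w)\<^sup>2) / R \<le> - \<kappa> * R / 200"
          by (rule gauss_exponent_bound[of _ _ H]) (use \<kappa> pb(4) H y w im in auto)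
        then show ?thesis by (simp add: Y_def G_def)
      qed
      ultimately show ?thesis by (simp add: exp_add[symmetric])
    qed
    also have "\<dots> \<le> exp (- \<kappa> * R / 200 + 8 * \<eta> * R) * (8 * pi * norm (poly Q w * ctrunc R M w))"
      using low[OF w] by (intro mult_left_mono) (auto simp: Y_def)
    finally have "norm (g w) / norm (poly Q w * ctrunc R M w) \<le> exp (- \<kappa> * R / 200 + 8 * \<eta> * R) * (8 * pi)"
      using ne by (simp add: pos_divide_le_eq mult_ac)
    then show ?thesis by (simp add: h_def norm_divide mult_ac)
  qed
  have err: "\<bar>1 - t\<^sup>2 / H\<^sup>2\<bar> * norm (contour_integral \<gamma> (\<lambda>w. h w * (poly Q (of_real t) * ctrunc R M (of_real t)) / (w - of_real t)) / (2 * of_real pi * \<i>))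
      \<le> 3232 * exp (- \<kappa> * R / 400)" if t: "\<bar>t\<bar> \<le> R" "\<bar>t\<bar> \<noteq> H" for t
  proof -
    \<comment> \<open>A lower bound for the distance from t to the contour, proportional to |1 - t^2
      / H^2|, so that this factor cancels 1 / \<mu>. The 101 is a crude consequence of |t| \<le> 10
      H. With four sides of length 2 H, the constant 8 pi in the bound for h and the division by 2
      pi it makes 3232 = 101 * 32.\<close>
    define \<mu> where "\<mu> = \<bar>H\<^sup>2 - t\<^sup>2\<bar> / (101 * H)"
    have "t\<^sup>2 \<noteq> H\<^sup>2" using t(2) H0 by (auto simp: power2_eq_iff abs_if split: if_splits)
    then have mu0: "0 < \<mu>" using H0 by (simp add: \<mu>_def)
    have t10: "\<bar>t\<bar> \<le> 10 * H" using t H by linarith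
    have dist: "\<mu> \<le> norm (w - of_real t)" if w: "w \<in> path_image \<gamma>" for w
    proof -
      have fac: "\<bar>H\<^sup>2 - t\<^sup>2\<bar> = \<bar>H - t\<bar> * \<bar>H + t\<bar>" by (simp add: abs_mult[symmetric] power2_eq_square algebra_simps)
      have v: "\<mu> \<le> \<bar>H - t\<bar>" "\<mu> \<le> \<bar>H + t\<bar>"
      proof -
        have "\<bar>H - t\<bar> * \<bar>H + t\<bar> \<le> \<bar>H - t\<bar> * (101 * H)" "\<bar>H - t\<bar> * \<bar>H + t\<bar> \<le> (101 * H) * \<bar>H + t\<bar>"
          using t10 H0 by (auto intro!: mult_left_mono mult_right_mono)
        then show "\<mu> \<le> \<bar>H - t\<bar>" "\<mu> \<le> \<bar>H + t\<bar>" unfolding \<mu>_def fac using H0 by (auto simp: divide_le_eq mult_ac)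
      qed
      have hz: "\<mu> \<le> H"
      proof -
        have "t\<^sup>2 \<le> 100 * H\<^sup>2" using power_mono[OF t10 abs_ge_zero, of 2] by (simp add: power_mult_distrib)
        then have "\<bar>H\<^sup>2 - t\<^sup>2\<bar> \<le> 101 * H\<^sup>2"
          using zero_le_power2[of t] zero_le_power2[of H] unfolding abs_le_iff by linarith
        then show ?thesis unfolding \<mu>_def using H0 by (simp add: divide_le_eq power2_eq_square mult_ac)
      qed
      consider "Re w = H" | "Re w = - H" | "\<bar>Im w\<bar> = H" using w im by (auto simp: abs_if split: if_splits)
      then show ?thesis
        using v hz abs_Re_le_cmod[of "w - of_real t"] abs_Im_le_cmod[of "w - of_real t"] by cases auto
    qed
    define P where "P = norm (poly Q (of_real t) * ctrunc R M (of_real t))"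
    have P: "P \<le> exp (2 * \<eta> * R)" unfolding P_def by (rule nb(3)[OF t(1)])
    define B where "B = 8 * pi * exp (- \<kappa> * R / 200 + 8 * \<eta> * R) * exp (2 * \<eta> * R) / \<mu>"
    have B0: "0 \<le> B" using mu0 by (simp add: B_def)
    have CI: "norm (contour_integral \<gamma> (\<lambda>w. h w * (poly Q (of_real t) * ctrunc R M (of_real t)) / (w - of_real t))) \<le> 4 * (2 * H) * B"
      unfolding \<gamma>_def
    proof (rule norm_rectpath_integral_le)
      have "continuous_on (path_image \<gamma>) g" "continuous_on (path_image \<gamma>) (ctrunc R M)"
        using gh ctrunc_holomorphic holomorphic_on_imp_continuous_on continuous_on_subset by blast+
      moreover have "ctrunc R M w \<noteq> 0" "w - of_real t \<noteq> 0" if "w \<in> path_image \<gamma>" for w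
        using G0[of w] that im S dist[OF that] mu0 by auto
      ultimately show "continuous_on (path_image (rectpath (Complex (-H) (-H)) (Complex H H)))
          (\<lambda>w. h w * (poly Q (of_real t) * ctrunc R M (of_real t)) / (w - of_real t))"
        unfolding h_def \<gamma>_def[symmetric] using Q0 by (intro continuous_intros) auto
      fix w assume "w \<in> path_image (rectpath (Complex (-H) (-H)) (Complex H H))"
      then have w: "w \<in> path_image \<gamma>" by (simp add: \<gamma>_def)
      have "norm (h w * (poly Q (of_real t) * ctrunc R M (of_real t)) / (w - of_real t)) = norm (h w) * P / norm (w - of_real t)"
        by (simp only: norm_divide norm_mult P_def)
      also have "\<dots> \<le> B" unfolding B_def
        using hbound[OF w] P dist[OF w] mu0 by (intro frac_le mult_mono) (auto simp: P_def)
      finally show "norm (h w * (poly Q (of_real t) * ctrunc R M (of_real t)) / (w - of_real t)) \<le> B" .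
    qed (use B0 H0 in auto)
    have fac: "\<bar>1 - t\<^sup>2 / H\<^sup>2\<bar> = 101 * \<mu> / H"
    proof -
      have "1 - t\<^sup>2 / H\<^sup>2 = (H\<^sup>2 - t\<^sup>2) / H\<^sup>2" using H0 by (simp add: diff_divide_distrib)
      then have "\<bar>1 - t\<^sup>2 / H\<^sup>2\<bar> = \<bar>H\<^sup>2 - t\<^sup>2\<bar> / H\<^sup>2" by simp
      then show ?thesis using H0 by (simp add: \<mu>_def power2_eq_square)
    qed
    have "norm (contour_integral \<gamma> (\<lambda>w. h w * (poly Q (of_real t) * ctrunc R M (of_real t)) / (w - of_real t)) / (2 * of_real pi * \<i>)) \<le> 4 * (2 * H) * B / (2 * pi)"
    proof -
      have n2: "norm (2 * of_real pi * \<i> :: complex) = 2 * pi" by (simp add: norm_mult)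
      show ?thesis unfolding norm_divide n2 by (rule divide_right_mono[OF CI]) simp
    qed
    then have "\<bar>1 - t\<^sup>2 / H\<^sup>2\<bar> * norm (contour_integral \<gamma> (\<lambda>w. h w * (poly Q (of_real t) * ctrunc R M (of_real t)) / (w - of_real t)) / (2 * of_real pi * \<i>))
      \<le> \<bar>1 - t\<^sup>2 / H\<^sup>2\<bar> * (4 * (2 * H) * B / (2 * pi))" by (rule mult_left_mono) simp
    also have "\<bar>1 - t\<^sup>2 / H\<^sup>2\<bar> * (4 * (2 * H) * B / (2 * pi)) = 101 * \<mu> / H * (4 * (2 * H) * B / (2 * pi))"
      by (simp only: fac)
    also have "101 * \<mu> / H * (4 * (2 * H) * B / (2 * pi)) = 3232 * (exp (- \<kappa> * R / 200 + 8 * \<eta> * R) * exp (2 * \<eta> * R))"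
      unfolding B_def using H0 mu0 by simp
    also have "\<dots> \<le> 3232 * exp (- \<kappa> * R / 400)"
    proof -
      define X where "X = \<kappa> * R"
      have X: "8 * \<eta> * R = 8 * (X / 20000)" "2 * \<eta> * R = 2 * (X / 20000)" "- \<kappa> * R = - X" by (simp_all add: eta X_def)
      have "0 \<le> X" using \<kappa> pb(4) by (simp add: X_def)
      then have "(- \<kappa> * R / 200 + 8 * \<eta> * R) + 2 * \<eta> * R \<le> - \<kappa> * R / 400" unfolding X by simp
      then show ?thesis unfolding mult_exp_exp by simp
    qed
    finally show ?thesis .
  qed
  \<comment> \<open>Taking real parts of the coefficients amounts to taking the real part on the
    real axis, where the target is real.\<close>
  define q where "q = [:1, 0, - 1 / H\<^sup>2:] * map_poly Re q1"
  have "degree q < card (inner R)"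
  proof -
    have "degree q \<le> degree [:1, 0, - 1 / H\<^sup>2:] + degree (map_poly Re q1)" unfolding q_def by (rule degree_mult_le)
    moreover have "degree [:1, 0, - 1 / H\<^sup>2:] \<le> 2" by simp
    moreover have "degree (map_poly Re q1) \<le> degree q1" by (rule map_poly_degree_leq)
    moreover have "degree Q \<le> 2 * m + 1" unfolding Q_def by (rule degree_node_poly)
    ultimately show ?thesis using q1(1) nb(1) by linarith
  qed
  moreover have "\<bar>poly q t * trunc R M t -
       (if \<bar>t\<bar> < H then (1 - t\<^sup>2 / H\<^sup>2) * (sinc (\<tau> * (t - y)) * exp (- \<kappa> * (t - y)\<^sup>2 / R)) else 0)\<bar> \<le> 3232 * exp (- \<kappa> * R / 400)"
    if t: "\<bar>t\<bar> \<le> R" "\<bar>t\<bar> \<noteq> H" for t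
  proof -
    define C where "C = contour_integral \<gamma> (\<lambda>w. h w * (poly Q (of_real t) * ctrunc R M (of_real t)) / (w - of_real t)) / (2 * of_real pi * \<i>)"
    have tn: "of_real t \<notin> path_image \<gamma>" using t(2) H0 by (auto simp: im)
    have tS: "of_real t \<in> S \<longleftrightarrow> \<bar>t\<bar> < H" using t(2) H0 by (auto simp: S)
    have gr: "g (of_real t) = of_real (sinc (\<tau> * (t - y)) * exp (- \<kappa> * (t - y)\<^sup>2 / R))"
    proof -
      have "exp (- of_real \<kappa> * (of_real t - of_real y)\<^sup>2 / of_real R) = complex_of_real (exp (- \<kappa> * (t - y)\<^sup>2 / R))"
        by (simp add: exp_of_real[symmetric])
      moreover have "csinc (of_real \<tau> * (of_real t - of_real y)) = of_real (sinc (\<tau> * (t - y)))"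
        using csinc_of_real[of "\<tau> * (t - y)"] by simp
      ultimately show ?thesis unfolding g_def by (simp only: of_real_mult)
    qed
    have "poly q1 (of_real t) * of_real (trunc R M t) = (if \<bar>t\<bar> < H then of_real (sinc (\<tau> * (t - y)) * exp (- \<kappa> * (t - y)\<^sup>2 / R)) else 0) - C"
      using q1(2)[OF tn] unfolding tS gr ctrunc_of_real C_def h_def .
    then have "Re (poly q1 (of_real t) * of_real (trunc R M t)) = Re ((if \<bar>t\<bar> < H then of_real (sinc (\<tau> * (t - y)) * exp (- \<kappa> * (t - y)\<^sup>2 / R)) else 0) - C)"
      by (rule arg_cong)
    then have "Re (poly q1 (of_real t)) * trunc R M t = (if \<bar>t\<bar> < H then sinc (\<tau> * (t - y)) * exp (- \<kappa> * (t - y)\<^sup>2 / R) else 0) - Re C"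
      by (simp split: if_splits)
    moreover have "poly q t * trunc R M t = (1 - t\<^sup>2 / H\<^sup>2) * (Re (poly q1 (of_real t)) * trunc R M t)"
      by (simp add: q_def poly_map_Re power2_eq_square left_diff_distrib)
    ultimately have "poly q t * trunc R M t -
       (if \<bar>t\<bar> < H then (1 - t\<^sup>2 / H\<^sup>2) * (sinc (\<tau> * (t - y)) * exp (- \<kappa> * (t - y)\<^sup>2 / R)) else 0) = - ((1 - t\<^sup>2 / H\<^sup>2) * Re C)"
      by (simp add: right_diff_distrib)
    then have "\<bar>poly q t * trunc R M t -
       (if \<bar>t\<bar> < H then (1 - t\<^sup>2 / H\<^sup>2) * (sinc (\<tau> * (t - y)) * exp (- \<kappa> * (t - y)\<^sup>2 / R)) else 0)\<bar> = \<bar>1 - t\<^sup>2 / H\<^sup>2\<bar> * \<bar>Re C\<bar>"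
      by (simp only: abs_minus_cancel abs_mult)
    also have "\<dots> \<le> \<bar>1 - t\<^sup>2 / H\<^sup>2\<bar> * norm C" by (intro mult_left_mono abs_Re_le_cmod) simp
    also have "\<dots> \<le> 3232 * exp (- \<kappa> * R / 400)" unfolding C_def by (rule err[OF t])
    finally show ?thesis .
  qed
  ultimately show ?thesis using that[OF H] by blast
qed

end

lemma integral_sinc_sq_le:
  fixes \<tau> y a b :: real
  assumes "0 < \<tau>"
  shows "integral {a..b} (\<lambda>t. (sinc (\<tau> * (t - y)))\<^sup>2) \<le> pi / \<tau>"
proof -
  have "(\<tau> / pi)\<^sup>2 * integral {a..b} (\<lambda>t. (sinc (\<tau> * (t - y)))\<^sup>2) = integral {a..b} (\<lambda>t. (\<tau> / pi * sinc (\<tau> * (t - y)))\<^sup>2)"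
    by (simp only: power_mult_distrib integral_mult_right)
  also have "\<dots> \<le> \<tau> / pi" by (rule integral_sinc2_le[OF assms])
  finally have "(\<tau> / pi)\<^sup>2 * integral {a..b} (\<lambda>t. (sinc (\<tau> * (t - y)))\<^sup>2) \<le> \<tau> / pi" .
  also have "\<tau> / pi = (\<tau> / pi)\<^sup>2 * (pi / \<tau>)" using assms by (simp add: power2_eq_square)
  finally show ?thesis by (rule mult_left_le_imp_le) (use assms in simp)
qed

text \<open>Young's inequality with a free weight.\<close>

lemma sum_square_le: "(u + v)\<^sup>2 \<le> (1 + \<theta>) * u\<^sup>2 + (1 + 1 / \<theta>) * v\<^sup>2" if "0 < \<theta>" for u v \<theta> :: real
proof -
  have "0 \<le> (\<theta> * u - v)\<^sup>2 / \<theta>" using that by simp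
  also have "\<dots> = \<theta> * u\<^sup>2 - 2 * u * v + v\<^sup>2 / \<theta>" using that by (simp add: power2_eq_square field_simps)
  finally show ?thesis by (simp add: power2_sum algebra_simps)
qed

context points
begin

text \<open>Both damping factors, the quadratic and the Gaussian, lie between 0 and 1 on (-H, H), so
  the norm is controlled by that of the cardinal sine of type \<tau>, whose square is at most 1 / (1
  - \<kappa>). On compact sets both factors tend to 1, so there the approximation survives.\<close>

lemma lower_estimate:
  assumes e: "0 < e" and T: "0 \<le> T"
  shows "\<forall>\<^sub>F R in at_top. \<forall>\<^sub>F M in sequentially. \<forall>y. \<bar>y\<bar> \<le> T \<longrightarrow> (\<exists>q. degree q < card (inner R) \<and>
     integral {-R..R} (\<lambda>t. (poly q t * trunc R M t)\<^sup>2) \<le> 1 + e \<and>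
     (\<forall>x. \<bar>x\<bar> \<le> T \<longrightarrow> \<bar>poly q x * trunc R M x - sinc (pi * (x - y))\<bar> \<le> e))"
proof -
  have "uniformly_continuous_on {- (2 * pi * T)..2 * pi * T} sinc"
    by (intro compact_uniformly_continuous continuous_on_sinc continuous_on_id) auto
  moreover have "0 < e / 2" using e by simp
  ultimately obtain d where d: "0 < d" and
    uc: "\<And>u v. u \<in> {- (2 * pi * T)..2 * pi * T} \<Longrightarrow> v \<in> {- (2 * pi * T)..2 * pi * T} \<Longrightarrow> dist v u < d \<Longrightarrow> dist (sinc v) (sinc u) < e / 2"
    unfolding uniformly_continuous_on_def by metis
  \<comment> \<open>The three bounds serve, in turn,
    \<open>(1 + \<kappa>) / (1 - \<kappa>) \<le> 1 + 4 * \<kappa>\<close>, the estimate of this by 1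
    + e / 2, and the passage from \<open>sinc (\<tau> * (x - y))\<close> to
    \<open>sinc (pi * (x - y))\<close> by uniform continuity.\<close>
  define \<kappa> where "\<kappa> = min (min (1/4) (e / 8)) (d / (4 * pi * (T + 1)))"
  define \<eta> where "\<eta> = \<kappa> / 20000"
  define \<tau> where "\<tau> = pi * (1 - \<kappa>)"
  have \<kappa>: "0 < \<kappa>" "\<kappa> \<le> 1/4" "\<kappa> \<le> e / 8" "\<kappa> \<le> d / (4 * pi * (T + 1))"
  proof -
    show "0 < \<kappa>" using e d T by (auto simp: \<kappa>_def)
    show "\<kappa> \<le> 1/4" "\<kappa> \<le> e / 8" "\<kappa> \<le> d / (4 * pi * (T + 1))" unfolding \<kappa>_def by linarith+
  qed
  have eta: "0 < \<eta>" "\<eta> \<le> 1/10" using \<kappa> by (auto simp: \<eta>_def)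
  have tau: "0 < \<tau>" using \<kappa> by (simp add: \<tau>_def)
  have tau_le: "\<tau> \<le> pi" using \<kappa> by (simp add: \<tau>_def)
  have near: "\<bar>sinc (\<tau> * (x - y)) - sinc (pi * (x - y))\<bar> \<le> e / 2" if "\<bar>x\<bar> \<le> T" "\<bar>y\<bar> \<le> T" for x y
  proof -
    have xy: "\<bar>x - y\<bar> \<le> 2 * T" using that by linarith
    have a: "\<bar>\<tau> * (x - y)\<bar> \<le> pi * (2 * T)" "\<bar>pi * (x - y)\<bar> \<le> pi * (2 * T)"
      unfolding abs_mult using xy tau tau_le by (intro mult_mono; simp)+
    have "\<tau> * (x - y) - pi * (x - y) = - (pi * \<kappa> * (x - y))" by (simp add: \<tau>_def algebra_simps)
    then have "\<bar>\<tau> * (x - y) - pi * (x - y)\<bar> = pi * \<kappa> * \<bar>x - y\<bar>" using \<kappa> by (simp add: abs_mult)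
    also have "\<dots> \<le> pi * (d / (4 * pi * (T + 1))) * (2 * T)"
      using xy \<kappa> d T by (intro mult_mono) auto
    also have "\<dots> = d * (T / (2 * (T + 1)))"
    proof -
      have "pi * (d / (4 * pi * S)) * (2 * T) = d * (T / (2 * S))" for S by simp
      then show ?thesis .
    qed
    also have "\<dots> < d * 1" using d T by (intro mult_strict_left_mono) (auto simp: divide_less_eq)
    finally have "dist (\<tau> * (x - y)) (pi * (x - y)) < d" by (simp add: dist_real_def)
    then have "dist (sinc (\<tau> * (x - y))) (sinc (pi * (x - y))) < e / 2"
      by (intro uc) (use a in \<open>auto simp: abs_le_iff\<close>)
    then show ?thesis by (simp add: dist_real_def)
  qed
  define E where "E = (\<lambda>R::real. 3232 * exp (- \<kappa> * R / 400))"
  have "((\<lambda>R::real. (1 + 1 / \<kappa>) * (E R)\<^sup>2 * (2 * R)) \<longlongrightarrow> 0) at_top" unfolding E_def using \<kappa>(1) by real_asymp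
  then have ev1: "\<forall>\<^sub>F R in at_top. (1 + 1 / \<kappa>) * (E R)\<^sup>2 * (2 * R) < e / 2" by (rule order_tendstoD(2)) (use e in simp)
  have "((\<lambda>R::real. E R + 100 * T\<^sup>2 / R\<^sup>2 + \<kappa> * (2 * T)\<^sup>2 / R) \<longlongrightarrow> 0) at_top" unfolding E_def using \<kappa>(1) by real_asymp
  then have ev2: "\<forall>\<^sub>F R in at_top. E R + 100 * T\<^sup>2 / R\<^sup>2 + \<kappa> * (2 * T)\<^sup>2 / R < e / 2" by (rule order_tendstoD(2)) (use e in simp)
  show ?thesis
    using eventually_regular[OF eta] ev1 ev2 eventually_ge_at_top[of "80 * T"] eventually_gt_at_top[of "10 * T"]
  proof eventually_elim
    case (elim R)
    then obtain a b where reg: "regular (tol \<eta>) R a b" by blast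
    have R: "threshold \<eta> \<le> R" using elim by blast
    note pb = parameter_bounds[OF eta R]
    have "\<forall>\<^sub>F M in sequentially. \<bar>\<Sum>n\<in>outer R M. 1 / p n\<bar> < tol \<eta>" using elim by blast
    then show ?case using eventually_large_trunc[of a b "4 * R\<^sup>2"]
    proof eventually_elim
      case M: (elim M)
      show ?case
      proof (intro allI impI)
        fix y :: real assume y: "\<bar>y\<bar> \<le> T"
        have \<kappa>1: "\<kappa> \<le> 1" and y80: "\<bar>y\<bar> \<le> R / 80" using \<kappa> y elim by auto
        from M have M1: "\<bar>\<Sum>n\<in>outer R M. 1 / p n\<bar> < tol \<eta>" "a \<le> int M" "b \<le> int M" "4 * R\<^sup>2 \<le> real M" by auto
        obtain q H where H: "R / 10 \<le> H" "H \<le> R / 8" and q: "degree q < card (inner R)" and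
          qb: "\<And>t. \<bar>t\<bar> \<le> R \<Longrightarrow> \<bar>t\<bar> \<noteq> H \<Longrightarrow> \<bar>poly q t * trunc R M t -
            (if \<bar>t\<bar> < H then (1 - t\<^sup>2 / H\<^sup>2) * (sinc (\<tau> * (t - y)) * exp (- \<kappa> * (t - y)\<^sup>2 / R)) else 0)\<bar> \<le> E R"
          using lower_pointwise[OF \<kappa>(1) \<kappa>1 \<eta>_def R reg M1 y80] unfolding \<tau>_def E_def by metis
        have H0: "0 < H" using H pb(4) by linarith
        have R0: "0 < R" using pb(4) by linarith
        define f where "f = (\<lambda>t. poly q t * trunc R M t)"
        define s where "s = (\<lambda>t. sinc (\<tau> * (t - y)))"
        have fc: "continuous_on A f" for A unfolding f_def by (intro continuous_intros trunc_continuous)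
        have sc: "continuous_on A s" for A
          unfolding s_def by (intro continuous_intros continuous_on_compose2[OF continuous_on_sinc]) auto
        have frac: "0 \<le> 1 - t\<^sup>2 / H\<^sup>2 \<and> 1 - t\<^sup>2 / H\<^sup>2 \<le> 1" if "\<bar>t\<bar> < H" for t
        proof -
          have "t\<^sup>2 \<le> H\<^sup>2" using power_mono[of "\<bar>t\<bar>" H 2] that by simp
          then show ?thesis using H0 by simp
        qed
        have ex: "0 \<le> exp (- \<kappa> * (t - y)\<^sup>2 / R) \<and> exp (- \<kappa> * (t - y)\<^sup>2 / R) \<le> 1" for t
          using \<kappa> R0 by simp
        have fb: "\<bar>f t\<bar> \<le> \<bar>s t\<bar> + E R" if t: "\<bar>t\<bar> \<le> R" "\<bar>t\<bar> \<noteq> H" for t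
        proof -
          have "\<bar>if \<bar>t\<bar> < H then (1 - t\<^sup>2 / H\<^sup>2) * (sinc (\<tau> * (t - y)) * exp (- \<kappa> * (t - y)\<^sup>2 / R)) else 0\<bar> \<le> \<bar>s t\<bar>"
          proof (cases "\<bar>t\<bar> < H")
            case True
            have "\<bar>(1 - t\<^sup>2 / H\<^sup>2) * (s t * exp (- \<kappa> * (t - y)\<^sup>2 / R))\<bar> = (1 - t\<^sup>2 / H\<^sup>2) * (\<bar>s t\<bar> * exp (- \<kappa> * (t - y)\<^sup>2 / R))"
              using frac[OF True] by (simp add: abs_mult)
            also have "\<dots> \<le> 1 * (\<bar>s t\<bar> * 1)" using frac[OF True] ex[of t] by (intro mult_mono) auto
            finally show ?thesis using True by (simp add: s_def)
          qed simp
          then show ?thesis using qb[OF t] unfolding f_def by linarith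
        qed
        define C where "C = (1 + 1 / \<kappa>) * (E R)\<^sup>2"
        have C0: "0 \<le> C" using \<kappa> by (simp add: C_def)
        \<comment> \<open>The pointwise estimate is silent at \<plusminus>H, where the contour meets
          the axis; these two points form a null set.\<close>
        have "integral {-R..R} (\<lambda>t. (f t)\<^sup>2) = integral {-R..R} (\<lambda>t. if t \<in> {-H, H} then 0 else (f t)\<^sup>2)"
          by (rule integral_spike[of "{-H, H}"]) auto
        also have "\<dots> \<le> integral {-R..R} (\<lambda>t. (1 + \<kappa>) * (s t)\<^sup>2 + C)"
        proof (rule integral_le)
          have "(\<lambda>t. (f t)\<^sup>2) integrable_on {-R..R}" by (intro integrable_continuous_real continuous_intros fc)
          then show "(\<lambda>t. if t \<in> {-H, H} then 0 else (f t)\<^sup>2) integrable_on {-R..R}"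
            by (rule integrable_spike[of _ _ "{-H, H}"]) auto
          show "(\<lambda>t. (1 + \<kappa>) * (s t)\<^sup>2 + C) integrable_on {-R..R}" by (intro integrable_continuous_real continuous_intros sc)
          fix t assume t: "t \<in> {-R..R}"
          show "(if t \<in> {-H, H} then 0 else (f t)\<^sup>2) \<le> (1 + \<kappa>) * (s t)\<^sup>2 + C"
          proof (cases "t \<in> {-H, H}")
            case True
            then show ?thesis using \<kappa> C0 by simp
          next
            case False
            then have "\<bar>f t\<bar> \<le> \<bar>s t\<bar> + E R" using t by (intro fb) (auto simp: abs_if)
            then have "\<bar>f t\<bar>\<^sup>2 \<le> (\<bar>s t\<bar> + E R)\<^sup>2" by (intro power_mono) auto
            \<comment> \<open>The small weight goes to the main term; its large reciprocal falls on
              an exponentially small one.\<close>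
            also have "\<dots> \<le> (1 + \<kappa>) * \<bar>s t\<bar>\<^sup>2 + (1 + 1 / \<kappa>) * (E R)\<^sup>2" by (rule sum_square_le[OF \<kappa>(1)])
            finally show ?thesis using False by (simp add: C_def)
          qed
        qed
        also have "\<dots> = (1 + \<kappa>) * integral {-R..R} (\<lambda>t. (s t)\<^sup>2) + C * (2 * R)"
          using R0 by (subst Henstock_Kurzweil_Integration.integral_add) (auto intro!: integrable_continuous_real continuous_intros sc)
        also have "\<dots> \<le> (1 + \<kappa>) * (1 / (1 - \<kappa>)) + e / 2"
        proof (rule add_mono)
          have "integral {-R..R} (\<lambda>t. (s t)\<^sup>2) \<le> pi / \<tau>" unfolding s_def by (rule integral_sinc_sq_le[OF tau])
          also have "pi / \<tau> = 1 / (1 - \<kappa>)" by (simp add: \<tau>_def)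
          finally show "(1 + \<kappa>) * integral {-R..R} (\<lambda>t. (s t)\<^sup>2) \<le> (1 + \<kappa>) * (1 / (1 - \<kappa>))"
            using \<kappa> by (intro mult_left_mono) auto
          show "C * (2 * R) \<le> e / 2" using elim unfolding C_def by auto
        qed
        also have "(1 + \<kappa>) * (1 / (1 - \<kappa>)) \<le> 1 + e / 2"
        proof -
          have "\<kappa> * \<kappa> \<le> 1/4 * \<kappa>" using \<kappa> by (intro mult_right_mono) auto
          then have "1 + \<kappa> \<le> (1 + 4 * \<kappa>) * (1 - \<kappa>)" using \<kappa> by (simp add: algebra_simps)
          then have "(1 + \<kappa>) / (1 - \<kappa>) \<le> 1 + 4 * \<kappa>" using \<kappa> by (simp add: divide_le_eq)
          then show ?thesis using \<kappa> by simp
        qed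
        finally have norm: "integral {-R..R} (\<lambda>t. (f t)\<^sup>2) \<le> 1 + e" by simp
        have loc: "\<bar>f x - sinc (pi * (x - y))\<bar> \<le> e" if x: "\<bar>x\<bar> \<le> T" for x
        proof -
          have xH: "\<bar>x\<bar> < H" using x elim H by linarith
          define u where "u = x\<^sup>2 / H\<^sup>2"
          define v where "v = \<kappa> * (x - y)\<^sup>2 / R"
          have u: "0 \<le> u" "u \<le> 100 * T\<^sup>2 / R\<^sup>2" "u \<le> 1"
          proof -
            show "0 \<le> u" by (simp add: u_def)
            show "u \<le> 1" using frac[OF xH] by (simp add: u_def)
            have "x\<^sup>2 / H\<^sup>2 \<le> T\<^sup>2 / (R / 10)\<^sup>2"
            proof (rule frac_le)
              show "x\<^sup>2 \<le> T\<^sup>2" using x power_mono[of "\<bar>x\<bar>" T 2] by simp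
              show "(R / 10)\<^sup>2 \<le> H\<^sup>2" using H R0 by (intro power_mono) auto
            qed (use R0 in auto)
            then show "u \<le> 100 * T\<^sup>2 / R\<^sup>2" by (simp add: u_def power_divide mult.commute)
          qed
          have v: "0 \<le> v" "v \<le> \<kappa> * (2 * T)\<^sup>2 / R"
          proof -
            show "0 \<le> v" using \<kappa> R0 by (simp add: v_def)
            have "\<bar>x - y\<bar> \<le> 2 * T" using x y by linarith
            then have "\<bar>x - y\<bar>\<^sup>2 \<le> (2 * T)\<^sup>2" by (intro power_mono) auto
            then show "v \<le> \<kappa> * (2 * T)\<^sup>2 / R" unfolding v_def using \<kappa> R0 by (intro divide_right_mono mult_left_mono) auto
          qed
          have ev: "1 - v \<le> exp (- v)" "exp (- v) \<le> 1" using exp_ge_add_one_self[of "- v"] v by auto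
          \<comment> \<open>The quadratic factor differs from 1 by u and the Gaussian by at most
            v.\<close>
          have "\<bar>(1 - u) * (s x * exp (- v)) - s x\<bar> \<le> u + v"
          proof -
            have "1 - (1 - u) * exp (- v) = (1 - exp (- v)) + u * exp (- v)" by (simp add: algebra_simps)
            moreover have "u * exp (- v) \<le> u * 1" using u ev by (intro mult_left_mono) auto
            moreover have "0 \<le> u * exp (- v)" using u by simp
            ultimately have "\<bar>1 - (1 - u) * exp (- v)\<bar> \<le> u + v" using ev by linarith
            moreover have "\<bar>(1 - u) * (s x * exp (- v)) - s x\<bar> = \<bar>s x\<bar> * \<bar>1 - (1 - u) * exp (- v)\<bar>"
              by (simp add: abs_mult[symmetric] algebra_simps abs_minus_commute)
            moreover have "\<bar>s x\<bar> * \<bar>1 - (1 - u) * exp (- v)\<bar> \<le> 1 * \<bar>1 - (1 - u) * exp (- v)\<bar>"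
              unfolding s_def by (intro mult_right_mono abs_sinc_le_1) auto
            ultimately show ?thesis by (metis mult_1 order_trans)
          qed
          moreover have "\<bar>f x - (1 - u) * (s x * exp (- v))\<bar> \<le> E R"
            using qb[of x] x xH elim unfolding f_def s_def u_def v_def by auto
          ultimately have "\<bar>f x - s x\<bar> \<le> E R + u + v" by linarith
          moreover have "E R + u + v \<le> e / 2" using u(2) v(2) elim by linarith
          ultimately show ?thesis using near[OF x y] unfolding s_def by linarith
        qed
        show "\<exists>q. degree q < card (inner R) \<and>
           integral {-R..R} (\<lambda>t. (poly q t * trunc R M t)\<^sup>2) \<le> 1 + e \<and>
           (\<forall>x. \<bar>x\<bar> \<le> T \<longrightarrow> \<bar>poly q x * trunc R M x - sinc (pi * (x - y))\<bar> \<le> e)"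
          using q norm loc unfolding f_def by blast
      qed
    qed
  qed
qed

end

section \<open>The kernel limit\<close>

context points
begin

lemma point_count_eq: "point_count p R = card (inner R)"
proof -
  have "{p n | n. \<bar>p n\<bar> \<le> R} = p ` inner R" by (auto simp: inner_def)
  moreover have "inj_on p (inner R)" using strict_mono strict_mono_eq by (auto simp: inj_on_def)
  ultimately show ?thesis by (simp add: point_count_def card_image)
qed

text \<open>\<open>orthonormal_polys\<close> integrates over the whole line in the sense of
  Lebesgue, the estimates over [-R, R] with the gauge integral. The weight vanishes outside that
  interval and the integrand is continuous on it.\<close>

lemma weight_integral:
  assumes R: "0 < R" and gc: "continuous_on {-R..R} g"
    and gw: "\<And>t. \<bar>t\<bar> \<le> R \<Longrightarrow> point_weight p R t = (g t)\<^sup>2"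
    and h: "continuous_on {-R..R} h"
  shows "has_bochner_integral lborel (\<lambda>t. h t * point_weight p R t) (integral {-R..R} (\<lambda>t. h t * (g t)\<^sup>2))"
proof -
  have c: "continuous_on {-R..R} (\<lambda>t. h t * (g t)\<^sup>2)" using gc h by (intro continuous_intros)
  have i: "set_integrable lborel {-R..R} (\<lambda>t. h t * (g t)\<^sup>2)"
    by (rule borel_integrable_atLeastAtMost'[OF c])
  have e: "(\<lambda>t. h t * point_weight p R t) = (\<lambda>t. indicator {-R..R} t *\<^sub>R (h t * (g t)\<^sup>2))"
  proof
    fix t
    show "h t * point_weight p R t = indicator {-R..R} t *\<^sub>R (h t * (g t)\<^sup>2)"
      using gw[of t] by (cases "t \<in> {-R..R}") (auto simp: point_weight_def abs_le_iff)
  qed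
  have "(LINT t:{-R..R}|lborel. h t * (g t)\<^sup>2) = integral {-R..R} (\<lambda>t. h t * (g t)\<^sup>2)"
    by (rule set_borel_integral_eq_integral(2)[OF i])
  then show ?thesis
    using i unfolding e set_integrable_def set_lebesgue_integral_def has_bochner_integral_iff by simp
qed

lemma poly_weight_point_weight:
  assumes R: "0 < R" and gc: "continuous_on {-R..R} g" and g0: "\<And>t. \<bar>t\<bar> \<le> R \<Longrightarrow> 0 < g t"
    and gw: "\<And>t. \<bar>t\<bar> \<le> R \<Longrightarrow> point_weight p R t = (g t)\<^sup>2"
  shows "poly_weight (point_weight p R)"
    and "weight_inner (point_weight p R) q q = integral {-R..R} (\<lambda>t. (poly q t * g t)\<^sup>2)"
proof -
  have inner: "weight_inner (point_weight p R) q q = integral {-R..R} (\<lambda>t. (poly q t * g t)\<^sup>2)" for q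
  proof -
    have "has_bochner_integral lborel (\<lambda>t. poly q t * poly q t * point_weight p R t)
       (integral {-R..R} (\<lambda>t. poly q t * poly q t * (g t)\<^sup>2))"
      by (rule weight_integral[OF R gc gw]) (auto intro!: continuous_intros)
    then show ?thesis
      by (simp add: weight_inner_def has_bochner_integral_iff power_mult_distrib power2_eq_square[of "poly q _"])
  qed
  show "weight_inner (point_weight p R) q q = integral {-R..R} (\<lambda>t. (poly q t * g t)\<^sup>2)" by (rule inner)
  show "poly_weight (point_weight p R)"
  proof
    fix q
    have "has_bochner_integral lborel (\<lambda>t. poly q t * point_weight p R t) (integral {-R..R} (\<lambda>t. poly q t * (g t)\<^sup>2))"
      by (rule weight_integral[OF R gc gw]) (auto intro!: continuous_intros)
    then show "integrable lborel (\<lambda>t. poly q t * point_weight p R t)" by (simp add: has_bochner_integral_iff)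
  next
    fix q :: "real poly" assume q: "q \<noteq> 0"
    have c: "continuous_on {-R..R} (\<lambda>t. (poly q t * g t)\<^sup>2)" using gc by (intro continuous_intros)
    \<comment> \<open>A continuous non-negative function with zero integral vanishes; as g > 0, the
      polynomial q would have an interval of zeros.\<close>
    have "integral {-R..R} (\<lambda>t. (poly q t * g t)\<^sup>2) \<noteq> 0"
    proof
      assume "integral {-R..R} (\<lambda>t. (poly q t * g t)\<^sup>2) = 0"
      then have i0: "((\<lambda>t. (poly q t * g t)\<^sup>2) has_integral 0) (cbox (-R) R)"
        using integrable_integral[OF integrable_continuous_real[OF c]] by simp
      have z: "(poly q t * g t)\<^sup>2 = 0" if "t \<in> cbox (-R) R" for t
      proof (rule has_integral_0_cbox_imp_0[of "-R" R "\<lambda>t. (poly q t * g t)\<^sup>2"])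
        show "continuous_on (cbox (-R) R) (\<lambda>t. (poly q t * g t)\<^sup>2)" using c by simp
        show "((\<lambda>t. (poly q t * g t)\<^sup>2) has_integral 0) (cbox (-R) R)" by (rule i0)
        show "box (-R) R \<noteq> {}" using R by simp
      qed (use that in auto)
      have "{-R..R} \<subseteq> {t. poly q t = 0}"
      proof
        fix t assume t: "t \<in> {-R..R}"
        then have "0 < g t" by (intro g0) auto
        then show "t \<in> {t. poly q t = 0}" using z[of t] t by auto
      qed
      then have "finite {-R..R}" using poly_roots_finite[OF q] finite_subset by blast
      then show False using R by (simp add: infinite_Icc)
    qed
    moreover have "0 \<le> integral {-R..R} (\<lambda>t. (poly q t * g t)\<^sup>2)"
      by (intro Henstock_Kurzweil_Integration.integral_nonneg integrable_continuous_real c) auto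
    ultimately show "0 < weight_inner (point_weight p R) q q" unfolding inner by linarith
  qed
qed

lemma integral_poly_square_mono:
  fixes f1 f2 :: "real \<Rightarrow> real"
  assumes c1: "continuous_on {-R..R} f1" and c2: "continuous_on {-R..R} f2" and K: "0 \<le> K"
    and le: "\<And>t. t \<in> {-R..R} \<Longrightarrow> 0 \<le> f1 t \<and> f1 t \<le> K * f2 t"
  shows "integral {-R..R} (\<lambda>t. (poly q t * f1 t)\<^sup>2) \<le> K\<^sup>2 * integral {-R..R} (\<lambda>t. (poly q t * f2 t)\<^sup>2)"
proof -
  have "integral {-R..R} (\<lambda>t. (poly q t * f1 t)\<^sup>2) \<le> integral {-R..R} (\<lambda>t. K\<^sup>2 * (poly q t * f2 t)\<^sup>2)"
  proof (rule Henstock_Kurzweil_Integration.integral_le)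
    show "(\<lambda>t. (poly q t * f1 t)\<^sup>2) integrable_on {-R..R}" "(\<lambda>t. K\<^sup>2 * (poly q t * f2 t)\<^sup>2) integrable_on {-R..R}"
      by (intro integrable_continuous_real continuous_intros c1 c2)+
    fix t assume t: "t \<in> {-R..R}"
    have "(f1 t)\<^sup>2 \<le> (K * f2 t)\<^sup>2" using le[OF t] by (intro power_mono) auto
    then have "(poly q t)\<^sup>2 * (f1 t)\<^sup>2 \<le> (poly q t)\<^sup>2 * (K * f2 t)\<^sup>2" by (intro mult_left_mono) auto
    then show "(poly q t * f1 t)\<^sup>2 \<le> K\<^sup>2 * (poly q t * f2 t)\<^sup>2" by (simp add: power_mult_distrib mult_ac)
  qed
  then show ?thesis by simp
qed

text \<open>For fixed R, one large M serves both estimates together with the approximation of g.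
  Exchanging \<open>trunc\<close> for g costs the factor k = 1 + e / 8 each time: k^4 \<le> 1 + e in
  the evaluation bound, k^2 in the norm of q, so C = (1 + e)^2 covers both. Then 2 C - 2 (1 - 2 e)
  \<le> 10 e and C \<le> 4 lead to sqrt(40 e) \<le> 7 sqrt e, and the remaining error 2 e stays far
  below what 20 sqrt e allows.\<close>

lemma kernel_near_sinc:
  assumes e: "0 < e" "e \<le> 1" and T: "0 \<le> T"
  shows "\<forall>\<^sub>F R in at_top. \<forall>x y. \<bar>x\<bar> \<le> T \<longrightarrow> \<bar>y\<bar> \<le> T \<longrightarrow>
    \<bar>orthonormal_kernel (point_weight p R) (point_count p R) x y - sinc (pi * (x - y))\<bar> \<le> 20 * sqrt e"
  using upper_estimate[OF e(1) T] lower_estimate[OF e(1) T] eventually_gt_at_top[of T]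
proof eventually_elim
  case (elim R)
  have R: "0 < R" using elim T by linarith
  obtain g where gc: "continuous_on {-R..R} g" and g0: "\<And>t. \<bar>t\<bar> \<le> R \<Longrightarrow> 0 < g t"
    and gw: "\<And>t. \<bar>t\<bar> \<le> R \<Longrightarrow> point_weight p R t = (g t)\<^sup>2"
    and ga: "\<And>\<epsilon>. 0 < \<epsilon> \<Longrightarrow> \<forall>\<^sub>F M in sequentially. \<forall>t\<in>{-R..R}. exp (- \<epsilon>) * trunc R M t \<le> g t \<and> g t \<le> exp \<epsilon> * trunc R M t"
    using point_weight_limit[OF R] by blast
  interpret pw: poly_weight "point_weight p R" by (rule poly_weight_point_weight(1)[OF R gc g0 gw])
  have ip: "weight_inner (point_weight p R) q q = integral {-R..R} (\<lambda>t. (poly q t * g t)\<^sup>2)" for q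
    by (rule poly_weight_point_weight(2)[OF R gc g0 gw])
  define \<epsilon> where "\<epsilon> = ln (1 + e / 8)"
  have eps: "0 < \<epsilon>" using e by (simp add: \<epsilon>_def)
  have exp_eps: "exp \<epsilon> = 1 + e / 8" using e by (simp add: \<epsilon>_def)
  define k where "k = 1 + e / 8"
  have k: "1 \<le> k" "k\<^sup>2 \<le> 1 + e / 2" "k ^ 4 \<le> 1 + e"
  proof -
    show "1 \<le> k" using e by (simp add: k_def)
    define d where "d = e * e"
    have ee: "d \<le> e" using mult_right_mono[of e 1 e] e by (simp add: d_def)
    have "k\<^sup>2 = 1 + e / 4 + d / 64" by (simp add: k_def d_def power2_eq_square field_simps)
    then have k2: "k\<^sup>2 \<le> 1 + 3/10 * e" using ee e by linarith
    then show "k\<^sup>2 \<le> 1 + e / 2" using e by linarith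
    have "k ^ 4 = k\<^sup>2 * k\<^sup>2" by (simp add: power2_eq_square power4_eq_xxxx)
    also have "\<dots> \<le> (1 + 3/10 * e) * (1 + 3/10 * e)" using k2 e by (intro mult_mono) auto
    also have "\<dots> = 1 + 3/5 * e + 9/100 * d" by (simp add: d_def field_simps)
    also have "\<dots> \<le> 1 + e" using ee e by linarith
    finally show "k ^ 4 \<le> 1 + e" .
  qed
  have "\<forall>\<^sub>F M in sequentially. (\<forall>t\<in>{-R..R}. exp (- \<epsilon>) * trunc R M t \<le> g t \<and> g t \<le> exp \<epsilon> * trunc R M t) \<and>
     (\<forall>q y. degree q < card (inner R) \<longrightarrow> \<bar>y\<bar> \<le> T \<longrightarrow>
        (poly q y * trunc R M y)\<^sup>2 \<le> (1 + e) * integral {-R..R} (\<lambda>t. (poly q t * trunc R M t)\<^sup>2)) \<and>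
     (\<forall>y. \<bar>y\<bar> \<le> T \<longrightarrow> (\<exists>q. degree q < card (inner R) \<and>
        integral {-R..R} (\<lambda>t. (poly q t * trunc R M t)\<^sup>2) \<le> 1 + e \<and>
        (\<forall>x. \<bar>x\<bar> \<le> T \<longrightarrow> \<bar>poly q x * trunc R M x - sinc (pi * (x - y))\<bar> \<le> e)))"
    by (intro eventually_conj ga[OF eps] elim(1,2))
  then obtain M where
    gM: "\<And>t. t \<in> {-R..R} \<Longrightarrow> exp (- \<epsilon>) * trunc R M t \<le> g t \<and> g t \<le> exp \<epsilon> * trunc R M t" and
    upper: "\<And>q y. degree q < card (inner R) \<Longrightarrow> \<bar>y\<bar> \<le> T \<Longrightarrow>
        (poly q y * trunc R M y)\<^sup>2 \<le> (1 + e) * integral {-R..R} (\<lambda>t. (poly q t * trunc R M t)\<^sup>2)" and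
    lower: "\<And>y. \<bar>y\<bar> \<le> T \<Longrightarrow> \<exists>q. degree q < card (inner R) \<and>
        integral {-R..R} (\<lambda>t. (poly q t * trunc R M t)\<^sup>2) \<le> 1 + e \<and>
        (\<forall>x. \<bar>x\<bar> \<le> T \<longrightarrow> \<bar>poly q x * trunc R M x - sinc (pi * (x - y))\<bar> \<le> e)"
    using eventually_happens'[OF sequentially_bot] by blast
  have tpos: "0 < trunc R M t" if "t \<in> {-R..R}" for t
    using trunc_eq_exp[of t R M] that by auto
  have g1: "g t \<le> k * trunc R M t" and g2: "trunc R M t \<le> k * g t" if t: "t \<in> {-R..R}" for t
  proof -
    show "g t \<le> k * trunc R M t" using gM[OF t] by (simp add: exp_eps k_def)
    have "trunc R M t = exp \<epsilon> * (exp (- \<epsilon>) * trunc R M t)" by (simp add: exp_minus)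
    also have "\<dots> \<le> exp \<epsilon> * g t" using gM[OF t] by (intro mult_left_mono) auto
    finally show "trunc R M t \<le> k * g t" by (simp only: exp_eps k_def)
  qed
  have TR: "t \<in> {-R..R}" if "\<bar>t\<bar> \<le> T" for t using that elim by auto
  have TA: "\<bar>t\<bar> \<le> R" if "\<bar>t\<bar> \<le> T" for t using that elim by auto
  define C where "C = (1 + e) * (1 + e)"
  have upper': "(poly q z)\<^sup>2 * point_weight p R z \<le> C * weight_inner (point_weight p R) q q"
    if q: "degree q < card (inner R)" and z: "\<bar>z\<bar> \<le> T" for q z
  proof -
    have zR: "z \<in> {-R..R}" by (rule TR[OF z])
    have "(poly q z)\<^sup>2 * point_weight p R z = (poly q z)\<^sup>2 * (g z)\<^sup>2" by (simp add: gw[OF TA[OF z]])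
    also have "\<dots> \<le> (poly q z)\<^sup>2 * (k * trunc R M z)\<^sup>2"
      using g1[OF zR] g0[OF TA[OF z]] by (intro mult_left_mono power_mono) auto
    also have "\<dots> = k\<^sup>2 * (poly q z * trunc R M z)\<^sup>2" by (simp add: power_mult_distrib mult_ac)
    also have "\<dots> \<le> k\<^sup>2 * ((1 + e) * integral {-R..R} (\<lambda>t. (poly q t * trunc R M t)\<^sup>2))"
      by (intro mult_left_mono upper[OF q z]) auto
    also have "\<dots> \<le> k\<^sup>2 * ((1 + e) * (k\<^sup>2 * integral {-R..R} (\<lambda>t. (poly q t * g t)\<^sup>2)))"
      using g2 tpos k e by (intro mult_left_mono integral_poly_square_mono trunc_continuous gc) (auto intro: less_imp_le)
    also have "\<dots> = k ^ 4 * (1 + e) * weight_inner (point_weight p R) q q"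
      by (simp add: ip power2_eq_square[of k] power4_eq_xxxx)
    also have "\<dots> \<le> (1 + e) * (1 + e) * weight_inner (point_weight p R) q q"
    proof (intro mult_right_mono k(3))
      show "0 \<le> weight_inner (point_weight p R) q q"
        by (cases "q = 0") (auto intro: less_imp_le pw.positive)
    qed (use e in auto)
    finally show ?thesis by (simp add: C_def)
  qed
  have C: "1 \<le> C" "C \<le> 1 + 3 * e" "C \<le> 4"
  proof -
    have ee: "0 \<le> e * e" "e * e \<le> e" using mult_right_mono[of e 1 e] e by auto
    have "C = 1 + 2 * e + e * e" by (simp add: C_def algebra_simps)
    then show "1 \<le> C" "C \<le> 1 + 3 * e" "C \<le> 4" using ee e by linarith+
  qed
  show ?case
  proof (intro allI impI)
    fix x y assume x: "\<bar>x\<bar> \<le> T" and y: "\<bar>y\<bar> \<le> T"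
    obtain q where q: "degree q < card (inner R)" and
      qi: "integral {-R..R} (\<lambda>t. (poly q t * trunc R M t)\<^sup>2) \<le> 1 + e" and
      qs: "\<And>x. \<bar>x\<bar> \<le> T \<Longrightarrow> \<bar>poly q x * trunc R M x - sinc (pi * (x - y))\<bar> \<le> e"
      using lower[OF y] by blast
    have sq: "sqrt (point_weight p R z) = g z" if "\<bar>z\<bar> \<le> T" for z
      using g0[OF TA[OF that]] by (simp add: gw[OF TA[OF that]])
    have gq: "\<bar>g z * poly q z - sinc (pi * (z - y))\<bar> \<le> 2 * e" if z: "\<bar>z\<bar> \<le> T" for z
    proof -
      have zR: "z \<in> {-R..R}" by (rule TR[OF z])
      have t0: "0 < trunc R M z" by (rule tpos[OF zR])
      have "\<bar>g z - trunc R M z\<bar> \<le> e / 8 * trunc R M z"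
      proof -
        have "g z \<le> trunc R M z + e / 8 * trunc R M z" using g1[OF zR] by (simp add: k_def algebra_simps)
        moreover have "trunc R M z - e / 8 * trunc R M z \<le> g z"
        proof -
          have "1 - e / 8 \<le> 1 / k" using e by (simp add: k_def le_divide_eq algebra_simps)
          then have "(1 - e / 8) * trunc R M z \<le> 1 / k * trunc R M z" using t0 by (intro mult_right_mono) auto
          also have "\<dots> \<le> g z" using g2[OF zR] k(1) by (simp add: divide_le_eq mult.commute)
          finally show ?thesis by (simp add: algebra_simps)
        qed
        ultimately show ?thesis by linarith
      qed
      then have "\<bar>poly q z\<bar> * \<bar>g z - trunc R M z\<bar> \<le> \<bar>poly q z\<bar> * (e / 8 * trunc R M z)" by (intro mult_left_mono) auto
      also have "\<dots> = e / 8 * \<bar>poly q z * trunc R M z\<bar>" using t0 by (simp add: abs_mult)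
      also have "\<dots> \<le> e / 8 * 2"
      proof (intro mult_left_mono)
        show "\<bar>poly q z * trunc R M z\<bar> \<le> 2" using qs[OF z] abs_sinc_le_1[of "pi * (z - y)"] e by linarith
      qed (use e in auto)
      finally have "\<bar>poly q z * (g z - trunc R M z)\<bar> \<le> e / 4" by (simp add: abs_mult)
      moreover have "g z * poly q z - sinc (pi * (z - y)) = poly q z * (g z - trunc R M z) + (poly q z * trunc R M z - sinc (pi * (z - y)))"
        by (simp add: algebra_simps)
      ultimately show ?thesis using qs[OF z] e by linarith
    qed
    have iq: "weight_inner (point_weight p R) q q \<le> C"
    proof -
      have "weight_inner (point_weight p R) q q \<le> k\<^sup>2 * integral {-R..R} (\<lambda>t. (poly q t * trunc R M t)\<^sup>2)"
        unfolding ip using g1 g0 k by (intro integral_poly_square_mono trunc_continuous gc) (auto intro: less_imp_le)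
      also have "\<dots> \<le> (1 + e / 2) * (1 + e)"
        using k qi e by (intro mult_mono Henstock_Kurzweil_Integration.integral_nonneg integrable_continuous_real continuous_intros trunc_continuous) auto
      also have "\<dots> \<le> C" unfolding C_def using e by (intro mult_right_mono) auto
      finally show ?thesis .
    qed
    have "\<bar>orthonormal_kernel (point_weight p R) (card (inner R)) x y - sqrt (point_weight p R x) * poly q x\<bar>
       \<le> sqrt (C * (2 * C - 2 * (sqrt (point_weight p R y) * poly q y)))"
    proof (rule pw.orthonormal_kernel_approx)
      show "0 \<le> point_weight p R x" "0 \<le> point_weight p R y"
        by (simp_all add: gw[OF TA[OF x]] gw[OF TA[OF y]])
      show "(poly r z)\<^sup>2 * point_weight p R z \<le> C * weight_inner (point_weight p R) r r"
        if "z \<in> {x, y}" "degree r < card (inner R)" for r z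
        using upper'[OF that(2)] that(1) x y by auto
    qed (use q iq C in auto)
    also have "\<dots> \<le> sqrt (4 * (10 * e))"
    proof (rule real_sqrt_le_mono)
      have "1 - 2 * e \<le> g y * poly q y" using gq[OF y] by simp
      then have "2 * C - 2 * (g y * poly q y) \<le> 10 * e" using C by linarith
      then have "C * (2 * C - 2 * (g y * poly q y)) \<le> C * (10 * e)" using C by (intro mult_left_mono) auto
      also have "\<dots> \<le> 4 * (10 * e)" using C e by (intro mult_right_mono) auto
      finally show "C * (2 * C - 2 * (sqrt (point_weight p R y) * poly q y)) \<le> 4 * (10 * e)" by (simp only: sq[OF y])
    qed
    also have "\<dots> \<le> 7 * sqrt e"
    proof -
      have "sqrt (4 * (10 * e)) \<le> sqrt (49 * e)" using e by (intro real_sqrt_le_mono) auto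
      also have "\<dots> = 7 * sqrt e" by (simp add: real_sqrt_mult)
      finally show ?thesis .
    qed
    finally have "\<bar>orthonormal_kernel (point_weight p R) (card (inner R)) x y - g x * poly q x\<bar> \<le> 7 * sqrt e"
      unfolding sq[OF x] .
    moreover have "e \<le> sqrt e"
    proof (rule real_le_rsqrt)
      show "e\<^sup>2 \<le> e" using mult_right_mono[of e 1 e] e by (simp add: power2_eq_square)
    qed
    ultimately show "\<bar>orthonormal_kernel (point_weight p R) (point_count p R) x y - sinc (pi * (x - y))\<bar> \<le> 20 * sqrt e"
      using gq[OF x] e unfolding point_count_eq by linarith
  qed
qed

end

theorem theorem1p3:
  fixes p :: "int \<Rightarrow> real" and A B :: "real set"
  assumes "strict_mono p"
    and "p (-1) < 0" and "0 \<le> p 0"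
    and "\<exists>L::real. ((\<lambda>S. \<Sum>n | 0 < \<bar>p n\<bar> \<and> \<bar>p n\<bar> < S. 1 / p n) \<longlongrightarrow> L) at_top"
    and "((\<lambda>n. p n / of_int n) \<longlongrightarrow> 1) at_top"
    and "((\<lambda>n. p n / of_int n) \<longlongrightarrow> 1) at_bot"
    and "compact A" and "compact B"
  shows "uniform_limit (A \<times> B)
           (\<lambda>R (x, y). orthonormal_kernel (point_weight p R) (point_count p R) x y)
           (\<lambda>(x, y). sine_kernel x y) at_top"
proof (rule uniform_limitI)
  fix e :: real assume e: "0 < e"
  obtain L where "((\<lambda>S. \<Sum>n | 0 < \<bar>p n\<bar> \<and> \<bar>p n\<bar> < S. 1 / p n) \<longlongrightarrow> L) at_top" using assms(4) by blast
  then interpret points p L by unfold_locales (use assms in auto)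
  have "bounded (A \<union> B)" using assms(7,8) by (simp add: compact_imp_bounded)
  then obtain T where T: "0 < T" "\<And>x. x \<in> A \<union> B \<Longrightarrow> norm x \<le> T" unfolding bounded_pos by blast
  \<comment> \<open>Gives 20 sqrt d \<le> e / 2, together with d \<le> 1 as
    \<open>kernel_near_sinc\<close> requires.\<close>
  define d where "d = min 1 ((e / 40)\<^sup>2)"
  have d: "0 < d" "d \<le> 1" using e by (auto simp: d_def)
  have "sqrt d \<le> sqrt ((e / 40)\<^sup>2)" by (intro real_sqrt_le_mono) (simp add: d_def)
  then have sd: "20 * sqrt d < e" using e by simp
  \<comment> \<open>Both conventions assign 1 to the removable singularity on the diagonal.\<close>
  have sk: "sine_kernel x y = sinc (pi * (x - y))" for x y by (simp add: sine_kernel_def)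
  show "\<forall>\<^sub>F R in at_top. \<forall>z\<in>A \<times> B. dist (case z of (x, y) \<Rightarrow> orthonormal_kernel (point_weight p R) (point_count p R) x y)
      (case z of (x, y) \<Rightarrow> sine_kernel x y) < e"
    using kernel_near_sinc[OF d less_imp_le[OF T(1)]]
  proof eventually_elim
    case (elim R)
    show ?case
    proof
      fix z assume "z \<in> A \<times> B"
      then obtain x y where z: "z = (x, y)" "x \<in> A" "y \<in> B" by blast
      have "\<bar>orthonormal_kernel (point_weight p R) (point_count p R) x y - sinc (pi * (x - y))\<bar> \<le> 20 * sqrt d"
        using elim T(2)[of x] T(2)[of y] z by auto
      then show "dist (case z of (x, y) \<Rightarrow> orthonormal_kernel (point_weight p R) (point_count p R) x y)
          (case z of (x, y) \<Rightarrow> sine_kernel x y) < e"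
        using sd unfolding z(1) case_prod_conv sk dist_real_def by linarith
    qed
  qed
qed

end
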